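(* Let $u$ be the solution of the parabolic problem $\partial_t u+\mathcal{L}u=f$ in $\Omega\times(0,T]$, $u(\cdot,0)=u^0$, $u=0$ on $\partial\Omega\times[0,T]$, and let the Green's function bounds (with constants $\kappa_0,\kappa_1,\kappa_1',\gamma$) stated in the context hold. Let $0=t_0<t_1<\dots<t_M=T$ be an arbitrary mesh and let $U^j\in H_0^1(\Omega)$ be the Crank-Nicolson approximations: $U^0=u^0$ and $$\frac{U^j-U^{j-1}}{\tau_j}+\frac{\mathcal{L}U^j+\mathcal{L}U^{j-1}}{2}=\frac{f^j+f^{j-1}}{2}\quad\text{in }\Omega,\qquad j=1,\dots,M.$$ Let $$\beta^j:=-4\,\frac{f^j-2f^{j-1/2}+f^{j-1}}{\tau_j^2},\qquad \tilde f(s):=\hat f(s)+\beta^j\,\frac{(t_j-s)(s-t_{j-1})}{2},\quad s\in[t_{j-1},t_j],$$ and let $q^j\in H_0^1(\Omega)$ be the unique solution of $\mathcal{L}q^j=\beta^j$, $j=1,\dots,M$. Then $$\|u(T)-U^M\|_{\infty,\Omega}\le\sum_{j=1}^M\mathrm{e}^{-\gamma(T-t_j)}\min\left\{\eta_{\hat f}^j+\eta_{\delta\psi}^j,\ \eta_{\tilde f}^j+\eta_{\delta\psi q}^j\right\},$$ where, with $\psi^j:=\mathcal{L}U^j-f^j$, $$\eta_{\hat f}^j:=\kappa_0\int_{I_j}\|(f-\hat f)(s)\|_{\infty,\Omega}\,\mathrm{d}s,\qquad \eta_{\delta\psi}^j:=\frac{\Psi_{1,j}}{2}\|\delta_t\psi^j\|_{\infty,\Omega},$$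 $$\eta_{\tilde f}^j:=\kappa_0\int_{I_j}\|(f-\tilde f)(s)\|_{\infty,\Omega}\,\mathrm{d}s,\qquad \eta_{\delta\psi q}^j:=\frac{\Psi_{1,j}}{2}\|\delta_t\psi^j-q^j\|_{\infty,\Omega},$$ and $\Psi_{1,j}:=\min\{\Phi_{1,j},\Phi_{1,j}^*\}$ with $$\Phi_{1,j}:=\kappa_1\int_{t_{j-1}}^{t_j}\frac{(t_j-s)(s-t_{j-1})}{T-s}\,\mathrm{d}s+\kappa_1'\frac{\tau_j^3}{6},\qquad \Phi_{1,j}^*:=\kappa_0\int_{t_{j-1}}^{t_j}\left|\frac{\mathrm{d}}{\mathrm{d}s}\left[(t_j-s)(s-t_{j-1})\right]\right|\mathrm{d}s.$$
   Context: Setting. $\Omega\subset\mathbb{R}^n$ is a spatial domain with Lipschitz boundary, $T>0$, $\mathcal{L}$ is a second-order linear elliptic operator in $\Omega$ with adjoint $\mathcal{L}^*$, $f\colon[0,T]\to L_2(\Omega)$, and $\mathcal{K}w:=\partial_t w+\mathcal{L}w$. The problems $\mathcal{L}q=\beta$ considered are uniquely solvable in $H_0^1(\Omega)$. For functions $w$ on $\Omega\times[0,T]$ write $w(t):=w(\cdot,t)$. $\|\cdot\|_{p,\Omega}$, $p\in[1,\infty]$, is the norm of $L_p(\Omega)$, and $\langle\cdot,\cdot\rangle$ denotes both the duality pairing on $H^{-1}(\Omega)\times H_0^1(\Omega)$ and the $L_2(\Omega)$ scalar product. Green's function. For fixed $x\in\Omega$, $\mathcal{G}$ solves $\partial_t\mathcal{G}+\mathcal{L}^*\mathcal{G}=0$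 in $\Omega\times\mathbb{R}^+$, $\mathcal{G}|_{\partial\Omega}=0$, $\mathcal{G}(0)=\delta_x$ (Dirac distribution at $x$). For all $w\in W^{1,1}([0,T],H_0^1(\Omega))$ and $t\in(0,T]$ one has $w(x,t)=\langle\mathcal{G}(t),w(0)\rangle+\int_0^t\langle\mathcal{G}(t-s),(\mathcal{K}w)(s)\rangle\,\mathrm{d}s$; the solution $u$ is assumed regular enough that this representation applies to $u$ minus a continuous function that is piecewise polynomial in time and built from the discrete approximations. Standing assumption. There are non-negative constants $\kappa_0,\kappa_1,\kappa_2,\kappa_1',\kappa_2',\gamma$ such that, with $\kappa_0'=0$, $\|\partial_t^p\mathcal{G}(t)\|_{1,\Omega}\le\left(\frac{\kappa_p}{t^p}+\kappa_p'\right)\mathrm{e}^{-\gamma t}$ for all $x\in\bar\Omega$, $t\in[0,T]$, $p=0,1,2$. Mesh notation. $I_j:=(t_{j-1},t_j)$, $\tau_j:=t_j-t_{j-1}$, $t_{j-1/2}:=t_j-\tau_j/2$; $f^j:=f(t_j)$, $f^{j-1/2}:=f(t_{j-1/2})$; $\delta_t v^j:=(v^j-v^{j-1})/\tau_j$. $\hat f$ is the piecewise linear interpolant in time of $f$ on the mesh: $\hat f(s)=f^j-(t_j-s)\,\delta_tf^j$ for $s\in[t_{j-1},t_j]$. *)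

theory Defs
  imports
    "HOL-Analysis.Analysis"
    "HOL-Probability.Essential_Supremum"
    "HOL-Computational_Algebra.Polynomial"
begin

section \<open>Domains, test functions and Sobolev spaces\<close>

text \<open>Near each boundary point, in suitable Cartesian coordinates with vertical direction \<open>e\<close>, the
  set is the strict epigraph of a Lipschitz function of the remaining coordinates. No boundedness
  is required.\<close>

definition lipschitz_boundary :: "(real ^ 'n) set \<Rightarrow> bool" where
  "lipschitz_boundary \<Omega> \<longleftrightarrow>
     (\<forall>p\<in>frontier \<Omega>. \<exists>e r g C. norm e = 1 \<and> r > 0 \<and> C-lipschitz_on UNIV g \<and>
        \<Omega> \<inter> ball p r = {x \<in> ball p r. g (x - (x \<bullet> e) *\<^sub>R e) < x \<bullet> e})"

definition lipschitz_domain :: "(real ^ 'n) set \<Rightarrow> bool" where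
  "lipschitz_domain \<Omega> \<longleftrightarrow> open \<Omega> \<and> connected \<Omega> \<and> \<Omega> \<noteq> {} \<and> lipschitz_boundary \<Omega>"

definition partial_deriv :: "'n \<Rightarrow> (real ^ 'n \<Rightarrow> real) \<Rightarrow> real ^ 'n \<Rightarrow> real" where
  "partial_deriv i \<phi> x = frechet_derivative \<phi> (at x) (axis i 1)"

primrec C_k :: "nat \<Rightarrow> (real ^ 'n \<Rightarrow> real) \<Rightarrow> bool" where
  "C_k 0 \<phi> \<longleftrightarrow> continuous_on UNIV \<phi>"
| "C_k (Suc k) \<phi> \<longleftrightarrow> (\<forall>x. \<phi> differentiable at x) \<and> (\<forall>i. C_k k (partial_deriv i \<phi>))"

definition test_functions :: "(real ^ 'n) set \<Rightarrow> (real ^ 'n \<Rightarrow> real) set" where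
  "test_functions \<Omega> =
     {\<phi>. (\<forall>k. C_k k \<phi>) \<and> compact (closure {x. \<phi> x \<noteq> 0}) \<and> closure {x. \<phi> x \<noteq> 0} \<subseteq> \<Omega>}"

text \<open>Elements of the function spaces below are functions; the usual classes are obtained by
  identifying functions that agree almost everywhere on \<open>\<Omega>\<close>.\<close>

definition L2 :: "(real ^ 'n) set \<Rightarrow> (real ^ 'n \<Rightarrow> real) set" where
  "L2 \<Omega> = {v \<in> borel_measurable (lebesgue_on \<Omega>). integrable (lebesgue_on \<Omega>) (\<lambda>x. (v x)\<^sup>2)}"

definition L2_inner :: "(real ^ 'n) set \<Rightarrow> (real ^ 'n \<Rightarrow> real) \<Rightarrow> (real ^ 'n \<Rightarrow> real) \<Rightarrow> real" where
  "L2_inner \<Omega> v w = (LINT x|lebesgue_on \<Omega>. v x * w x)"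

definition L1_norm :: "(real ^ 'n) set \<Rightarrow> (real ^ 'n \<Rightarrow> real) \<Rightarrow> ennreal" where
  "L1_norm \<Omega> v = (\<integral>\<^sup>+ x. ennreal \<bar>v x\<bar> \<partial>lebesgue_on \<Omega>)"

definition Linf_norm :: "(real ^ 'n) set \<Rightarrow> (real ^ 'n \<Rightarrow> real) \<Rightarrow> ennreal" where
  "Linf_norm \<Omega> v = esssup (lebesgue_on \<Omega>) (\<lambda>x. ennreal \<bar>v x\<bar>)"

definition weak_partial ::
    "(real ^ 'n) set \<Rightarrow> 'n \<Rightarrow> (real ^ 'n \<Rightarrow> real) \<Rightarrow> (real ^ 'n \<Rightarrow> real) \<Rightarrow> bool" where
  "weak_partial \<Omega> i v g \<longleftrightarrow> g \<in> L2 \<Omega> \<and>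
     (\<forall>\<phi>\<in>test_functions \<Omega>. L2_inner \<Omega> v (partial_deriv i \<phi>) = - L2_inner \<Omega> g \<phi>)"

definition H1 :: "(real ^ 'n) set \<Rightarrow> (real ^ 'n \<Rightarrow> real) set" where
  "H1 \<Omega> = {v \<in> L2 \<Omega>. \<forall>i. \<exists>g. weak_partial \<Omega> i v g}"

definition weak_grad :: "(real ^ 'n) set \<Rightarrow> (real ^ 'n \<Rightarrow> real) \<Rightarrow> real ^ 'n \<Rightarrow> real ^ 'n" where
  "weak_grad \<Omega> v x = (\<chi> i. (SOME g. weak_partial \<Omega> i v g) x)"

definition H1_norm :: "(real ^ 'n) set \<Rightarrow> (real ^ 'n \<Rightarrow> real) \<Rightarrow> real" where
  "H1_norm \<Omega> v = sqrt (LINT x|lebesgue_on \<Omega>. (v x)\<^sup>2 + (norm (weak_grad \<Omega> v x))\<^sup>2)"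

definition H10 :: "(real ^ 'n) set \<Rightarrow> (real ^ 'n \<Rightarrow> real) set" where
  "H10 \<Omega> = {v \<in> H1 \<Omega>. \<exists>\<phi>. (\<forall>k. \<phi> k \<in> test_functions \<Omega>) \<and>
                          (\<lambda>k. H1_norm \<Omega> (\<lambda>x. v x - \<phi> k x)) \<longlonglongrightarrow> 0}"

text \<open>Elements of \<open>H\<^sup>-\<^sup>1(\<Omega>)\<close> are functionals, so the duality pairing is function application.
  Only their values on \<open>H10 \<Omega>\<close> matter.\<close>

definition Hm1 :: "(real ^ 'n) set \<Rightarrow> ((real ^ 'n \<Rightarrow> real) \<Rightarrow> real) set" where
  "Hm1 \<Omega> = {F. (\<forall>\<phi>\<in>H10 \<Omega>. \<forall>\<omega>\<in>H10 \<Omega>. \<forall>a b. F (\<lambda>x. a * \<phi> x + b * \<omega> x) = a * F \<phi> + b * F \<omega>) \<and>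
               (\<exists>C. \<forall>\<phi>\<in>H10 \<Omega>. \<bar>F \<phi>\<bar> \<le> C * H1_norm \<Omega> \<phi>)}"

text \<open>The maximum norm of a functional is that of the function representing it, and \<open>\<infinity>\<close> if it is
  not represented by a bounded function. The representing function is unique almost everywhere,
  so the infimum only serves to return \<open>\<infinity>\<close> when there is none. Integrability of the product
  has to be asked for only because \<open>\<Omega>\<close> may have infinite measure.\<close>

definition represents ::
    "(real ^ 'n) set \<Rightarrow> (real ^ 'n \<Rightarrow> real) \<Rightarrow> ((real ^ 'n \<Rightarrow> real) \<Rightarrow> real) \<Rightarrow> bool" where
  "represents \<Omega> h F \<longleftrightarrow> h \<in> borel_measurable (lebesgue_on \<Omega>) \<and>
     (\<forall>\<phi>\<in>H10 \<Omega>. integrable (lebesgue_on \<Omega>) (\<lambda>x. h x * \<phi> x) \<longrightarrow> F \<phi> = L2_inner \<Omega> h \<phi>)"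

definition Linf_norm_dual :: "(real ^ 'n) set \<Rightarrow> ((real ^ 'n \<Rightarrow> real) \<Rightarrow> real) \<Rightarrow> ennreal" where
  "Linf_norm_dual \<Omega> F = (INF h\<in>{h. represents \<Omega> h F}. Linf_norm \<Omega> h)"

section \<open>The elliptic operator\<close>

text \<open>Coefficients of \<open>v \<mapsto> - div (A \<nabla>v + v d) + b \<cdot> \<nabla>v + c v\<close>.\<close>

record 'n coefficients =
  coeff_A :: "real ^ 'n \<Rightarrow> real ^ 'n ^ 'n"
  coeff_d :: "real ^ 'n \<Rightarrow> real ^ 'n"
  coeff_b :: "real ^ 'n \<Rightarrow> real ^ 'n"
  coeff_c :: "real ^ 'n \<Rightarrow> real"

definition elliptic :: "(real ^ 'n) set \<Rightarrow> 'n coefficients \<Rightarrow> bool" where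
  "elliptic \<Omega> P \<longleftrightarrow>
     coeff_A P \<in> borel_measurable (lebesgue_on \<Omega>) \<and> coeff_d P \<in> borel_measurable (lebesgue_on \<Omega>) \<and>
     coeff_b P \<in> borel_measurable (lebesgue_on \<Omega>) \<and> coeff_c P \<in> borel_measurable (lebesgue_on \<Omega>) \<and>
     (\<exists>C. AE x in lebesgue_on \<Omega>. norm (coeff_A P x) \<le> C \<and> norm (coeff_d P x) \<le> C \<and>
                                  norm (coeff_b P x) \<le> C \<and> \<bar>coeff_c P x\<bar> \<le> C) \<and>
     (\<exists>\<alpha>>0. AE x in lebesgue_on \<Omega>. \<forall>\<xi>. \<alpha> * (norm \<xi>)\<^sup>2 \<le> \<xi> \<bullet> (coeff_A P x *v \<xi>))"

definition ell_op ::
    "(real ^ 'n) set \<Rightarrow> 'n coefficients \<Rightarrow> (real ^ 'n \<Rightarrow> real) \<Rightarrow> (real ^ 'n \<Rightarrow> real) \<Rightarrow> real" where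
  "ell_op \<Omega> P v \<phi> = (LINT x|lebesgue_on \<Omega>.
      (coeff_A P x *v weak_grad \<Omega> v x + v x *\<^sub>R coeff_d P x) \<bullet> weak_grad \<Omega> \<phi> x
      + (coeff_b P x \<bullet> weak_grad \<Omega> v x) * \<phi> x + coeff_c P x * v x * \<phi> x)"

definition ell_op_adj ::
    "(real ^ 'n) set \<Rightarrow> 'n coefficients \<Rightarrow> (real ^ 'n \<Rightarrow> real) \<Rightarrow> (real ^ 'n \<Rightarrow> real) \<Rightarrow> real" where
  "ell_op_adj \<Omega> P v \<phi> = ell_op \<Omega> P \<phi> v"

definition elliptic_solution ::
    "(real ^ 'n) set \<Rightarrow> 'n coefficients \<Rightarrow> (real ^ 'n \<Rightarrow> real) \<Rightarrow> (real ^ 'n \<Rightarrow> real) \<Rightarrow> bool" where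
  "elliptic_solution \<Omega> P \<beta> q \<longleftrightarrow> q \<in> H10 \<Omega> \<and> (\<forall>\<phi>\<in>H10 \<Omega>. ell_op \<Omega> P q \<phi> = L2_inner \<Omega> \<beta> \<phi>)"

definition unique_elliptic_solution ::
    "(real ^ 'n) set \<Rightarrow> 'n coefficients \<Rightarrow> (real ^ 'n \<Rightarrow> real) \<Rightarrow> (real ^ 'n \<Rightarrow> real) \<Rightarrow> bool" where
  "unique_elliptic_solution \<Omega> P \<beta> q \<longleftrightarrow> elliptic_solution \<Omega> P \<beta> q \<and>
     (\<forall>r. elliptic_solution \<Omega> P \<beta> r \<longrightarrow> (AE x in lebesgue_on \<Omega>. r x = q x))"

section \<open>Functions of time\<close>

text \<open>\<open>w'\<close> is an \<open>H\<^sup>-\<^sup>1\<close>-valued weak time derivative of \<open>w\<close>, and \<open>w\<close> is its (weakly) continuous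
  representative, so that point values \<open>w t\<close> make sense.\<close>

definition time_deriv ::
    "(real ^ 'n) set \<Rightarrow> real \<Rightarrow> (real \<Rightarrow> real ^ 'n \<Rightarrow> real) \<Rightarrow>
     (real \<Rightarrow> (real ^ 'n \<Rightarrow> real) \<Rightarrow> real) \<Rightarrow> bool" where
  "time_deriv \<Omega> T w w' \<longleftrightarrow>
     (AE s in lebesgue_on {0..T}. w' s \<in> Hm1 \<Omega>) \<and>
     (\<forall>\<phi>\<in>H10 \<Omega>. integrable (lebesgue_on {0..T}) (\<lambda>s. w' s \<phi>) \<and>
        (\<forall>t\<in>{0..T}. L2_inner \<Omega> (w t) \<phi> = L2_inner \<Omega> (w 0) \<phi> + (LINT s|lebesgue_on {0..t}. w' s \<phi>)))"

definition par_op ::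
    "(real ^ 'n) set \<Rightarrow> 'n coefficients \<Rightarrow> (real \<Rightarrow> real ^ 'n \<Rightarrow> real) \<Rightarrow>
     (real \<Rightarrow> (real ^ 'n \<Rightarrow> real) \<Rightarrow> real) \<Rightarrow> real \<Rightarrow> (real ^ 'n \<Rightarrow> real) \<Rightarrow> real" where
  "par_op \<Omega> P w w' s \<phi> = w' s \<phi> + ell_op \<Omega> P (w s) \<phi>"

definition parabolic_solution ::
    "(real ^ 'n) set \<Rightarrow> 'n coefficients \<Rightarrow> real \<Rightarrow> (real \<Rightarrow> real ^ 'n \<Rightarrow> real) \<Rightarrow>
     (real ^ 'n \<Rightarrow> real) \<Rightarrow> (real \<Rightarrow> real ^ 'n \<Rightarrow> real) \<Rightarrow> bool" where
  "parabolic_solution \<Omega> P T f u0 u \<longleftrightarrow>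
     (\<forall>t\<in>{0..T}. u t \<in> H10 \<Omega>) \<and>
     (AE x in lebesgue_on \<Omega>. u 0 x = u0 x) \<and>
     (\<exists>u'. time_deriv \<Omega> T u u' \<and>
        (AE s in lebesgue_on {0..T}. \<forall>\<phi>\<in>H10 \<Omega>. par_op \<Omega> P u u' s \<phi> = L2_inner \<Omega> (f s) \<phi>))"

text \<open>Bochner measurability and integrability of maps into \<open>H\<^sub>0\<^sup>1(\<Omega>)\<close>.\<close>

definition bochner_integrable_H10 ::
    "(real ^ 'n) set \<Rightarrow> real \<Rightarrow> (real \<Rightarrow> real ^ 'n \<Rightarrow> real) \<Rightarrow> bool" where
  "bochner_integrable_H10 \<Omega> T g \<longleftrightarrow>
     (\<forall>s\<in>{0..T}. g s \<in> H10 \<Omega>) \<and>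
     (\<exists>S :: nat \<Rightarrow> real \<Rightarrow> real ^ 'n \<Rightarrow> real.
        (\<forall>k. finite (S k ` {0..T}) \<and> S k ` {0..T} \<subseteq> H10 \<Omega> \<and>
             (\<forall>v. {s \<in> {0..T}. S k s = v} \<in> sets lebesgue)) \<and>
        (AE s in lebesgue_on {0..T}. (\<lambda>k. H1_norm \<Omega> (\<lambda>x. S k s x - g s x)) \<longlonglongrightarrow> 0)) \<and>
     integrable (lebesgue_on {0..T}) (\<lambda>s. H1_norm \<Omega> (g s))"

text \<open>\<open>W\<^sup>1\<^sup>,\<^sup>1([0,T], H\<^sub>0\<^sup>1(\<Omega>))\<close>, continuous representatives: \<open>w t = w 0 + \<integral>\<^sub>0\<^sup>t g\<close>. Testing with
  \<open>L\<^sub>2\<close> functions determines the Bochner integral.\<close>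

definition W11_H10 ::
    "(real ^ 'n) set \<Rightarrow> real \<Rightarrow> (real \<Rightarrow> real ^ 'n \<Rightarrow> real) set" where
  "W11_H10 \<Omega> T = {w. (\<forall>t\<in>{0..T}. w t \<in> H10 \<Omega>) \<and>
     (\<exists>g. bochner_integrable_H10 \<Omega> T g \<and>
        (\<forall>\<phi>\<in>L2 \<Omega>. \<forall>t\<in>{0..T}.
           L2_inner \<Omega> (w t) \<phi> = L2_inner \<Omega> (w 0) \<phi> + (LINT s|lebesgue_on {0..t}. L2_inner \<Omega> (g s) \<phi>)))}"

section \<open>The Green's function\<close>

text \<open>\<open>G x t y\<close> is the value at \<open>y\<close>, at time \<open>t\<close>, of the Green's function with source point \<open>x\<close>.\<close>

definition green_dt ::
    "nat \<Rightarrow> (real ^ 'n \<Rightarrow> real \<Rightarrow> real ^ 'n \<Rightarrow> real) \<Rightarrow> real ^ 'n \<Rightarrow> real \<Rightarrow> real ^ 'n \<Rightarrow> real" where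
  "green_dt p G x t y = (deriv ^^ p) (\<lambda>\<tau>. G x \<tau> y) t"

definition green_function ::
    "(real ^ 'n) set \<Rightarrow> 'n coefficients \<Rightarrow> (real ^ 'n \<Rightarrow> real \<Rightarrow> real ^ 'n \<Rightarrow> real) \<Rightarrow> bool" where
  "green_function \<Omega> P G \<longleftrightarrow> (\<forall>x\<in>\<Omega>.
     (\<forall>t>0. G x t \<in> H10 \<Omega>) \<and>
     (AE y in lebesgue_on \<Omega>. \<forall>p<2. \<forall>t>0. (\<lambda>\<tau>. green_dt p G x \<tau> y) differentiable at t) \<and>
     (\<forall>t>0. \<forall>\<phi>\<in>test_functions \<Omega>.
        integrable (lebesgue_on \<Omega>) (\<lambda>y. green_dt 1 G x t y * \<phi> y) \<and>
        L2_inner \<Omega> (green_dt 1 G x t) \<phi> + ell_op_adj \<Omega> P (G x t) \<phi> = 0) \<and>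
     (\<forall>\<phi>\<in>test_functions \<Omega>. ((\<lambda>t. L2_inner \<Omega> (G x t) \<phi>) \<longlongrightarrow> \<phi> x) (at_right 0)))"

text \<open>The representation formula, for almost every \<open>x\<close> because \<open>w t\<close> is only defined almost
  everywhere. The derivative \<open>w'\<close> is determined up to a null set of times.\<close>

definition green_representation ::
    "(real ^ 'n) set \<Rightarrow> 'n coefficients \<Rightarrow> real \<Rightarrow> (real ^ 'n \<Rightarrow> real \<Rightarrow> real ^ 'n \<Rightarrow> real) \<Rightarrow>
     (real \<Rightarrow> real ^ 'n \<Rightarrow> real) \<Rightarrow> bool" where
  "green_representation \<Omega> P T G w \<longleftrightarrow>
     (\<forall>w'. time_deriv \<Omega> T w w' \<longrightarrow>
       (\<forall>t\<in>{0<..T}. AE x in lebesgue_on \<Omega>.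
          integrable (lebesgue_on {0<..<t}) (\<lambda>s. par_op \<Omega> P w w' s (G x (t - s))) \<and>
          w t x = L2_inner \<Omega> (G x t) (w 0)
                  + (LINT s|lebesgue_on {0<..<t}. par_op \<Omega> P w w' s (G x (t - s)))))"

text \<open>At \<open>t = 0\<close> the Green's function is not a function, so the bounds are stated for \<open>t > 0\<close>.\<close>

definition green_bounds ::
    "(real ^ 'n) set \<Rightarrow> real \<Rightarrow> (real ^ 'n \<Rightarrow> real \<Rightarrow> real ^ 'n \<Rightarrow> real) \<Rightarrow>
     (nat \<Rightarrow> real) \<Rightarrow> (nat \<Rightarrow> real) \<Rightarrow> real \<Rightarrow> bool" where
  "green_bounds \<Omega> T G \<kappa> \<kappa>' \<gamma> \<longleftrightarrow>
     (\<forall>p\<le>2. \<kappa> p \<ge> 0 \<and> \<kappa>' p \<ge> 0) \<and> \<kappa>' 0 = 0 \<and> \<gamma> \<ge> 0 \<and>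
     (\<forall>x\<in>\<Omega>. \<forall>t\<in>{0<..T}. \<forall>p\<le>2.
        L1_norm \<Omega> (green_dt p G x t) \<le> ennreal ((\<kappa> p / t ^ p + \<kappa>' p) * exp (- \<gamma> * t)))"

section \<open>Mesh quantities\<close>

definition mesh :: "real \<Rightarrow> nat \<Rightarrow> (nat \<Rightarrow> real) \<Rightarrow> bool" where
  "mesh T M t \<longleftrightarrow> t 0 = 0 \<and> t M = T \<and> strict_mono_on {0..M} t"

definition step :: "(nat \<Rightarrow> real) \<Rightarrow> nat \<Rightarrow> real" where
  "step t j = t j - t (j - 1)"

definition midpt :: "(nat \<Rightarrow> real) \<Rightarrow> nat \<Rightarrow> real" where
  "midpt t j = t j - step t j / 2"

definition continuous_pw_poly :: "nat \<Rightarrow> (nat \<Rightarrow> real) \<Rightarrow> (real \<Rightarrow> real) \<Rightarrow> bool" where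
  "continuous_pw_poly M t a \<longleftrightarrow> continuous_on {t 0..t M} a \<and>
     (\<forall>j\<in>{1..M}. \<exists>p :: real poly. \<forall>s\<in>{t (j - 1)..t j}. a s = poly p s)"

definition reconstructions ::
    "nat \<Rightarrow> (nat \<Rightarrow> real) \<Rightarrow> (nat \<Rightarrow> real ^ 'n \<Rightarrow> real) \<Rightarrow> (nat \<Rightarrow> real ^ 'n \<Rightarrow> real) \<Rightarrow>
     (real \<Rightarrow> real ^ 'n \<Rightarrow> real) set" where
  "reconstructions M t U q =
     {v. \<exists>a b. (\<forall>i. continuous_pw_poly M t (a i) \<and> continuous_pw_poly M t (b i)) \<and>
           v = (\<lambda>s x. (\<Sum>i=0..M. a i s * U i x) + (\<Sum>i=1..M. b i s * q i x))}"

definition f_hat ::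
    "(nat \<Rightarrow> real) \<Rightarrow> (real \<Rightarrow> real ^ 'n \<Rightarrow> real) \<Rightarrow> nat \<Rightarrow> real \<Rightarrow> real ^ 'n \<Rightarrow> real" where
  "f_hat t f j s x = f (t j) x - (t j - s) * ((f (t j) x - f (t (j - 1)) x) / step t j)"

definition beta ::
    "(nat \<Rightarrow> real) \<Rightarrow> (real \<Rightarrow> real ^ 'n \<Rightarrow> real) \<Rightarrow> nat \<Rightarrow> real ^ 'n \<Rightarrow> real" where
  "beta t f j x = - 4 * ((f (t j) x - 2 * f (midpt t j) x + f (t (j - 1)) x) / (step t j)\<^sup>2)"

definition f_tilde ::
    "(nat \<Rightarrow> real) \<Rightarrow> (real \<Rightarrow> real ^ 'n \<Rightarrow> real) \<Rightarrow> nat \<Rightarrow> real \<Rightarrow> real ^ 'n \<Rightarrow> real" where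
  "f_tilde t f j s x = f_hat t f j s x + beta t f j x * ((t j - s) * (s - t (j - 1)) / 2)"

definition crank_nicolson ::
    "(real ^ 'n) set \<Rightarrow> 'n coefficients \<Rightarrow> (real \<Rightarrow> real ^ 'n \<Rightarrow> real) \<Rightarrow> (real ^ 'n \<Rightarrow> real) \<Rightarrow>
     nat \<Rightarrow> (nat \<Rightarrow> real) \<Rightarrow> (nat \<Rightarrow> real ^ 'n \<Rightarrow> real) \<Rightarrow> bool" where
  "crank_nicolson \<Omega> P f u0 M t U \<longleftrightarrow>
     (\<forall>j\<in>{0..M}. U j \<in> H10 \<Omega>) \<and>
     (AE x in lebesgue_on \<Omega>. U 0 x = u0 x) \<and>
     (\<forall>j\<in>{1..M}. \<forall>\<phi>\<in>H10 \<Omega>.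
        L2_inner \<Omega> (\<lambda>x. (U j x - U (j - 1) x) / step t j) \<phi>
        + (ell_op \<Omega> P (U j) \<phi> + ell_op \<Omega> P (U (j - 1)) \<phi>) / 2
        = L2_inner \<Omega> (\<lambda>x. (f (t j) x + f (t (j - 1)) x) / 2) \<phi>)"

definition psi ::
    "(real ^ 'n) set \<Rightarrow> 'n coefficients \<Rightarrow> (real \<Rightarrow> real ^ 'n \<Rightarrow> real) \<Rightarrow> (nat \<Rightarrow> real) \<Rightarrow>
     (nat \<Rightarrow> real ^ 'n \<Rightarrow> real) \<Rightarrow> nat \<Rightarrow> (real ^ 'n \<Rightarrow> real) \<Rightarrow> real" where
  "psi \<Omega> P f t U j \<phi> = ell_op \<Omega> P (U j) \<phi> - L2_inner \<Omega> (f (t j)) \<phi>"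

definition delta_psi ::
    "(real ^ 'n) set \<Rightarrow> 'n coefficients \<Rightarrow> (real \<Rightarrow> real ^ 'n \<Rightarrow> real) \<Rightarrow> (nat \<Rightarrow> real) \<Rightarrow>
     (nat \<Rightarrow> real ^ 'n \<Rightarrow> real) \<Rightarrow> nat \<Rightarrow> (real ^ 'n \<Rightarrow> real) \<Rightarrow> real" where
  "delta_psi \<Omega> P f t U j \<phi> = (psi \<Omega> P f t U j \<phi> - psi \<Omega> P f t U (j - 1) \<phi>) / step t j"

section \<open>Error estimators\<close>

definition Phi1 :: "(nat \<Rightarrow> real) \<Rightarrow> (nat \<Rightarrow> real) \<Rightarrow> real \<Rightarrow> (nat \<Rightarrow> real) \<Rightarrow> nat \<Rightarrow> real" where
  "Phi1 \<kappa> \<kappa>' T t j =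
     \<kappa> 1 * integral {t (j - 1)..t j} (\<lambda>s. (t j - s) * (s - t (j - 1)) / (T - s))
     + \<kappa>' 1 * ((step t j) ^ 3 / 6)"

definition Phi1_star :: "(nat \<Rightarrow> real) \<Rightarrow> (nat \<Rightarrow> real) \<Rightarrow> nat \<Rightarrow> real" where
  "Phi1_star \<kappa> t j =
     \<kappa> 0 * integral {t (j - 1)..t j} (\<lambda>s. \<bar>deriv (\<lambda>r. (t j - r) * (r - t (j - 1))) s\<bar>)"

definition Psi1 :: "(nat \<Rightarrow> real) \<Rightarrow> (nat \<Rightarrow> real) \<Rightarrow> real \<Rightarrow> (nat \<Rightarrow> real) \<Rightarrow> nat \<Rightarrow> real" where
  "Psi1 \<kappa> \<kappa>' T t j = min (Phi1 \<kappa> \<kappa>' T t j) (Phi1_star \<kappa> t j)"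

text \<open>The estimators take values in \<open>[0,\<infinity>]\<close>, with \<open>0 * \<infinity> = 0\<close>. They are \<open>\<infinity>\<close> when the
  (nonzero) prefactor multiplies the maximum norm of something unbounded, so no boundedness of
  \<open>f\<close> or of the discrete residuals has to be assumed.\<close>

definition eta_f_hat ::
    "(real ^ 'n) set \<Rightarrow> (nat \<Rightarrow> real) \<Rightarrow> (real \<Rightarrow> real ^ 'n \<Rightarrow> real) \<Rightarrow> (nat \<Rightarrow> real) \<Rightarrow> nat \<Rightarrow> ennreal"
  where
  "eta_f_hat \<Omega> \<kappa> f t j = ennreal (\<kappa> 0) *
     (\<integral>\<^sup>+ s. Linf_norm \<Omega> (\<lambda>x. f s x - f_hat t f j s x) \<partial>lebesgue_on {t (j - 1)<..<t j})"

definition eta_f_tilde ::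
    "(real ^ 'n) set \<Rightarrow> (nat \<Rightarrow> real) \<Rightarrow> (real \<Rightarrow> real ^ 'n \<Rightarrow> real) \<Rightarrow> (nat \<Rightarrow> real) \<Rightarrow> nat \<Rightarrow> ennreal"
  where
  "eta_f_tilde \<Omega> \<kappa> f t j = ennreal (\<kappa> 0) *
     (\<integral>\<^sup>+ s. Linf_norm \<Omega> (\<lambda>x. f s x - f_tilde t f j s x) \<partial>lebesgue_on {t (j - 1)<..<t j})"

definition eta_delta_psi ::
    "(real ^ 'n) set \<Rightarrow> 'n coefficients \<Rightarrow> (nat \<Rightarrow> real) \<Rightarrow> (nat \<Rightarrow> real) \<Rightarrow> real \<Rightarrow>
     (real \<Rightarrow> real ^ 'n \<Rightarrow> real) \<Rightarrow> (nat \<Rightarrow> real) \<Rightarrow> (nat \<Rightarrow> real ^ 'n \<Rightarrow> real) \<Rightarrow> nat \<Rightarrow> ennreal"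
  where
  "eta_delta_psi \<Omega> P \<kappa> \<kappa>' T f t U j =
     ennreal (Psi1 \<kappa> \<kappa>' T t j / 2) * Linf_norm_dual \<Omega> (delta_psi \<Omega> P f t U j)"

definition eta_delta_psi_q ::
    "(real ^ 'n) set \<Rightarrow> 'n coefficients \<Rightarrow> (nat \<Rightarrow> real) \<Rightarrow> (nat \<Rightarrow> real) \<Rightarrow> real \<Rightarrow>
     (real \<Rightarrow> real ^ 'n \<Rightarrow> real) \<Rightarrow> (nat \<Rightarrow> real) \<Rightarrow> (nat \<Rightarrow> real ^ 'n \<Rightarrow> real) \<Rightarrow>
     (nat \<Rightarrow> real ^ 'n \<Rightarrow> real) \<Rightarrow> nat \<Rightarrow> ennreal"
  where
  "eta_delta_psi_q \<Omega> P \<kappa> \<kappa>' T f t U q j =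
     ennreal (Psi1 \<kappa> \<kappa>' T t j / 2) *
     Linf_norm_dual \<Omega> (\<lambda>\<phi>. delta_psi \<Omega> P f t U j \<phi> - L2_inner \<Omega> (q j) \<phi>)"

end

theory Submission
  imports Defs
begin

text \<open>Join the Crank--Nicolson values by a continuous function of time \<open>v\<close>: the piecewise linear
interpolant of the \<open>U\<^sup>j\<close>, to which the bubble \<open>q\<^sup>j (t\<^sub>j - s)(s - t\<^sub>j\<^sub>-\<^sub>1) / 2\<close> is added on those intervals where the
second of the two competing estimators is the smaller one. Since the intervals are independent of
each other, this choice produces the minimum in the estimate.

The scheme says precisely that on the \<open>j\<close>-th interval, with midpoint \<open>m\<close>,
\<open>K v = F + (s - m) D\<close> with \<open>K v = \<partial>\<^sub>t v + \<L> v\<close>, where \<open>F\<close> is the corresponding time interpolant of \<open>f\<close> and \<open>D\<close> is the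
functional \<open>\<delta>\<^sub>t\<psi>\<^sup>j\<close>, respectively \<open>\<delta>\<^sub>t\<psi>\<^sup>j - q\<^sup>j\<close> (\<open>residual_identity\<close>). The Green function
representation of \<open>w = u - v\<close>, whose initial value vanishes, therefore writes the error at \<open>(x,T)\<close> as
the sum over the intervals of
\<open>\<integral> \<langle>f(s) - F(s), G(T - s)\<rangle> ds - \<integral> (s - m) \<langle>D, G(T - s)\<rangle> ds\<close>.
The first integral is bounded with \<open>\<parallel>G(T - s)\<parallel>\<^sub>1 \<le> \<kappa>\<^sub>0 e\<^sup>-\<^sup>\<gamma>\<^sup>(\<^sup>T\<^sup>-\<^sup>s\<^sup>)\<close>. The same bound in the second one gives
\<open>\<Phi>\<^sub>1\<^sup>*\<close>, because \<open>s - m\<close> is minus one half of the derivative of \<open>(t\<^sub>j - s)(s - t\<^sub>j\<^sub>-\<^sub>1)\<close>. The bound with \<open>\<Phi>\<^sub>1\<close>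
comes from the time derivative of \<open>G\<close>, in the spirit of an integration by parts. It is obtained
without differentiating under the pairing: up to the exponential factor, \<open>G\<close> varies in \<open>L\<^sub>1\<close> at most as much as the scalar
function \<open>\<beta>(s) = - \<kappa>\<^sub>1 ln (T - s) - \<kappa>\<^sub>1' (T - s)\<close> does (\<open>green_increment_L1\<close>), and among functions
with such a variation the weight \<open>s - m\<close> is integrated to the largest value by \<open>\<beta>\<close> itself
(\<open>integral_midpoint_weight_le\<close>); only the explicit \<open>\<beta>\<close> is then integrated by parts.

Evaluating the elliptic form on \<open>u - v\<close> needs its linearity. Weak gradients are picked by a choice
operator, so linearity rests on their uniqueness almost everywhere
(\<open>fundamental_lemma_calculus_of_variations\<close>), for which enough smooth compactly supported functions
have to be constructed. The same uniqueness shows that \<open>D\<close> only depends on the class of its argument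
modulo null sets; this settles the degenerate case of a vanishing prefactor, where \<open>D\<close> need not be
represented by a bounded function but \<open>\<langle>D, G(T - s)\<rangle>\<close> is constant in \<open>s\<close>.\<close>

section \<open>Smooth bump functions\<close>

lemma partial_deriv_eqI:
  assumes "(\<phi> has_derivative D) (at x)"
  shows "partial_deriv i \<phi> x = D (axis i 1)"
  unfolding partial_deriv_def using frechet_derivative_at[OF assms] by simp

lemma C_k_imp_continuous_on: "C_k k \<phi> \<Longrightarrow> continuous_on UNIV \<phi>"
  by (cases k) (auto simp: continuous_on_eq_continuous_at intro: differentiable_imp_continuous_within)

lemma C_k_antimono_Suc: "C_k (Suc k) \<phi> \<Longrightarrow> C_k k \<phi>"
proof (induction k arbitrary: \<phi>)
  case 0
  then show ?case
    by (metis C_k_imp_continuous_on C_k.simps(1))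
next
  case (Suc k)
  then show ?case by (simp only: C_k.simps) blast
qed

lemma C_k_const: "C_k k (\<lambda>_ :: real ^ 'n. a)"
proof (induction k arbitrary: a)
  case (Suc k)
  have "partial_deriv i (\<lambda>_ :: real ^ 'n. a) = (\<lambda>_. 0)" for i
    by (rule ext) (simp add: partial_deriv_eqI[OF has_derivative_const])
  with Suc show ?case by simp
qed simp

lemma C_k_add: "C_k k \<phi> \<Longrightarrow> C_k k \<omega> \<Longrightarrow> C_k k (\<lambda>x. \<phi> x + \<omega> x)"
proof (induction k arbitrary: \<phi> \<omega>)
  case (Suc k)
  have "partial_deriv i (\<lambda>x. \<phi> x + \<omega> x) = (\<lambda>x. partial_deriv i \<phi> x + partial_deriv i \<omega> x)" for i
  proof
    fix x
    have "(\<phi> has_derivative frechet_derivative \<phi> (at x)) (at x)"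
      "(\<omega> has_derivative frechet_derivative \<omega> (at x)) (at x)"
      using Suc.prems by (auto simp flip: frechet_derivative_works)
    from partial_deriv_eqI[OF has_derivative_add[OF this]]
    show "partial_deriv i (\<lambda>x. \<phi> x + \<omega> x) x = partial_deriv i \<phi> x + partial_deriv i \<omega> x"
      by (simp add: partial_deriv_def)
  qed
  with Suc show ?case by simp
qed (simp add: continuous_on_add)

lemma C_k_mult: "C_k k \<phi> \<Longrightarrow> C_k k \<omega> \<Longrightarrow> C_k k (\<lambda>x. \<phi> x * \<omega> x)"
proof (induction k arbitrary: \<phi> \<omega>)
  case (Suc k)
  have "partial_deriv i (\<lambda>x. \<phi> x * \<omega> x)
      = (\<lambda>x. \<phi> x * partial_deriv i \<omega> x + partial_deriv i \<phi> x * \<omega> x)" for i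
  proof
    fix x
    have "(\<phi> has_derivative frechet_derivative \<phi> (at x)) (at x)"
      "(\<omega> has_derivative frechet_derivative \<omega> (at x)) (at x)"
      using Suc.prems by (auto simp flip: frechet_derivative_works)
    from partial_deriv_eqI[OF has_derivative_mult[OF this]]
    show "partial_deriv i (\<lambda>x. \<phi> x * \<omega> x) x = \<phi> x * partial_deriv i \<omega> x + partial_deriv i \<phi> x * \<omega> x"
      by (simp add: partial_deriv_def)
  qed
  moreover have "C_k k \<phi>" "C_k k \<omega>" using Suc.prems by (blast intro: C_k_antimono_Suc)+
  ultimately show ?case using Suc by (simp add: C_k_add)
qed (simp add: continuous_on_mult)

lemma C_k_prod:
  assumes "finite I" "\<And>i. i \<in> I \<Longrightarrow> C_k k (\<phi> i)"
  shows "C_k k (\<lambda>x. \<Prod>i\<in>I. \<phi> i x)"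
  using assms by (induction I rule: finite_induct) (auto simp: C_k_const C_k_mult)

text \<open>Every derivative of the cutoff \<open>y \<mapsto> exp (- 1 / y)\<close> is of the form \<open>p(1/y) exp (- 1 / y)\<close> with a
polynomial \<open>p\<close>, extended by zero. Carrying \<open>p\<close> along as a parameter makes the family closed
under differentiation.\<close>

definition exp_cutoff :: "real poly \<Rightarrow> real \<Rightarrow> real" where
  "exp_cutoff p y = (if y > 0 then poly p (1 / y) * exp (- (1 / y)) else 0)"

text \<open>The induction over the coefficients raises the degree of the remaining factor, hence the extra
power in the inductive claim.\<close>

lemma poly_times_exp_minus_tendsto_0:
  fixes p :: "real poly"
  shows "((\<lambda>z. poly p z * exp (- z)) \<longlongrightarrow> 0) at_top"
proof -
  have "((\<lambda>z. z ^ n * poly p z * exp (- z)) \<longlongrightarrow> 0) at_top" for n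
  proof (induction p arbitrary: n)
    case (pCons a p)
    have "((\<lambda>z. a * (z ^ n / exp z) + z ^ Suc n * poly p z * exp (- z)) \<longlongrightarrow> a * 0 + 0) at_top"
      by (intro tendsto_intros tendsto_power_div_exp_0 pCons.IH)
    then show ?case by (simp add: field_simps exp_minus)
  qed simp
  from this[of 0] show ?thesis by simp
qed

lemma exp_cutoff_tendsto_0: "((exp_cutoff p) \<longlongrightarrow> 0) (at 0)"
  unfolding filterlim_at_split
proof
  show "((exp_cutoff p) \<longlongrightarrow> 0) (at_left 0)"
    by (rule tendsto_eventually)
      (auto simp: exp_cutoff_def eventually_at_left_field intro!: exI[of _ "-1"])
  have "((\<lambda>y. poly p (1 / y) * exp (- (1 / y))) \<longlongrightarrow> 0) (at_right 0)"
    by (rule filterlim_compose[OF poly_times_exp_minus_tendsto_0])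
      (simp add: filterlim_inverse_at_top_right divide_inverse)
  then show "((exp_cutoff p) \<longlongrightarrow> 0) (at_right 0)"
    by (rule Lim_transform_eventually)
      (auto simp: exp_cutoff_def eventually_at_right_field intro!: exI[of _ 1])
qed

lemma exp_cutoff_has_derivative:
  "((exp_cutoff p) has_real_derivative exp_cutoff ([:0, 0, 1:] * (p - pderiv p)) y) (at y)"
proof -
  consider "y > 0" | "y < 0" | "y = 0" by linarith
  then show ?thesis
  proof cases
    case 1
    have "((\<lambda>y. poly p (1 / y) * exp (- (1 / y))) has_real_derivative
        exp_cutoff ([:0, 0, 1:] * (p - pderiv p)) y) (at y)"
      using 1 unfolding exp_cutoff_def
      by (auto intro!: derivative_eq_intros simp: field_simps power2_eq_square)
    then show ?thesis
      by (rule has_field_derivative_transform_within_open[of _ _ _ "{0<..}"])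
        (use 1 in \<open>auto simp: exp_cutoff_def\<close>)
  next
    case 2
    have "((\<lambda>_. 0) has_real_derivative exp_cutoff ([:0, 0, 1:] * (p - pderiv p)) y) (at y)"
      using 2 by (simp add: exp_cutoff_def)
    then show ?thesis
      by (rule has_field_derivative_transform_within_open[of _ _ _ "{..<0}"])
        (use 2 in \<open>auto simp: exp_cutoff_def\<close>)
  next
    case 3
    have "(exp_cutoff p h - exp_cutoff p 0) / h = exp_cutoff ([:0, 1:] * p) h" for h
      by (simp add: exp_cutoff_def)
    then have "((\<lambda>h. (exp_cutoff p (0 + h) - exp_cutoff p 0) / h) \<longlongrightarrow> 0) (at 0)"
      using exp_cutoff_tendsto_0[of "[:0, 1:] * p"] by (simp only: add_0_left)
    moreover have "exp_cutoff ([:0, 0, 1:] * (p - pderiv p)) 0 = 0" by (simp add: exp_cutoff_def)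
    ultimately show ?thesis using 3 by (simp only: DERIV_def)
  qed
qed

text \<open>Differentiating in a coordinate direction reproduces a function of the same kind up to a constant
factor, so the induction on the order of smoothness runs over all \<open>p\<close> at once.\<close>

lemma C_k_exp_cutoff: "C_k k (\<lambda>x :: real ^ 'n. exp_cutoff p (c * x $ i + d))"
proof (induction k arbitrary: p)
  case 0
  have "continuous_on UNIV (exp_cutoff p)"
    by (auto simp: continuous_on_eq_continuous_at intro: DERIV_isCont exp_cutoff_has_derivative)
  from continuous_on_compose2[OF this, of UNIV "\<lambda>x. c * x $ i + d"] show ?case
    by (simp add: continuous_intros)
next
  case (Suc k)
  define p' where "p' = [:0, 0, 1:] * (p - pderiv p)"
  have D: "((\<lambda>x :: real ^ 'n. exp_cutoff p (c * x $ i + d)) has_derivative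
     (\<lambda>h. exp_cutoff p' (c * x $ i + d) * (c * h $ i))) (at x)" for x
  proof -
    have "((\<lambda>x :: real ^ 'n. c * x $ i + d) has_derivative (\<lambda>h. c * h $ i)) (at x)"
      by (auto intro!: derivative_eq_intros bounded_linear.has_derivative[OF bounded_linear_vec_nth])
    moreover have "((exp_cutoff p) has_derivative (\<lambda>h. exp_cutoff p' (c * x $ i + d) * h))
        (at (c * x $ i + d))"
      using exp_cutoff_has_derivative[of p "c * x $ i + d"]
      unfolding has_field_derivative_def p'_def .
    ultimately show ?thesis by (rule has_derivative_compose)
  qed
  have "partial_deriv l (\<lambda>x :: real ^ 'n. exp_cutoff p (c * x $ i + d))
     = (\<lambda>x. (if l = i then c else 0) * exp_cutoff p' (c * x $ i + d))" for l
    by (rule ext) (simp add: partial_deriv_eqI[OF D] axis_def)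
  moreover have "C_k k (\<lambda>x :: real ^ 'n. (if l = i then c else 0) * exp_cutoff p' (c * x $ i + d))" for l
    by (intro C_k_mult C_k_const Suc.IH)
  ultimately show ?case using D by (auto simp: differentiable_def)
qed

text \<open>Smooth functions of the form \<open>exp (- 1 / (c (x\<^sub>i - a\<^sub>i)) - 1 / (c (b\<^sub>i - x\<^sub>i)))\<close>, multiplied over
\<open>i\<close>, rise to the indicator of the box as \<open>c\<close> tends to infinity. Bounded pointwise convergence is all
that dominated convergence needs below.\<close>

lemma box_indicator_limit_of_test_functions:
  fixes a b :: "real ^ 'n"
  assumes "cbox a b \<subseteq> \<Omega>"
  obtains \<phi> :: "nat \<Rightarrow> real ^ 'n \<Rightarrow> real" where
    "\<And>n. \<phi> n \<in> test_functions \<Omega>"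
    "\<And>n x. \<bar>\<phi> n x\<bar> \<le> indicator (cbox a b) x"
    "\<And>x. (\<lambda>n. \<phi> n x) \<longlonglongrightarrow> indicator (box a b) x"
proof -
  define \<phi> where "\<phi> n x = (\<Prod>i\<in>UNIV. exp_cutoff 1 (real (Suc n) * x $ i + - (real (Suc n) * a $ i))
      * exp_cutoff 1 (- real (Suc n) * x $ i + real (Suc n) * b $ i))" for n and x :: "real ^ 'n"
  have cut: "0 \<le> exp_cutoff 1 y" "exp_cutoff 1 y \<le> 1" "exp_cutoff 1 y \<noteq> 0 \<longleftrightarrow> y > 0" for y
    by (auto simp: exp_cutoff_def)
  have fac: "real (Suc n) * r + - (real (Suc n) * s) = real (Suc n) * (r - s)"
    "- real (Suc n) * r + real (Suc n) * s = real (Suc n) * (s - r)" for n r s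
    by (simp_all add: algebra_simps)
  have zero: "\<phi> n x = 0" if "x \<notin> box a b" for n x
  proof -
    have "\<not> (\<forall>i. a $ i < x $ i \<and> x $ i < b $ i)"
      using that unfolding mem_box_cart .
    then obtain i where "x $ i \<le> a $ i \<or> b $ i \<le> x $ i"
      by (auto simp: not_less)
    then show ?thesis unfolding \<phi>_def fac
      by (intro prod_zero bexI[of _ i]) (auto simp: exp_cutoff_def zero_less_mult_iff)
  qed
  have bd: "0 \<le> \<phi> n x" "\<phi> n x \<le> 1" for n x
    unfolding \<phi>_def by (auto intro!: prod_nonneg prod_le_1 mult_nonneg_nonneg mult_le_one simp: cut)
  have sub: "box a b \<subseteq> cbox a b" by (rule box_subset_cbox)
  have lim: "(\<lambda>n. exp_cutoff 1 (real (Suc n) * y)) \<longlonglongrightarrow> 1" if "y > 0" for y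
  proof -
    have "(\<lambda>n. exp (- (1 / (real (Suc n) * y)))) \<longlonglongrightarrow> 1"
    proof -
      have "(\<lambda>n. exp (- (inverse (real (Suc n)) * (1/y)))) \<longlonglongrightarrow> exp (- (0 * (1/y)))"
        by (intro tendsto_intros LIMSEQ_inverse_real_of_nat)
      then show ?thesis by (simp add: field_simps)
    qed
    moreover have "exp_cutoff 1 (real (Suc n) * y) = exp (- (1 / (real (Suc n) * y)))" for n
      using that by (simp add: exp_cutoff_def del: of_nat_Suc)
    ultimately show ?thesis by simp
  qed
  show ?thesis
  proof
    fix n
    have clo: "closure {x. \<phi> n x \<noteq> 0} \<subseteq> cbox a b"
      using zero sub by (intro closure_minimal closed_cbox) blast
    have "compact (closure {x. \<phi> n x \<noteq> 0})"
      using clo bounded_subset[OF bounded_cbox] by (simp add: compact_eq_bounded_closed)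
    moreover have "C_k k (\<phi> n)" for k
      unfolding \<phi>_def by (intro C_k_prod C_k_mult C_k_exp_cutoff) auto
    ultimately show "\<phi> n \<in> test_functions \<Omega>"
      using clo assms by (auto simp: test_functions_def)
  next
    fix n x
    show "\<bar>\<phi> n x\<bar> \<le> indicator (cbox a b) x"
      using zero[of x n] bd[of n x] sub by (auto simp: indicator_def)
  next
    fix x
    show "(\<lambda>n. \<phi> n x) \<longlonglongrightarrow> indicator (box a b) x"
    proof (cases "x \<in> box a b")
      case True
      have "(\<lambda>n. \<phi> n x) \<longlonglongrightarrow> (\<Prod>i\<in>(UNIV::'n set). 1 * 1)"
        unfolding \<phi>_def fac using True
        by (intro tendsto_intros lim) (auto simp: mem_box_cart)
      then show ?thesis using True by simp
    qed (simp add: zero)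
  qed
qed

section \<open>Square integrable functions and test functions\<close>

lemma L2_measurable: "v \<in> L2 \<Omega> \<Longrightarrow> v \<in> borel_measurable (lebesgue_on \<Omega>)"
  by (simp add: L2_def)

lemma integrable_bounded_times_L2_L2:
  assumes v: "v \<in> L2 \<Omega>" and w: "w \<in> L2 \<Omega>"
    and m: "m \<in> borel_measurable (lebesgue_on \<Omega>)" "AE x in lebesgue_on \<Omega>. \<bar>m x\<bar> \<le> C"
  shows "integrable (lebesgue_on \<Omega>) (\<lambda>x. m x * v x * w x)"
proof (rule Bochner_Integration.integrable_bound)
  show "integrable (lebesgue_on \<Omega>) (\<lambda>x. C * ((v x)\<^sup>2 + (w x)\<^sup>2))"
    using v w by (simp add: L2_def)
  show "(\<lambda>x. m x * v x * w x) \<in> borel_measurable (lebesgue_on \<Omega>)"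
    using m(1) L2_measurable[OF v] L2_measurable[OF w] by simp
  show "AE x in lebesgue_on \<Omega>. norm (m x * v x * w x) \<le> norm (C * ((v x)\<^sup>2 + (w x)\<^sup>2))"
    using m(2)
  proof eventually_elim
    case (elim x)
    have "2 * \<bar>v x\<bar> * \<bar>w x\<bar> \<le> (v x)\<^sup>2 + (w x)\<^sup>2"
      using sum_squares_bound[of "\<bar>v x\<bar>" "\<bar>w x\<bar>"] by simp
    moreover have "0 \<le> \<bar>v x\<bar> * \<bar>w x\<bar>" by simp
    ultimately have "\<bar>v x\<bar> * \<bar>w x\<bar> \<le> (v x)\<^sup>2 + (w x)\<^sup>2" by linarith
    then have "\<bar>m x\<bar> * (\<bar>v x\<bar> * \<bar>w x\<bar>) \<le> C * ((v x)\<^sup>2 + (w x)\<^sup>2)"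
      using elim by (intro mult_mono) auto
    also have "\<dots> \<le> norm (C * ((v x)\<^sup>2 + (w x)\<^sup>2))" by simp
    finally show ?case by (simp add: abs_mult mult.assoc)
  qed
qed

lemma integrable_L2_times_L2:
  "v \<in> L2 \<Omega> \<Longrightarrow> w \<in> L2 \<Omega> \<Longrightarrow> integrable (lebesgue_on \<Omega>) (\<lambda>x. v x * w x)"
  using integrable_bounded_times_L2_L2[of v \<Omega> w "\<lambda>_. 1" 1] by simp

lemma L2_lincomb:
  assumes v: "v \<in> L2 \<Omega>" and w: "w \<in> L2 \<Omega>"
  shows "(\<lambda>x. a * v x + b * w x) \<in> L2 \<Omega>"
proof -
  have "(a * v x + b * w x)\<^sup>2 = a\<^sup>2 * (v x)\<^sup>2 + 2 * a * b * (v x * w x) + b\<^sup>2 * (w x)\<^sup>2" for x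
    by (simp add: power2_eq_square algebra_simps)
  moreover have "integrable (lebesgue_on \<Omega>)
      (\<lambda>x. a\<^sup>2 * (v x)\<^sup>2 + 2 * a * b * (v x * w x) + b\<^sup>2 * (w x)\<^sup>2)"
    using integrable_L2_times_L2[OF v w] v w by (simp add: L2_def)
  moreover have "(\<lambda>x. a * v x + b * w x) \<in> borel_measurable (lebesgue_on \<Omega>)"
    using L2_measurable[OF v] L2_measurable[OF w] by measurable
  ultimately show ?thesis by (simp add: L2_def)
qed

lemma L2_zero: "(\<lambda>x. 0) \<in> L2 \<Omega>"
  by (simp add: L2_def)

lemma L2_inner_commute: "L2_inner \<Omega> v w = L2_inner \<Omega> w v"
  by (simp add: L2_inner_def mult.commute)

lemma L2_inner_lincomb:
  assumes "v \<in> L2 \<Omega>" "w \<in> L2 \<Omega>" "\<phi> \<in> L2 \<Omega>"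
  shows "L2_inner \<Omega> (\<lambda>x. a * v x + b * w x) \<phi> = a * L2_inner \<Omega> v \<phi> + b * L2_inner \<Omega> w \<phi>"
proof -
  have "L2_inner \<Omega> (\<lambda>x. a * v x + b * w x) \<phi>
      = (LINT x|lebesgue_on \<Omega>. a * (v x * \<phi> x) + b * (w x * \<phi> x))"
    by (simp add: L2_inner_def algebra_simps)
  also have "\<dots> = a * L2_inner \<Omega> v \<phi> + b * L2_inner \<Omega> w \<phi>"
    using assms by (simp add: L2_inner_def integrable_L2_times_L2)
  finally show ?thesis .
qed

lemma L2_inner_cong_AE:
  assumes "v \<in> L2 \<Omega>" "w \<in> L2 \<Omega>" "\<phi> \<in> L2 \<Omega>" "AE x in lebesgue_on \<Omega>. v x = w x"
  shows "L2_inner \<Omega> v \<phi> = L2_inner \<Omega> w \<phi>"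
  unfolding L2_inner_def using assms(4)
  by (intro integral_cong_AE borel_measurable_times L2_measurable assms) (auto elim: eventually_mono)

lemma L2_sum:
  assumes "finite I" "\<And>i. i \<in> I \<Longrightarrow> v i \<in> L2 \<Omega>"
  shows "(\<lambda>x. \<Sum>i\<in>I. c i * v i x) \<in> L2 \<Omega>"
  using assms
proof (induction I rule: finite_induct)
  case (insert i I)
  from L2_lincomb[of "v i" \<Omega> "\<lambda>x. \<Sum>i\<in>I. c i * v i x" "c i" 1] insert show ?case by simp
qed (simp add: L2_zero)

lemma L2_inner_sum:
  assumes "finite I" "\<And>i. i \<in> I \<Longrightarrow> v i \<in> L2 \<Omega>" "\<phi> \<in> L2 \<Omega>"
  shows "L2_inner \<Omega> (\<lambda>x. \<Sum>i\<in>I. c i * v i x) \<phi> = (\<Sum>i\<in>I. c i * L2_inner \<Omega> (v i) \<phi>)"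
  using assms
proof (induction I rule: finite_induct)
  case (insert i I)
  from L2_inner_lincomb[of "v i" \<Omega> "\<lambda>x. \<Sum>i\<in>I. c i * v i x" \<phi> "c i" 1] insert show ?case
    by (simp add: L2_sum)
qed (simp add: L2_inner_def)

lemma abs_L2_inner_le:
  assumes v: "v \<in> L2 \<Omega>" and w: "w \<in> L2 \<Omega>"
  shows "\<bar>L2_inner \<Omega> v w\<bar>
    \<le> sqrt (LINT x|lebesgue_on \<Omega>. (v x)\<^sup>2) * sqrt (LINT x|lebesgue_on \<Omega>. (w x)\<^sup>2)"
proof -
  let ?N = "lebesgue_on \<Omega>"
  define A B where "A = (LINT x|?N. (v x)\<^sup>2)" and "B = (LINT x|?N. (w x)\<^sup>2)"
  have AB: "A \<ge> 0" "B \<ge> 0" by (simp_all add: A_def B_def)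
  have int: "integrable ?N (\<lambda>x. \<bar>v x * w x\<bar>)" "integrable ?N (\<lambda>x. (v x)\<^sup>2)" "integrable ?N (\<lambda>x. (w x)\<^sup>2)"
    using integrable_L2_times_L2[OF v w] v w by (auto simp: L2_def)
  have "(\<integral>\<^sup>+x. ennreal \<bar>v x\<bar> * ennreal \<bar>w x\<bar> \<partial>?N)\<^sup>2
      \<le> (\<integral>\<^sup>+x. (ennreal \<bar>v x\<bar>)\<^sup>2 \<partial>?N) * (\<integral>\<^sup>+x. (ennreal \<bar>w x\<bar>)\<^sup>2 \<partial>?N)"
    using L2_measurable[OF v] L2_measurable[OF w] by (intro Cauchy_Schwarz_nn_integral) simp_all
  then have "(\<integral>\<^sup>+x. ennreal \<bar>v x * w x\<bar> \<partial>?N)\<^sup>2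
      \<le> (\<integral>\<^sup>+x. ennreal ((v x)\<^sup>2) \<partial>?N) * (\<integral>\<^sup>+x. ennreal ((w x)\<^sup>2) \<partial>?N)"
    unfolding abs_mult ennreal_mult'[OF abs_ge_zero] ennreal_power[OF abs_ge_zero] power2_abs .
  then have "ennreal ((LINT x|?N. \<bar>v x * w x\<bar>)\<^sup>2) \<le> ennreal (A * B)"
    unfolding nn_integral_eq_integral[OF int(1) AE_I2[OF abs_ge_zero]]
      nn_integral_eq_integral[OF int(2) AE_I2[OF zero_le_power2]]
      nn_integral_eq_integral[OF int(3) AE_I2[OF zero_le_power2]]
    using AB by (simp add: A_def B_def ennreal_mult ennreal_power)
  then have "(LINT x|?N. \<bar>v x * w x\<bar>)\<^sup>2 \<le> A * B" using AB by simp
  then have "(LINT x|?N. \<bar>v x * w x\<bar>) \<le> sqrt (A * B)" by (rule real_le_rsqrt)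
  moreover have "\<bar>L2_inner \<Omega> v w\<bar> \<le> (LINT x|?N. \<bar>v x * w x\<bar>)"
    unfolding L2_inner_def by (rule integral_abs_bound)
  ultimately show ?thesis by (simp add: A_def B_def real_sqrt_mult)
qed

lemma integrable_lebesgue_on_iff:
  fixes g :: "'a::euclidean_space \<Rightarrow> real"
  assumes "S \<in> sets lebesgue"
  shows "integrable (lebesgue_on S) g \<longleftrightarrow> integrable lebesgue (\<lambda>x. indicator S x *\<^sub>R g x)"
  using assms by (intro integrable_restrict_space) simp

lemma test_function_in_L2:
  assumes \<Omega>: "open \<Omega>" and \<phi>: "\<phi> \<in> test_functions \<Omega>"
  shows "\<phi> \<in> L2 \<Omega>"
proof -
  define K where "K = closure {x. \<phi> x \<noteq> 0}"
  have K: "compact K" "\<And>x. \<phi> x \<noteq> 0 \<Longrightarrow> x \<in> K"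
    using \<phi> closure_subset[of "{x. \<phi> x \<noteq> 0}"] by (auto simp: test_functions_def K_def)
  have cont: "continuous_on UNIV \<phi>"
    using \<phi> by (auto simp: test_functions_def intro: C_k_imp_continuous_on)
  have S: "\<Omega> \<in> sets lebesgue" using \<Omega> by (simp add: borel_open)
  have mb: "\<phi> \<in> borel_measurable borel" using cont by (rule borel_measurable_continuous_onI)
  have "integrable lborel (\<lambda>x. indicator K x *\<^sub>R (\<phi> x)\<^sup>2)"
    using K(1) by (intro borel_integrable_compact continuous_intros continuous_on_subset[OF cont]) auto
  moreover have "indicator K x *\<^sub>R (\<phi> x)\<^sup>2 = (\<phi> x)\<^sup>2" for x
    using K(2)[of x] by (cases "\<phi> x = 0") auto
  ultimately have "integrable lborel (\<lambda>x. (\<phi> x)\<^sup>2)" by (simp only:)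
  then have "integrable lebesgue (\<lambda>x. (\<phi> x)\<^sup>2)"
    using mb by (subst integrable_completion) auto
  then have "integrable (lebesgue_on \<Omega>) (\<lambda>x. (\<phi> x)\<^sup>2)"
    unfolding integrable_lebesgue_on_iff[OF S] by (rule integrable_mult_indicator[OF S])
  moreover have "\<phi> \<in> borel_measurable (lebesgue_on \<Omega>)"
    using cont S continuous_on_subset by (intro continuous_imp_measurable_on_sets_lebesgue) auto
  ultimately show ?thesis by (simp add: L2_def)
qed

lemma partial_deriv_test_function:
  assumes "\<phi> \<in> test_functions \<Omega>"
  shows "partial_deriv i \<phi> \<in> test_functions \<Omega>"
proof -
  let ?K = "closure {x. \<phi> x \<noteq> 0}"
  have "partial_deriv i \<phi> x = 0" if "x \<notin> ?K" for x
  proof -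
    have "(\<phi> has_derivative (\<lambda>_. 0)) (at x)"
    proof (rule has_derivative_transform_within_open[OF has_derivative_const[of 0]])
      show "open (- ?K)" "x \<in> - ?K" using that by auto
      show "0 = \<phi> y" if "y \<in> - ?K" for y using that closure_subset[of "{x. \<phi> x \<noteq> 0}"] by auto
    qed
    then show ?thesis by (rule partial_deriv_eqI)
  qed
  then have sub: "closure {x. partial_deriv i \<phi> x \<noteq> 0} \<subseteq> ?K"
    by (intro closure_minimal closed_closure) blast
  moreover have "compact (closure {x. partial_deriv i \<phi> x \<noteq> 0})"
  proof -
    have "bounded ?K" using assms compact_imp_bounded by (auto simp: test_functions_def)
    from bounded_subset[OF this sub] show ?thesis by (simp only: compact_eq_bounded_closed closed_closure)
  qed
  moreover have "C_k k (partial_deriv i \<phi>)" for k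
  proof -
    have "C_k (Suc k) \<phi>" using assms by (simp only: test_functions_def mem_Collect_eq)
    then show ?thesis by simp
  qed
  ultimately show ?thesis using assms unfolding test_functions_def mem_Collect_eq by blast
qed

section \<open>Weak gradients and the bilinear form of the operator\<close>

lemma lebesgue_on_AE_iff:
  "\<Omega> \<in> sets lebesgue \<Longrightarrow> (AE x in lebesgue_on \<Omega>. Q x) \<longleftrightarrow> (AE x in lebesgue. x \<in> \<Omega> \<longrightarrow> Q x)"
  by (simp add: AE_restrict_space_iff)

text \<open>Dominated convergence along the bumps above shows that \<open>g\<close> has integral zero over each box inside
\<open>\<Omega>\<close>. By Lebesgue's differentiation theorem it vanishes almost everywhere on each such box, and
countably many boxes cover \<open>\<Omega>\<close>.\<close>

lemma fundamental_lemma_calculus_of_variations: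
  fixes \<Omega> :: "(real ^ 'n) set"
  assumes \<Omega>: "open \<Omega>" and g: "g \<in> L2 \<Omega>"
    and orth: "\<And>\<phi>. \<phi> \<in> test_functions \<Omega> \<Longrightarrow> L2_inner \<Omega> g \<phi> = 0"
  shows "AE x in lebesgue_on \<Omega>. g x = 0"
proof -
  have S[simp]: "\<Omega> \<in> sets lebesgue" using \<Omega> by (simp add: borel_open)
  have ig: "integrable (lebesgue_on \<Omega>) (\<lambda>x. indicator (cbox e f) x * g x)"
    if "cbox e f \<subseteq> \<Omega>" for e f
  proof -
    have "integrable (lebesgue_on \<Omega>) (\<lambda>x. indicat_real (cbox e f) x)"
    proof -
      have "integrable lebesgue (indicat_real (cbox e f))"
        using lmeasurable_cbox[of e f] by (simp add: fmeasurable_def)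
      then show ?thesis
        unfolding integrable_lebesgue_on_iff[OF S] by (rule integrable_mult_indicator[OF S])
    qed
    moreover have "(indicat_real (cbox e f) x)\<^sup>2 = indicat_real (cbox e f) x" for x
      by (simp add: indicator_def)
    ultimately have "indicat_real (cbox e f) \<in> L2 \<Omega>"
      by (simp add: L2_def integrable_iff_bounded)
    from integrable_L2_times_L2[OF this g] show ?thesis .
  qed
  have g_cbox: "integrable (lebesgue_on (cbox e f)) g" if "cbox e f \<subseteq> \<Omega>" for e f
  proof -
    have "integrable lebesgue (\<lambda>x. indicator \<Omega> x *\<^sub>R (indicator (cbox e f) x * g x))"
      using ig[OF that] unfolding integrable_lebesgue_on_iff[OF S] .
    moreover have "indicator \<Omega> x *\<^sub>R (indicator (cbox e f) x * g x) = indicator (cbox e f) x *\<^sub>R g x" for x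
      using that by (auto simp: indicator_def)
    ultimately show ?thesis by (simp only: integrable_lebesgue_on_iff lmeasurable_cbox fmeasurableD)
  qed
  have zero: "integral (cbox e f) g = 0" if sub: "cbox e f \<subseteq> \<Omega>" for e f
  proof -
    from box_indicator_limit_of_test_functions[OF sub] obtain \<phi> where \<phi>:
      "\<And>n. \<phi> n \<in> test_functions \<Omega>" "\<And>n x. \<bar>\<phi> n x\<bar> \<le> indicator (cbox e f) x"
      "\<And>x. (\<lambda>n. \<phi> n x) \<longlonglongrightarrow> indicat_real (box e f) x" by blast
    have "(\<lambda>n. LINT x|lebesgue_on \<Omega>. g x * \<phi> n x)
        \<longlonglongrightarrow> (LINT x|lebesgue_on \<Omega>. g x * indicator (box e f) x)"
    proof (rule integral_dominated_convergence)
      show "integrable (lebesgue_on \<Omega>) (\<lambda>x. \<bar>indicator (cbox e f) x * g x\<bar>)"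
        using ig[OF sub] by (rule integrable_abs)
      show "AE x in lebesgue_on \<Omega>. (\<lambda>n. g x * \<phi> n x) \<longlonglongrightarrow> g x * indicator (box e f) x"
        by (intro AE_I2 tendsto_intros \<phi>)
      show "AE x in lebesgue_on \<Omega>. norm (g x * \<phi> n x) \<le> \<bar>indicator (cbox e f) x * g x\<bar>" for n
        using mult_left_mono[OF \<phi>(2)] by (intro AE_I2) (simp add: abs_mult mult.commute)
      show "(\<lambda>x. g x * \<phi> n x) \<in> borel_measurable (lebesgue_on \<Omega>)" for n
        by (intro borel_measurable_times L2_measurable g test_function_in_L2[OF \<Omega> \<phi>(1)])
      have "indicat_real (box e f) \<in> borel_measurable (lebesgue_on \<Omega>)"
        by (intro measurable_restrict_space1 borel_measurable_indicator) simp
      then show "(\<lambda>x. g x * indicat_real (box e f) x) \<in> borel_measurable (lebesgue_on \<Omega>)"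
        using L2_measurable[OF g] by (intro borel_measurable_times)
    qed
    moreover have "(LINT x|lebesgue_on \<Omega>. g x * \<phi> n x) = 0" for n
      using orth[OF \<phi>(1)] by (simp add: L2_inner_def)
    ultimately have "(LINT x|lebesgue_on \<Omega>. g x * indicator (box e f) x) = 0"
      by (simp add: LIMSEQ_const_iff)
    moreover have "g x * indicator (box e f) x = (if x \<in> box e f then g x else 0)" for x by simp
    ultimately have "(LINT x|lebesgue_on \<Omega>. (if x \<in> box e f then g x else 0)) = 0" by simp
    moreover have bsub: "box e f \<subseteq> \<Omega>" using sub box_subset_cbox[of e f] by (rule order_trans[rotated])
    ultimately have "(LINT x|lebesgue_on (box e f). g x) = 0"
      by (subst (asm) Lebesgue_Measure.integral_restrict) auto
    moreover have "integrable (lebesgue_on (box e f)) g"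
    proof -
      have "integrable lebesgue (\<lambda>x. indicator (cbox e f) x *\<^sub>R g x)"
        using g_cbox[OF sub] by (simp only: integrable_lebesgue_on_iff lmeasurable_cbox fmeasurableD)
      then have "integrable lebesgue (\<lambda>x. indicator (box e f) x *\<^sub>R indicator (cbox e f) x *\<^sub>R g x)"
        by (rule integrable_mult_indicator[rotated]) simp
      moreover have "indicator (box e f) x *\<^sub>R indicator (cbox e f) x *\<^sub>R g x = indicator (box e f) x *\<^sub>R g x" for x
        using box_subset_cbox[of e f] by (auto simp: indicator_def)
      ultimately show ?thesis by (simp only: integrable_lebesgue_on_iff lmeasurable_box fmeasurableD)
    qed
    ultimately have "integral (box e f) g = 0"
      by (simp add: lebesgue_integral_eq_integral)
    then show ?thesis by (simp add: integral_open_interval)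
  qed
  have AE_cbox: "AE x in lebesgue. x \<in> cbox c d \<longrightarrow> g x = 0" if sub: "cbox c d \<subseteq> \<Omega>" for c d
  proof -
    define k where "k x = (if x \<in> cbox c d then g x else 0)" for x
    have "g integrable_on cbox c d"
      using g_cbox[OF sub] by (intro integrable_on_lebesgue_on) auto
    then have "k integrable_on UNIV"
      unfolding k_def by (simp add: Henstock_Kurzweil_Integration.integrable_restrict_UNIV)
    then have k: "k integrable_on cbox a b" for a b
      by (rule integrable_on_subcbox) simp
    have k0: "integral (cbox a b) k = 0" for a b
    proof -
      have "integral (cbox a b) k = integral (cbox c d \<inter> cbox a b) g"
        unfolding k_def by (rule Henstock_Kurzweil_Integration.integral_restrict_Int)
      also have "cbox c d \<inter> cbox a b \<subseteq> \<Omega>" using sub by blast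
      then have "integral (cbox c d \<inter> cbox a b) g = 0"
        unfolding Int_interval by (rule zero)
      finally show ?thesis .
    qed
    \<comment> \<open>Outside a null set the value of a function is the limit of its means over small cubes.\<close>
    from integrable_ccontinuous_explicit[OF k] obtain N where N: "negligible N"
      "\<And>x e. \<lbrakk>x \<notin> N; 0 < e\<rbrakk> \<Longrightarrow> \<exists>d>0. \<forall>h. 0 < h \<and> h < d \<longrightarrow>
         norm (integral (cbox x (x + h *\<^sub>R One)) k /\<^sub>R h ^ DIM(real^'n) - k x) < e"
      by blast
    have "k x = 0" if "x \<notin> N" for x
    proof (rule ccontr)
      assume "k x \<noteq> 0"
      from N(2)[OF that, of "\<bar>k x\<bar>"] this obtain d :: real where "d > 0"
        "\<forall>h>0. \<not> h < d"
        unfolding k0 by auto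
      from this(2)[rule_format, of "d / 2"] \<open>d > 0\<close> show False by simp
    qed
    then have "{x. k x \<noteq> 0} \<subseteq> N" by blast
    then have "{x. \<not> (x \<in> cbox c d \<longrightarrow> g x = 0)} \<subseteq> N" by (auto simp: k_def)
    then show ?thesis
      using N(1) by (intro AE_I'[of N]) (simp_all add: negligible_iff_null_sets)
  qed
  obtain \<D> where \<D>: "countable \<D>" "\<D> \<subseteq> Pow \<Omega>" "\<And>X. X \<in> \<D> \<Longrightarrow> \<exists>a b. X = cbox a b" "\<Union>\<D> = \<Omega>"
    by (rule open_countable_Union_open_cbox[OF \<Omega>]) blast
  have "AE x in lebesgue. \<forall>X\<in>\<D>. x \<in> X \<longrightarrow> g x = 0"
    unfolding AE_ball_countable[OF \<D>(1)]
  proof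
    fix X assume "X \<in> \<D>"
    with \<D>(2,3) obtain a b where "X = cbox a b" "cbox a b \<subseteq> \<Omega>" by blast
    then show "AE x in lebesgue. x \<in> X \<longrightarrow> g x = 0" using AE_cbox by blast
  qed
  then show ?thesis
    unfolding lebesgue_on_AE_iff[OF S] using \<D>(4) by (auto elim: eventually_mono)
qed

lemma weak_partial_unique:
  assumes \<Omega>: "open \<Omega>" and g: "weak_partial \<Omega> i v g" and h: "weak_partial \<Omega> i v h"
  shows "AE x in lebesgue_on \<Omega>. g x = h x"
proof -
  have L2: "g \<in> L2 \<Omega>" "h \<in> L2 \<Omega>" using g h by (auto simp: weak_partial_def)
  have "AE x in lebesgue_on \<Omega>. 1 * g x + (- 1) * h x = 0"
  proof (rule fundamental_lemma_calculus_of_variations[OF \<Omega> L2_lincomb[OF L2]])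
    fix \<phi> assume \<phi>: "\<phi> \<in> test_functions \<Omega>"
    then have "L2_inner \<Omega> g \<phi> = L2_inner \<Omega> h \<phi>"
      using g h unfolding weak_partial_def by (metis add.inverse_inverse)
    then show "L2_inner \<Omega> (\<lambda>x. 1 * g x + (- 1) * h x) \<phi> = 0"
      unfolding L2_inner_lincomb[OF L2 test_function_in_L2[OF \<Omega> \<phi>]] by simp
  qed
  then show ?thesis by eventually_elim simp
qed

lemma weak_partial_lincomb:
  assumes \<Omega>: "open \<Omega>" and vw: "v \<in> L2 \<Omega>" "w \<in> L2 \<Omega>"
    and g: "weak_partial \<Omega> i v g" and h: "weak_partial \<Omega> i w h"
  shows "weak_partial \<Omega> i (\<lambda>x. a * v x + b * w x) (\<lambda>x. a * g x + b * h x)"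
proof -
  have L2: "g \<in> L2 \<Omega>" "h \<in> L2 \<Omega>" using g h by (auto simp: weak_partial_def)
  show ?thesis
    unfolding weak_partial_def
  proof (intro conjI ballI)
    show "(\<lambda>x. a * g x + b * h x) \<in> L2 \<Omega>" by (rule L2_lincomb[OF L2])
    fix \<phi> assume \<phi>: "\<phi> \<in> test_functions \<Omega>"
    have "\<phi> \<in> L2 \<Omega>" "partial_deriv i \<phi> \<in> L2 \<Omega>"
      using \<phi> partial_deriv_test_function test_function_in_L2[OF \<Omega>] by blast+
    moreover have "L2_inner \<Omega> v (partial_deriv i \<phi>) = - L2_inner \<Omega> g \<phi>"
      "L2_inner \<Omega> w (partial_deriv i \<phi>) = - L2_inner \<Omega> h \<phi>"
      using g h \<phi> by (simp_all add: weak_partial_def)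
    ultimately show "L2_inner \<Omega> (\<lambda>x. a * v x + b * w x) (partial_deriv i \<phi>)
        = - L2_inner \<Omega> (\<lambda>x. a * g x + b * h x) \<phi>"
      by (simp add: L2_inner_lincomb[OF vw] L2_inner_lincomb[OF L2])
  qed
qed

lemma weak_partial_cong_AE:
  assumes \<Omega>: "open \<Omega>" and vw: "v \<in> L2 \<Omega>" "w \<in> L2 \<Omega>" "AE x in lebesgue_on \<Omega>. v x = w x"
    and g: "weak_partial \<Omega> i v g"
  shows "weak_partial \<Omega> i w g"
  using g L2_inner_cong_AE[OF vw(1,2) test_function_in_L2[OF \<Omega> partial_deriv_test_function] vw(3)]
  by (simp add: weak_partial_def)

lemma H1_imp_L2: "v \<in> H1 \<Omega> \<Longrightarrow> v \<in> L2 \<Omega>"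
  by (simp add: H1_def)

lemma H10_imp_H1: "v \<in> H10 \<Omega> \<Longrightarrow> v \<in> H1 \<Omega>"
  by (simp add: H10_def)

lemma H10_imp_L2: "v \<in> H10 \<Omega> \<Longrightarrow> v \<in> L2 \<Omega>"
  by (intro H1_imp_L2 H10_imp_H1)

lemma weak_partial_weak_grad:
  assumes "v \<in> H1 \<Omega>"
  shows "weak_partial \<Omega> i v (\<lambda>x. weak_grad \<Omega> v x $ i)"
proof -
  have "\<exists>g. weak_partial \<Omega> i v g" using assms by (simp add: H1_def)
  from someI_ex[OF this] show ?thesis by (simp add: weak_grad_def)
qed

lemma weak_grad_in_L2: "v \<in> H1 \<Omega> \<Longrightarrow> (\<lambda>x. weak_grad \<Omega> v x $ i) \<in> L2 \<Omega>"
  using weak_partial_weak_grad[of v \<Omega> i] by (simp add: weak_partial_def)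

text \<open>The chosen weak derivatives agree with any others, which is what turns the choice in the definition
of the weak gradient into something linear and insensitive to null sets.\<close>

lemma weak_grad_eqI:
  assumes \<Omega>: "open \<Omega>" and v: "v \<in> H1 \<Omega>" and g: "\<And>i. weak_partial \<Omega> i v (\<lambda>x. g x $ i)"
  shows "AE x in lebesgue_on \<Omega>. weak_grad \<Omega> v x = g x"
  unfolding vec_eq_iff
  using weak_partial_unique[OF \<Omega> weak_partial_weak_grad[OF v] g] by (simp add: eventually_all_finite)

lemma H1_lincomb:
  assumes \<Omega>: "open \<Omega>" and vw: "v \<in> H1 \<Omega>" "w \<in> H1 \<Omega>"
  shows "(\<lambda>x. a * v x + b * w x) \<in> H1 \<Omega>"
  using weak_partial_lincomb[OF \<Omega> vw[THEN H1_imp_L2] vw[THEN weak_partial_weak_grad]]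
    L2_lincomb[OF vw[THEN H1_imp_L2]] by (auto simp: H1_def)

lemma weak_grad_lincomb:
  assumes \<Omega>: "open \<Omega>" and vw: "v \<in> H1 \<Omega>" "w \<in> H1 \<Omega>"
  shows "AE x in lebesgue_on \<Omega>. weak_grad \<Omega> (\<lambda>x. a * v x + b * w x) x
    = a *\<^sub>R weak_grad \<Omega> v x + b *\<^sub>R weak_grad \<Omega> w x"
  using weak_partial_lincomb[OF \<Omega> vw[THEN H1_imp_L2] vw[THEN weak_partial_weak_grad]]
  by (intro weak_grad_eqI[OF \<Omega> H1_lincomb[OF \<Omega> vw]]) simp

lemma weak_grad_cong_AE:
  assumes \<Omega>: "open \<Omega>" and vw: "v \<in> H1 \<Omega>" "w \<in> H1 \<Omega>" "AE x in lebesgue_on \<Omega>. v x = w x"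
  shows "AE x in lebesgue_on \<Omega>. weak_grad \<Omega> v x = weak_grad \<Omega> w x"
proof (rule weak_grad_eqI[OF \<Omega> vw(1)])
  have "AE x in lebesgue_on \<Omega>. w x = v x" using vw(3) by eventually_elim simp
  from weak_partial_cong_AE[OF \<Omega> vw(2,1)[THEN H1_imp_L2] this weak_partial_weak_grad[OF vw(2)]]
  show "weak_partial \<Omega> i v (\<lambda>x. weak_grad \<Omega> w x $ i)" for i .
qed

lemma H1_zero: "(\<lambda>x. 0) \<in> H1 \<Omega>"
  by (auto simp: H1_def L2_zero weak_partial_def L2_inner_def intro!: exI[of _ "\<lambda>x. 0"])

lemma H1_sum:
  assumes "open \<Omega>" "finite I" "\<And>i. i \<in> I \<Longrightarrow> v i \<in> H1 \<Omega>"
  shows "(\<lambda>x. \<Sum>i\<in>I. c i * v i x) \<in> H1 \<Omega>"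
  using assms(2,3)
proof (induction I rule: finite_induct)
  case (insert i I)
  from H1_lincomb[OF assms(1), of "v i" "\<lambda>x. \<Sum>i\<in>I. c i * v i x" "c i" 1] insert show ?case by simp
qed (simp add: H1_zero)

text \<open>Additivity of the Bochner integral, and with it linearity of the form, requires the integrand to
be integrable; it is named so that this can be stated.\<close>

definition ell_integrand ::
    "(real ^ 'n) set \<Rightarrow> 'n coefficients \<Rightarrow> (real ^ 'n \<Rightarrow> real) \<Rightarrow> (real ^ 'n \<Rightarrow> real) \<Rightarrow> real ^ 'n \<Rightarrow> real" where
  "ell_integrand \<Omega> P v \<phi> x =
      (coeff_A P x *v weak_grad \<Omega> v x + v x *\<^sub>R coeff_d P x) \<bullet> weak_grad \<Omega> \<phi> x
      + (coeff_b P x \<bullet> weak_grad \<Omega> v x) * \<phi> x + coeff_c P x * v x * \<phi> x"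

text \<open>Written out in coordinates, the integrand is a finite sum of products of a bounded coefficient
and two square integrable functions.\<close>

lemma integrable_ell_integrand:
  fixes \<Omega> :: "(real ^ 'n) set"
  assumes P: "elliptic \<Omega> P" and v: "v \<in> H1 \<Omega>" and \<phi>: "\<phi> \<in> H1 \<Omega>"
  shows "integrable (lebesgue_on \<Omega>) (ell_integrand \<Omega> P v \<phi>)"
proof -
  let ?N = "lebesgue_on \<Omega>"
  obtain C where C: "AE x in ?N. norm (coeff_A P x) \<le> C \<and> norm (coeff_d P x) \<le> C \<and>
      norm (coeff_b P x) \<le> C \<and> \<bar>coeff_c P x\<bar> \<le> C"
    using P by (auto simp: elliptic_def)
  have nth: "(\<lambda>x. w x $ i) \<in> borel_measurable ?N" if "w \<in> borel_measurable ?N"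
    for w :: "real ^ 'n \<Rightarrow> ('b::euclidean_space) ^ 'n" and i :: 'n
    by (rule measurable_compose[OF that borel_measurable_continuous_onI]) (intro continuous_intros)
  have mA: "(\<lambda>x. coeff_A P x $ i $ j) \<in> borel_measurable ?N" for i j
    by (intro nth) (use P in \<open>simp add: elliptic_def\<close>)
  have md: "(\<lambda>x. coeff_d P x $ i) \<in> borel_measurable ?N"
    and mb: "(\<lambda>x. coeff_b P x $ i) \<in> borel_measurable ?N" for i
    using P by (auto intro!: nth simp: elliptic_def)
  have mc: "coeff_c P \<in> borel_measurable ?N" using P by (simp add: elliptic_def)
  have bA: "AE x in ?N. \<bar>coeff_A P x $ i $ j\<bar> \<le> C" for i j
    using C by eventually_elim
      (meson component_le_norm_cart Finite_Cartesian_Product.norm_nth_le order_trans)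
  have bd: "AE x in ?N. \<bar>coeff_d P x $ i\<bar> \<le> C" for i
    using C by eventually_elim (meson component_le_norm_cart order_trans)
  have bb: "AE x in ?N. \<bar>coeff_b P x $ i\<bar> \<le> C" for i
    using C by eventually_elim (meson component_le_norm_cart order_trans)
  have bc: "AE x in ?N. \<bar>coeff_c P x\<bar> \<le> C"
    using C by eventually_elim simp
  have L2: "v \<in> L2 \<Omega>" "\<phi> \<in> L2 \<Omega>" "\<And>i. (\<lambda>x. weak_grad \<Omega> v x $ i) \<in> L2 \<Omega>"
    "\<And>i. (\<lambda>x. weak_grad \<Omega> \<phi> x $ i) \<in> L2 \<Omega>"
    using v \<phi> by (auto intro: H1_imp_L2 weak_grad_in_L2)
  have "ell_integrand \<Omega> P v \<phi> = (\<lambda>x.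
      (\<Sum>i\<in>UNIV. (\<Sum>j\<in>UNIV. coeff_A P x $ i $ j * weak_grad \<Omega> v x $ j * weak_grad \<Omega> \<phi> x $ i)
        + coeff_d P x $ i * v x * weak_grad \<Omega> \<phi> x $ i)
      + (\<Sum>i\<in>UNIV. coeff_b P x $ i * weak_grad \<Omega> v x $ i * \<phi> x) + coeff_c P x * v x * \<phi> x)"
    by (rule ext) (simp add: ell_integrand_def inner_vec_def matrix_vector_mult_def sum_distrib_left algebra_simps)
  moreover have "integrable ?N \<dots>"
    by (intro Bochner_Integration.integrable_add Bochner_Integration.integrable_sum
      integrable_bounded_times_L2_L2[OF L2(3) L2(4) mA bA]
      integrable_bounded_times_L2_L2[OF L2(1) L2(4) md bd]
      integrable_bounded_times_L2_L2[OF L2(3) L2(2) mb bb]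
      integrable_bounded_times_L2_L2[OF L2(1) L2(2) mc bc])
  ultimately show ?thesis by simp
qed

lemma ell_op_eq: "ell_op \<Omega> P v \<phi> = (LINT x|lebesgue_on \<Omega>. ell_integrand \<Omega> P v \<phi> x)"
  by (simp add: ell_op_def ell_integrand_def)

lemma ell_op_lincomb:
  assumes \<Omega>: "open \<Omega>" and P: "elliptic \<Omega> P" and vw: "v \<in> H1 \<Omega>" "w \<in> H1 \<Omega>" and \<phi>: "\<phi> \<in> H1 \<Omega>"
  shows "ell_op \<Omega> P (\<lambda>x. a * v x + b * w x) \<phi> = a * ell_op \<Omega> P v \<phi> + b * ell_op \<Omega> P w \<phi>"
proof -
  note int = vw[THEN integrable_ell_integrand[OF P], OF \<phi>]
  have "ell_op \<Omega> P (\<lambda>x. a * v x + b * w x) \<phi>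
      = (LINT x|lebesgue_on \<Omega>. a * ell_integrand \<Omega> P v \<phi> x + b * ell_integrand \<Omega> P w \<phi> x)"
    unfolding ell_op_eq
  proof (rule integral_cong_AE)
    show "ell_integrand \<Omega> P (\<lambda>x. a * v x + b * w x) \<phi> \<in> borel_measurable (lebesgue_on \<Omega>)"
      using integrable_ell_integrand[OF P H1_lincomb[OF \<Omega> vw] \<phi>] by (rule borel_measurable_integrable)
    show "(\<lambda>x. a * ell_integrand \<Omega> P v \<phi> x + b * ell_integrand \<Omega> P w \<phi> x)
        \<in> borel_measurable (lebesgue_on \<Omega>)"
      using int[THEN borel_measurable_integrable] by measurable
    show "AE x in lebesgue_on \<Omega>. ell_integrand \<Omega> P (\<lambda>x. a * v x + b * w x) \<phi> x
        = a * ell_integrand \<Omega> P v \<phi> x + b * ell_integrand \<Omega> P w \<phi> x"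
      using weak_grad_lincomb[OF \<Omega> vw, of a b]
      by eventually_elim (simp add: ell_integrand_def matrix_vector_right_distrib
        matrix_vector_mult_scaleR inner_add_left inner_add_right algebra_simps)
  qed
  also have "\<dots> = a * ell_op \<Omega> P v \<phi> + b * ell_op \<Omega> P w \<phi>"
    unfolding ell_op_eq using int by simp
  finally show ?thesis .
qed

lemma ell_op_cong_AE:
  assumes \<Omega>: "open \<Omega>" and P: "elliptic \<Omega> P" and v: "v \<in> H1 \<Omega>"
    and \<phi>: "\<phi> \<in> H1 \<Omega>" "\<omega> \<in> H1 \<Omega>" "AE x in lebesgue_on \<Omega>. \<phi> x = \<omega> x"
  shows "ell_op \<Omega> P v \<phi> = ell_op \<Omega> P v \<omega>"
  unfolding ell_op_eq
proof (rule integral_cong_AE)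
  show "ell_integrand \<Omega> P v \<phi> \<in> borel_measurable (lebesgue_on \<Omega>)"
    "ell_integrand \<Omega> P v \<omega> \<in> borel_measurable (lebesgue_on \<Omega>)"
    using \<phi>(1,2)[THEN integrable_ell_integrand[OF P v]] by (auto intro: borel_measurable_integrable)
  show "AE x in lebesgue_on \<Omega>. ell_integrand \<Omega> P v \<phi> x = ell_integrand \<Omega> P v \<omega> x"
    using weak_grad_cong_AE[OF \<Omega> \<phi>] \<phi>(3) by eventually_elim (simp add: ell_integrand_def)
qed

lemma ell_op_sum:
  assumes \<Omega>: "open \<Omega>" and P: "elliptic \<Omega> P" and \<phi>: "\<phi> \<in> H1 \<Omega>"
    and "finite I" "\<And>i. i \<in> I \<Longrightarrow> v i \<in> H1 \<Omega>"
  shows "ell_op \<Omega> P (\<lambda>x. \<Sum>i\<in>I. c i * v i x) \<phi> = (\<Sum>i\<in>I. c i * ell_op \<Omega> P (v i) \<phi>)"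
  using assms(4,5)
proof (induction I rule: finite_induct)
  case empty
  from ell_op_lincomb[OF \<Omega> P H1_zero H1_zero \<phi>, of 0 0] show ?case by simp
next
  case (insert i I)
  from ell_op_lincomb[OF \<Omega> P _ H1_sum[OF \<Omega>] \<phi>, of "v i" I v "c i" 1 c] insert show ?case by simp
qed

lemma L2_inner_in_Hm1:
  assumes g: "g \<in> L2 \<Omega>"
  shows "L2_inner \<Omega> g \<in> Hm1 \<Omega>"
  unfolding Hm1_def mem_Collect_eq
proof (intro conjI exI ballI allI)
  fix \<phi> \<omega> a b assume "\<phi> \<in> H10 \<Omega>" "\<omega> \<in> H10 \<Omega>"
  then show "L2_inner \<Omega> g (\<lambda>x. a * \<phi> x + b * \<omega> x) = a * L2_inner \<Omega> g \<phi> + b * L2_inner \<Omega> g \<omega>"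
    using g by (simp add: L2_inner_commute[of \<Omega> g] L2_inner_lincomb H10_imp_L2)
next
  fix \<phi> assume "\<phi> \<in> H10 \<Omega>"
  then have \<phi>: "\<phi> \<in> H1 \<Omega>" "\<phi> \<in> L2 \<Omega>" by (auto intro: H10_imp_H1 H10_imp_L2)
  have nsq: "(norm (weak_grad \<Omega> \<phi> x))\<^sup>2 = (\<Sum>i\<in>UNIV. (weak_grad \<Omega> \<phi> x $ i)\<^sup>2)" for x
    by (simp add: norm_vec_def L2_set_def sum_nonneg)
  have "integrable (lebesgue_on \<Omega>) (\<lambda>x. (norm (weak_grad \<Omega> \<phi> x))\<^sup>2)"
    unfolding nsq using weak_grad_in_L2[OF \<phi>(1)] by (intro Bochner_Integration.integrable_sum) (simp add: L2_def)
  then have "sqrt (LINT x|lebesgue_on \<Omega>. (\<phi> x)\<^sup>2) \<le> H1_norm \<Omega> \<phi>"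
    unfolding H1_norm_def using \<phi>(2) by (intro real_sqrt_le_mono integral_mono) (auto simp: L2_def)
  then show "\<bar>L2_inner \<Omega> g \<phi>\<bar> \<le> sqrt (LINT x|lebesgue_on \<Omega>. (g x)\<^sup>2) * H1_norm \<Omega> \<phi>"
    using abs_L2_inner_le[OF g \<phi>(2)] by (meson mult_left_mono order_trans real_sqrt_ge_zero
      Bochner_Integration.integral_nonneg zero_le_power2)
qed

lemma Hm1_diff:
  assumes "F \<in> Hm1 \<Omega>" "H \<in> Hm1 \<Omega>"
  shows "(\<lambda>\<phi>. F \<phi> - H \<phi>) \<in> Hm1 \<Omega>"
proof -
  obtain C D where "\<And>\<phi>. \<phi> \<in> H10 \<Omega> \<Longrightarrow> \<bar>F \<phi>\<bar> \<le> C * H1_norm \<Omega> \<phi>" "\<And>\<phi>. \<phi> \<in> H10 \<Omega> \<Longrightarrow> \<bar>H \<phi>\<bar> \<le> D * H1_norm \<Omega> \<phi>"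
  proof -
    have "\<exists>C. \<forall>\<phi>\<in>H10 \<Omega>. \<bar>F \<phi>\<bar> \<le> C * H1_norm \<Omega> \<phi>" "\<exists>D. \<forall>\<phi>\<in>H10 \<Omega>. \<bar>H \<phi>\<bar> \<le> D * H1_norm \<Omega> \<phi>"
      using assms by (simp_all only: Hm1_def mem_Collect_eq)
    then show ?thesis using that by blast
  qed
  then have "\<bar>F \<phi> - H \<phi>\<bar> \<le> (C + D) * H1_norm \<Omega> \<phi>" if "\<phi> \<in> H10 \<Omega>" for \<phi>
    using abs_triangle_ineq4[of "F \<phi>" "H \<phi>"] that by (fastforce simp: distrib_right)
  moreover have "(F (\<lambda>x. a * \<phi> x + b * \<omega> x) - H (\<lambda>x. a * \<phi> x + b * \<omega> x))
      = a * (F \<phi> - H \<phi>) + b * (F \<omega> - H \<omega>)" if "\<phi> \<in> H10 \<Omega>" "\<omega> \<in> H10 \<Omega>" for \<phi> \<omega> a b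
    using assms that by (simp add: Hm1_def algebra_simps)
  ultimately show ?thesis unfolding Hm1_def mem_Collect_eq by blast
qed

section \<open>Integrals weighted by the distance to the midpoint\<close>

lemma integrable_subset_lebesgue_on:
  fixes f :: "real \<Rightarrow> real"
  assumes "integrable (lebesgue_on S) f" "R \<subseteq> S" "S \<in> sets lebesgue" "R \<in> sets lebesgue"
  shows "integrable (lebesgue_on R) f"
proof -
  have "integrable lebesgue (\<lambda>x. indicator R x *\<^sub>R (indicator S x *\<^sub>R f x))"
    using assms(1,3,4) by (intro integrable_mult_indicator[where A = R]) (simp_all only: integrable_lebesgue_on_iff)
  moreover have "indicator R x *\<^sub>R (indicator S x *\<^sub>R f x) = indicator R x *\<^sub>R f x" for x
    using assms(2) by (auto simp: indicator_def)
  ultimately show ?thesis using assms(4) by (simp only: integrable_lebesgue_on_iff)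
qed

lemma lebesgue_integral_Ioo_eq_integral_Icc:
  fixes p :: "real \<Rightarrow> real"
  assumes "integrable (lebesgue_on {a<..<b}) p"
  shows "(LINT s|lebesgue_on {a<..<b}. p s) = integral {a..b} p"
  using lebesgue_integral_eq_integral[OF assms] integral_open_interval_real[of a b p] by simp

lemma integral_id_minus_midpoint:
  fixes a b :: real
  assumes "a \<le> b"
  shows "((\<lambda>s. s - (a + b) / 2) has_integral 0) {a..b}"
proof -
  have "((\<lambda>s. s - (a + b) / 2) has_integral
      (b - (a + b) / 2)\<^sup>2 / 2 - (a - (a + b) / 2)\<^sup>2 / 2) {a..b}"
    by (rule fundamental_theorem_of_calculus[OF assms])
      (auto intro!: derivative_eq_intros simp: has_real_derivative_iff_has_vector_derivative[symmetric])
  moreover have "(b - (a + b) / 2)\<^sup>2 / 2 - (a - (a + b) / 2)\<^sup>2 / 2 = 0"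
    by (simp add: power2_eq_square field_simps)
  ultimately show ?thesis by simp
qed

text \<open>Chebyshev's argument: \<open>(s - m) (k s - k m) \<ge> 0\<close> for the midpoint \<open>m\<close>, because \<open>k\<close> is monotone,
and \<open>s - m\<close> has integral zero.\<close>

lemma integral_midpoint_weight_mono_nonneg:
  fixes k :: "real \<Rightarrow> real"
  assumes ab: "a < b"
    and int: "(\<lambda>s. (s - (a + b) / 2) * k s) integrable_on {a..b}"
    and mono: "\<And>s r. a < s \<Longrightarrow> s \<le> r \<Longrightarrow> r < b \<Longrightarrow> k s \<le> k r"
  shows "0 \<le> integral {a..b} (\<lambda>s. (s - (a + b) / 2) * k s)"
proof -
  define m where "m = (a + b) / 2"
  have m: "a < m" "m < b" using ab by (auto simp: m_def)
  have i0: "((\<lambda>s. (s - m) * k m) has_integral 0) {a..b}"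
    using has_integral_mult_left[OF integral_id_minus_midpoint[of a b], of "k m"] ab
    by (simp add: m_def)
  have "0 = integral ({a<..<b}) (\<lambda>s. (s - m) * k m)"
    by (simp only: integral_open_interval_real[symmetric] integral_unique[OF i0])
  also have "\<dots> \<le> integral ({a<..<b}) (\<lambda>s. (s - m) * k s)"
  proof (rule integral_le)
    show "(\<lambda>s. (s - m) * k m) integrable_on {a<..<b}"
      using i0 integrable_on_open_interval_real by (metis has_integral_integrable)
    show "(\<lambda>s. (s - m) * k s) integrable_on {a<..<b}"
      using int unfolding m_def integrable_on_open_interval_real .
    fix s assume s: "s \<in> {a<..<b}"
    show "(s - m) * k m \<le> (s - m) * k s"
    proof (cases "m \<le> s")
      case True
      then show ?thesis using mono[of m s] s m by (intro mult_left_mono) auto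
    next
      case False
      then show ?thesis using mono[of s m] s m by (intro mult_left_mono_neg) auto
    qed
  qed
  also have "\<dots> = integral {a..b} (\<lambda>s. (s - m) * k s)" by (rule integral_open_interval_real[symmetric])
  finally show ?thesis by (simp add: m_def)
qed

text \<open>The hypothesis says that both \<open>\<beta> - g\<close> and \<open>\<beta> + g\<close> are nondecreasing. This replaces an integration
by parts for \<open>g\<close>, which need not be differentiable.\<close>

lemma integral_midpoint_weight_le:
  fixes g \<beta> :: "real \<Rightarrow> real"
  assumes ab: "a < b"
    and g: "(\<lambda>s. (s - (a + b) / 2) * g s) integrable_on {a..b}"
    and \<beta>: "(\<lambda>s. (s - (a + b) / 2) * \<beta> s) integrable_on {a..b}"
    and le: "\<And>s r. a < s \<Longrightarrow> s \<le> r \<Longrightarrow> r < b \<Longrightarrow> \<bar>g r - g s\<bar> \<le> \<beta> r - \<beta> s"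
  shows "\<bar>integral {a..b} (\<lambda>s. (s - (a + b) / 2) * g s)\<bar>
    \<le> integral {a..b} (\<lambda>s. (s - (a + b) / 2) * \<beta> s)"
proof -
  let ?m = "(a + b) / 2"
  have "0 \<le> integral {a..b} (\<lambda>s. (s - ?m) * (\<beta> s - g s))"
  proof (rule integral_midpoint_weight_mono_nonneg[OF ab])
    show "(\<lambda>s. (s - ?m) * (\<beta> s - g s)) integrable_on {a..b}"
      using integrable_diff[OF \<beta> g] by (simp only: right_diff_distrib)
    show "\<beta> s - g s \<le> \<beta> r - g r" if "a < s" "s \<le> r" "r < b" for s r
      using le[OF that] by linarith
  qed
  also have "\<dots> = integral {a..b} (\<lambda>s. (s - ?m) * \<beta> s) - integral {a..b} (\<lambda>s. (s - ?m) * g s)"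
    by (simp only: right_diff_distrib integral_diff[OF \<beta> g])
  finally have 1: "integral {a..b} (\<lambda>s. (s - ?m) * g s) \<le> integral {a..b} (\<lambda>s. (s - ?m) * \<beta> s)"
    by simp
  have "0 \<le> integral {a..b} (\<lambda>s. (s - ?m) * (\<beta> s + g s))"
  proof (rule integral_midpoint_weight_mono_nonneg[OF ab])
    show "(\<lambda>s. (s - ?m) * (\<beta> s + g s)) integrable_on {a..b}"
      using integrable_add[OF \<beta> g] by (simp only: distrib_left)
    show "\<beta> s + g s \<le> \<beta> r + g r" if "a < s" "s \<le> r" "r < b" for s r
      using le[OF that] by linarith
  qed
  also have "\<dots> = integral {a..b} (\<lambda>s. (s - ?m) * \<beta> s) + integral {a..b} (\<lambda>s. (s - ?m) * g s)"
    by (simp only: distrib_left integral_add[OF \<beta> g])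
  finally show ?thesis using 1 by simp
qed

lemma integral_bubble:
  fixes a b :: real
  assumes "a \<le> b"
  shows "((\<lambda>s. (b - s) * (s - a)) has_integral (b - a) ^ 3 / 6) {a..b}"
proof -
  define F where "F s = (b - a) / 2 * (s - a)\<^sup>2 - 1 / 3 * (s - a) ^ 3" for s
  have "((\<lambda>s. (b - s) * (s - a)) has_integral F b - F a) {a..b}"
    unfolding F_def by (rule fundamental_theorem_of_calculus[OF assms])
      (auto intro!: derivative_eq_intros
        simp: has_real_derivative_iff_has_vector_derivative[symmetric] power2_eq_square field_simps)
  moreover have "F b - F a = (b - a) ^ 3 / 6"
    by (simp add: F_def power2_eq_square power3_eq_cube)
  ultimately show ?thesis by simp
qed

lemma tendsto_x_ln_x: "((\<lambda>x::real. x * ln x) \<longlongrightarrow> 0) (at_right 0)"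
proof -
  have "((\<lambda>x. - (ln (inverse x) / inverse x)) \<longlongrightarrow> - 0) (at_right (0::real))"
    by (intro tendsto_minus filterlim_compose[OF ln_x_over_x_tendsto_0 filterlim_inverse_at_top_right])
  then have "((\<lambda>x. - (ln (inverse x) / inverse x)) \<longlongrightarrow> 0) (at_right (0::real))" by simp
  moreover have "\<forall>\<^sub>F x in at_right (0::real). - (ln (inverse x) / inverse x) = x * ln x"
    by (auto simp: eventually_at_right_field ln_inverse divide_inverse intro!: exI[of _ 1])
  ultimately show ?thesis by (rule Lim_transform_eventually)
qed

lemma continuous_on_x_ln_x: "continuous_on {0..} (\<lambda>x::real. x * ln x)"
  unfolding continuous_on_eq_continuous_within
proof
  fix x :: real assume "x \<in> {0..}"
  show "continuous (at x within {0..}) (\<lambda>x. x * ln x)"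
  proof (cases "x = 0")
    case True
    have "at (0::real) within {0..} = at_right 0"
      by (simp add: at_within_Ici_at_right)
    with True tendsto_x_ln_x show ?thesis by (simp add: continuous_within)
  next
    case False
    then show ?thesis using \<open>x \<in> {0..}\<close> by (intro continuous_intros) auto
  qed
qed

lemma integrable_bubble_over_time_to_end:
  fixes a b T :: real
  assumes ab: "a < b" "b \<le> T"
  shows "(\<lambda>s. (b - s) * (s - a) / (T - s)) integrable_on {a..b}"
proof (cases "b = T")
  case True
  have "(\<lambda>s. s - a) integrable_on {a..b}"
    by (intro integrable_continuous_interval continuous_intros)
  then show ?thesis
    by (rule integrable_spike_finite[of "{T}", rotated 2]) (auto simp: True)
next
  case False
  then show ?thesis using ab by (intro integrable_continuous_interval continuous_intros) auto
qed

text \<open>The boundary terms of this integration by parts vanish since the bubble \<open>(b - s)(s - a)\<close> does. When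
\<open>b = T\<close> the logarithm is singular at the right end point, but the bubble still compensates it, as
\<open>x ln x\<close> tends to zero.\<close>

lemma integral_midpoint_weight_log:
  fixes a b T c d :: real
  assumes ab: "a < b" "b \<le> T"
  shows "((\<lambda>s. (s - (a + b) / 2) * (- (c * ln (T - s) + d * (T - s)))) has_integral
    (c * integral {a..b} (\<lambda>s. (b - s) * (s - a) / (T - s)) + d * ((b - a) ^ 3 / 6)) / 2) {a..b}"
proof -
  define \<beta> where "\<beta> s = - (c * ln (T - s) + d * (T - s))" for s
  define F where "F s = (b - s) * (s - a) * \<beta> s" for s
  define F' where "F' s = - 2 * (s - (a + b) / 2) * \<beta> s + (b - s) * (s - a) * (c / (T - s) + d)" for s
  have "continuous_on {a..b} F"
  proof (cases "b = T")
    case True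
    have "continuous_on {a..b} (\<lambda>s. (T - s) * ln (T - s))"
      by (rule continuous_on_compose2[OF continuous_on_x_ln_x]) (auto intro!: continuous_intros simp: True)
    from continuous_on_mult[OF continuous_on_const[of _ c] this]
    have "continuous_on {a..b} (\<lambda>s. - (s - a) * (c * ((T - s) * ln (T - s)) + d * (T - s) * (T - s)))"
      by (rule continuous_on_mult[rotated, OF continuous_on_add]) (auto intro!: continuous_intros)
    moreover have "F = (\<lambda>s. - (s - a) * (c * ((T - s) * ln (T - s)) + d * (T - s) * (T - s)))"
      by (rule ext) (simp add: F_def \<beta>_def True algebra_simps)
    ultimately show ?thesis by simp
  next
    case False
    then show ?thesis using ab unfolding F_def \<beta>_def by (intro continuous_intros) auto
  qed
  moreover have "(F has_vector_derivative F' s) (at s)" if "s \<in> {a<..<b}" for s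
    using that ab unfolding F_def \<beta>_def F'_def has_real_derivative_iff_has_vector_derivative[symmetric]
    by (auto intro!: derivative_eq_intros)
  ultimately have "(F' has_integral F b - F a) {a..b}"
    using ab by (intro fundamental_theorem_of_calculus_interior) auto
  then have F': "(F' has_integral 0) {a..b}" by (simp add: F_def)
  have "((\<lambda>s. c * ((b - s) * (s - a) / (T - s)) + d * ((b - s) * (s - a))) has_integral
      c * integral {a..b} (\<lambda>s. (b - s) * (s - a) / (T - s)) + d * ((b - a) ^ 3 / 6)) {a..b}"
    using integrable_bubble_over_time_to_end[OF ab] integral_bubble[of a b] ab
    by (intro has_integral_add has_integral_mult_right integrable_integral) auto
  from has_integral_divide[OF has_integral_diff[OF this F'], of 2]
  show ?thesis
  proof (rule has_integral_eq_rhs[OF has_integral_eq, rotated])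
    fix s
    have "(b - s) * (s - a) * (c / (T - s) + d)
        = c * ((b - s) * (s - a) / (T - s)) + d * ((b - s) * (s - a))"
      by (simp add: distrib_left)
    moreover have "(X - (- 2 * m * B + X)) / 2 = m * B" for X m B :: real by simp
    ultimately show "(c * ((b - s) * (s - a) / (T - s)) + d * ((b - s) * (s - a)) - F' s) / 2
        = (s - (a + b) / 2) * (- (c * ln (T - s) + d * (T - s)))"
      by (simp only: F'_def \<beta>_def)
  qed simp
qed

text \<open>The integral in \<open>Phi1\<close> is positive, being at least that of the bubble divided by \<open>T\<close>.\<close>

lemma Phi1_nonpos_imp_constants_zero:
  assumes j: "t (j - 1) < t j" "t j \<le> T" "0 \<le> t (j - 1)"
    and \<kappa>: "\<kappa> 1 \<ge> 0" "\<kappa>' 1 \<ge> 0" and le: "Phi1 \<kappa> \<kappa>' T t j \<le> 0"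
  shows "\<kappa> 1 = 0" "\<kappa>' 1 = 0"
proof -
  let ?a = "t (j - 1)" and ?b = "t j"
  let ?p = "\<lambda>s. (?b - s) * (s - ?a)"
  have T: "T > 0" using j by linarith
  have "(?b - ?a) ^ 3 / 6 / T = integral {?a..?b} (\<lambda>s. ?p s / T)"
    using integral_unique[OF has_integral_divide[OF integral_bubble[of ?a ?b], of T]] j by simp
  also have "\<dots> = integral ({?a<..<?b}) (\<lambda>s. ?p s / T)"
    by (simp add: integral_open_interval_real)
  also have "\<dots> \<le> integral ({?a<..<?b}) (\<lambda>s. ?p s / (T - s))"
  proof (rule integral_le)
    show "(\<lambda>s. ?p s / T) integrable_on {?a<..<?b}"
      unfolding integrable_on_open_interval_real
      using T by (intro integrable_continuous_interval continuous_intros) auto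
    show "(\<lambda>s. ?p s / (T - s)) integrable_on {?a<..<?b}"
      unfolding integrable_on_open_interval_real
      using integrable_bubble_over_time_to_end[OF j(1,2)] by simp
  next
    fix s assume "s \<in> {?a<..<?b}"
    then show "?p s / T \<le> ?p s / (T - s)" using j by (intro divide_left_mono) auto
  qed
  also have "\<dots> = integral {?a..?b} (\<lambda>s. ?p s / (T - s))" by (simp add: integral_open_interval_real)
  finally have "0 < integral {?a..?b} (\<lambda>s. ?p s / (T - s))"
    using j T by (smt (verit) divide_pos_pos zero_less_power)
  moreover have "0 < (step t j) ^ 3 / 6" using j by (simp add: step_def)
  moreover have "0 \<le> \<kappa> 1 * integral {?a..?b} (\<lambda>s. ?p s / (T - s))" "0 \<le> \<kappa>' 1 * ((step t j) ^ 3 / 6)"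
    using \<kappa> calculation by (auto intro!: mult_nonneg_nonneg)
  then have "\<kappa> 1 * integral {?a..?b} (\<lambda>s. ?p s / (T - s)) = 0" "\<kappa>' 1 * ((step t j) ^ 3 / 6) = 0"
    using le unfolding Phi1_def by linarith+
  ultimately show "\<kappa> 1 = 0" "\<kappa>' 1 = 0" by auto
qed

lemma Phi1_star_eq:
  "Phi1_star \<kappa> t j = 2 * \<kappa> 0 * integral {t (j - 1)..t j} (\<lambda>s. \<bar>s - (t (j - 1) + t j) / 2\<bar>)"
proof -
  have "deriv (\<lambda>r. (t j - r) * (r - t (j - 1))) s = - 2 * (s - (t (j - 1) + t j) / 2)" for s
    by (rule DERIV_imp_deriv) (auto intro!: derivative_eq_intros simp: field_simps)
  then have "\<bar>deriv (\<lambda>r. (t j - r) * (r - t (j - 1))) s\<bar> = 2 * \<bar>s - (t (j - 1) + t j) / 2\<bar>" for s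
    by (simp only: abs_mult abs_minus_cancel abs_numeral)
  then show ?thesis unfolding Phi1_star_def by simp
qed

lemma Phi1_star_nonpos_imp_constant_zero:
  assumes j: "t (j - 1) < t j" and \<kappa>: "\<kappa> 0 \<ge> 0" and le: "Phi1_star \<kappa> t j \<le> 0"
  shows "\<kappa> 0 = 0"
proof -
  let ?I = "integral {t (j - 1)..t j} (\<lambda>s. \<bar>s - (t (j - 1) + t j) / 2\<bar>)"
  have "?I \<ge> 0"
    by (intro integral_nonneg integrable_continuous_interval continuous_intros) auto
  moreover have "?I \<noteq> 0"
  proof
    assume "?I = 0"
    then have "\<forall>s\<in>{t (j - 1)..t j}. \<bar>s - (t (j - 1) + t j) / 2\<bar> = 0"
      using j by (subst (asm) integral_eq_0_iff) (auto intro!: continuous_intros)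
    from this[rule_format, of "t j"] j show False by simp
  qed
  ultimately have "?I > 0" by simp
  moreover have "\<kappa> 0 * ?I \<le> 0" using le unfolding Phi1_star_eq by simp
  ultimately show ?thesis using \<kappa> by (simp add: mult_le_0_iff)
qed

section \<open>Piecewise polynomials in time\<close>

lemma mesh_less: "mesh T M t \<Longrightarrow> i < j \<Longrightarrow> j \<le> M \<Longrightarrow> t i < t j"
  by (auto simp: mesh_def strict_mono_on_def)

lemma mesh_le: "mesh T M t \<Longrightarrow> i \<le> j \<Longrightarrow> j \<le> M \<Longrightarrow> t i \<le> t j"
  using mesh_less[of T M t i j] by (cases "i = j") auto

lemma mesh_bounds:
  assumes "mesh T M t" "j \<in> {1..M}"
  shows "0 \<le> t (j - 1)" "t (j - 1) < t j" "t j \<le> T"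
  using mesh_le[OF assms(1), of 0 "j - 1"] mesh_less[OF assms(1), of "j - 1" j]
    mesh_le[OF assms(1), of j M] assms by (auto simp: mesh_def)

lemma mesh_cover:
  assumes "mesh T M t" "s \<in> {0..T}" "T > 0"
  obtains j where "j \<in> {1..M}" "s \<in> {t (j - 1)..t j}"
proof (cases "s = 0")
  case True
  have "M \<noteq> 0" using assms by (metis mesh_def less_irrefl)
  then have "1 \<in> {1..M}" by simp
  with mesh_bounds[OF assms(1) this] assms(1) True show ?thesis
    by (intro that[of 1]) (auto simp: mesh_def)
next
  case False
  define j where "j = (LEAST j. s \<le> t j)"
  have sM: "s \<le> t M" using assms by (simp add: mesh_def)
  have j: "s \<le> t j" "j \<le> M" unfolding j_def
    using LeastI[of "\<lambda>j. s \<le> t j", OF sM] Least_le[of "\<lambda>j. s \<le> t j", OF sM] by auto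
  have "j \<noteq> 0"
  proof
    assume "j = 0"
    with j(1) False assms show False by (simp add: mesh_def)
  qed
  moreover have "\<not> s \<le> t (j - 1)" using not_less_Least[of "j - 1" "\<lambda>j. s \<le> t j"] \<open>j \<noteq> 0\<close>
    unfolding j_def by simp
  ultimately show ?thesis using j by (intro that[of j]) auto
qed

lemma mesh_interval_disjoint:
  assumes t: "mesh T M t" and ij: "i \<in> {1..M}" "j \<in> {1..M}" "i \<noteq> j" and s: "s \<in> {t (j - 1)<..<t j}"
  shows "s \<notin> {t (i - 1)<..<t i}"
proof (cases "i < j")
  case True
  then have "t i \<le> t (j - 1)" using ij by (intro mesh_le[OF t]) auto
  then show ?thesis using s by auto
next
  case False
  then have "t j \<le> t (i - 1)" using ij by (intro mesh_le[OF t]) auto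
  then show ?thesis using s by auto
qed

lemma mesh_integral_split:
  fixes p :: "real \<Rightarrow> real"
  assumes t: "mesh T M t" and p: "integrable (lebesgue_on {0<..<T}) p"
  shows "\<And>j. j \<in> {1..M} \<Longrightarrow> integrable (lebesgue_on {t (j - 1)<..<t j}) p"
    and "(LINT s|lebesgue_on {0<..<T}. p s) = (\<Sum>j=1..M. LINT s|lebesgue_on {t (j - 1)<..<t j}. p s)"
proof -
  show int: "integrable (lebesgue_on {t (j - 1)<..<t j}) p" if "j \<in> {1..M}" for j
    using p by (rule integrable_subset_lebesgue_on) (use mesh_bounds[OF t that] in auto)
  have eq: "(LINT s|lebesgue_on {a<..<b}. p s) = integral {a..b} p"
    if "integrable (lebesgue_on {a<..<b}) p" for a b
    by (rule lebesgue_integral_Ioo_eq_integral_Icc[OF that])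
  have HK: "p integrable_on {0..T}"
    using integrable_on_lebesgue_on[OF p] by (simp add: integrable_on_open_interval_real)
  have "k \<le> M \<Longrightarrow> integral {0..t k} p = (\<Sum>j=1..k. integral {t (j - 1)..t j} p)" for k
  proof (induction k)
    case 0
    then show ?case using t by (simp add: mesh_def)
  next
    case (Suc k)
    have b: "0 \<le> t k" "t k \<le> t (Suc k)" "t (Suc k) \<le> T"
      using mesh_bounds[OF t, of "Suc k"] Suc.prems by auto
    have "p integrable_on {0..t (Suc k)}"
      by (rule integrable_subinterval_real[OF HK]) (use b in auto)
    from Henstock_Kurzweil_Integration.integral_combine[OF b(1,2) this] Suc show ?case by simp
  qed
  from this[of M] have "integral {0..T} p = (\<Sum>j=1..M. integral {t (j - 1)..t j} p)"
    using t by (simp add: mesh_def)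
  also have "\<dots> = (\<Sum>j=1..M. LINT s|lebesgue_on {t (j - 1)<..<t j}. p s)"
    by (intro sum.cong refl eq[symmetric] int)
  finally show "(LINT s|lebesgue_on {0<..<T}. p s) = (\<Sum>j=1..M. LINT s|lebesgue_on {t (j - 1)<..<t j}. p s)"
    by (simp only: eq[OF p])
qed

text \<open>The value at the nodes, where there need not be a derivative, is zero.\<close>

definition pw_poly_deriv :: "nat \<Rightarrow> (nat \<Rightarrow> real) \<Rightarrow> (nat \<Rightarrow> real poly) \<Rightarrow> real \<Rightarrow> real" where
  "pw_poly_deriv M t p s = (\<Sum>j=1..M. indicator {t (j - 1)<..<t j} s * poly (pderiv (p j)) s)"

lemma pw_poly_deriv_eq:
  assumes "mesh T M t" "j \<in> {1..M}" "s \<in> {t (j - 1)<..<t j}"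
  shows "pw_poly_deriv M t p s = poly (pderiv (p j)) s"
proof -
  have "pw_poly_deriv M t p s = (\<Sum>i=1..M. if i = j then poly (pderiv (p j)) s else 0)"
    unfolding pw_poly_deriv_def
  proof (rule sum.cong)
    fix i assume "i \<in> {1..M}"
    then show "indicator {t (i - 1)<..<t i} s * poly (pderiv (p i)) s = (if i = j then poly (pderiv (p j)) s else 0)"
      using mesh_interval_disjoint[OF assms(1) _ assms(2) _ assms(3), of i] assms(3)
      by (cases "i = j") auto
  qed simp
  then show ?thesis using assms(2) by simp
qed

lemma integrable_pw_poly_deriv: "integrable (lebesgue_on {0..T}) (pw_poly_deriv M t p)"
  unfolding pw_poly_deriv_def
proof (intro Bochner_Integration.integrable_sum)
  fix j
  have "integrable (lebesgue_on {0..T}) (poly (pderiv (p j)))"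
    by (rule continuous_imp_integrable_real) (intro continuous_intros)
  then show "integrable (lebesgue_on {0..T}) (\<lambda>s. indicator {t (j - 1)<..<t j} s * poly (pderiv (p j)) s)"
  proof (rule Bochner_Integration.integrable_bound)
    have "indicat_real {t (j - 1)<..<t j} \<in> borel_measurable (lebesgue_on {0..T})"
      by (intro measurable_restrict_space1 borel_measurable_indicator) simp
    then show "(\<lambda>s. indicat_real {t (j - 1)<..<t j} s * poly (pderiv (p j)) s) \<in> borel_measurable (lebesgue_on {0..T})"
      using borel_measurable_integrable[OF \<open>integrable (lebesgue_on {0..T}) (poly (pderiv (p j)))\<close>]
      by (rule borel_measurable_times)
    show "AE s in lebesgue_on {0..T}. norm (indicat_real {t (j - 1)<..<t j} s * poly (pderiv (p j)) s)
        \<le> norm (poly (pderiv (p j)) s)"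
      by (intro AE_I2) (simp add: indicator_def)
  qed
qed

lemma pw_poly_fundamental_theorem:
  assumes t: "mesh T M t" "T > 0" and a: "continuous_on {0..T} a"
    and p: "\<And>j s. j \<in> {1..M} \<Longrightarrow> s \<in> {t (j - 1)..t j} \<Longrightarrow> a s = poly (p j) s"
    and \<tau>: "\<tau> \<in> {0..T}"
  shows "a \<tau> = a 0 + (LINT s|lebesgue_on {0..\<tau>}. pw_poly_deriv M t p s)"
proof -
  have "(pw_poly_deriv M t p has_integral a \<tau> - a 0) {0..\<tau>}"
  proof (rule fundamental_theorem_of_calculus_interior_strong)
    show "finite (t ` {0..M})" "0 \<le> \<tau>" using \<tau> by auto
    show "continuous_on {0..\<tau>} a" using a \<tau> by (auto intro: continuous_on_subset)
    fix s assume s: "s \<in> {0<..<\<tau>} - t ` {0..M}"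
    then have "s \<in> {0..T}" using \<tau> by auto
    from mesh_cover[OF t(1) this t(2)] obtain j where j: "j \<in> {1..M}" "s \<in> {t (j - 1)..t j}" by blast
    moreover have "s \<noteq> t j" "s \<noteq> t (j - 1)" using s j(1) by auto
    ultimately have sj: "s \<in> {t (j - 1)<..<t j}" by auto
    have "(poly (p j) has_real_derivative poly (pderiv (p j)) s) (at s)" by (rule poly_DERIV)
    then have "(a has_real_derivative poly (pderiv (p j)) s) (at s)"
      by (rule has_field_derivative_transform_within_open[of _ _ _ "{t (j - 1)<..<t j}"])
        (use sj p[OF j(1)] in auto)
    then show "(a has_vector_derivative pw_poly_deriv M t p s) (at s)"
      by (simp add: pw_poly_deriv_eq[OF t(1) j(1) sj] has_real_derivative_iff_has_vector_derivative)
  qed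
  moreover have "integrable (lebesgue_on {0..\<tau>}) (pw_poly_deriv M t p)"
    by (rule integrable_pw_poly_deriv)
  ultimately show ?thesis by (simp add: lebesgue_integral_eq_integral integral_unique)
qed

text \<open>Once paired with \<open>\<phi>\<close>, the subtracted sum is a combination of the coefficients with the numbers
\<open>\<langle>e\<^sub>k, \<phi>\<rangle>\<close>, so that the fundamental theorem of calculus for each coefficient suffices.\<close>

lemma time_deriv_diff_sum:
  fixes e :: "'k \<Rightarrow> real ^ 'n \<Rightarrow> real"
  assumes u: "time_deriv \<Omega> T u u'" "\<And>s. s \<in> {0..T} \<Longrightarrow> u s \<in> L2 \<Omega>" and T: "T > 0"
    and I: "finite I" "\<And>k. k \<in> I \<Longrightarrow> e k \<in> L2 \<Omega>"
    and c: "\<And>k. k \<in> I \<Longrightarrow> integrable (lebesgue_on {0..T}) (dc k)"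
      "\<And>k \<tau>. k \<in> I \<Longrightarrow> \<tau> \<in> {0..T} \<Longrightarrow> c k \<tau> = c k 0 + (LINT s|lebesgue_on {0..\<tau>}. dc k s)"
  shows "time_deriv \<Omega> T (\<lambda>s x. u s x - (\<Sum>k\<in>I. c k s * e k x))
    (\<lambda>s \<phi>. u' s \<phi> - L2_inner \<Omega> (\<lambda>x. \<Sum>k\<in>I. dc k s * e k x) \<phi>)"
  unfolding time_deriv_def
proof (intro conjI ballI)
  have "AE s in lebesgue_on {0..T}. u' s \<in> Hm1 \<Omega>" using u(1) by (simp add: time_deriv_def)
  then show "AE s in lebesgue_on {0..T}. (\<lambda>\<phi>. u' s \<phi> - L2_inner \<Omega> (\<lambda>x. \<Sum>k\<in>I. dc k s * e k x) \<phi>) \<in> Hm1 \<Omega>"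
    by eventually_elim (rule Hm1_diff[OF _ L2_inner_in_Hm1[OF L2_sum[OF I]]])
next
  fix \<phi> assume "\<phi> \<in> H10 \<Omega>"
  then have \<phi>: "\<phi> \<in> L2 \<Omega>" by (rule H10_imp_L2)
  have u': "integrable (lebesgue_on {0..T}) (\<lambda>s. u' s \<phi>)"
    "\<And>\<tau>. \<tau> \<in> {0..T} \<Longrightarrow> L2_inner \<Omega> (u \<tau>) \<phi> = L2_inner \<Omega> (u 0) \<phi> + (LINT s|lebesgue_on {0..\<tau>}. u' s \<phi>)"
    using u(1) \<open>\<phi> \<in> H10 \<Omega>\<close> unfolding time_deriv_def by blast+
  have dI: "L2_inner \<Omega> (\<lambda>x. \<Sum>k\<in>I. dc k s * e k x) \<phi> = (\<Sum>k\<in>I. dc k s * L2_inner \<Omega> (e k) \<phi>)" for s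
    by (rule L2_inner_sum[OF I \<phi>])
  show int: "integrable (lebesgue_on {0..T}) (\<lambda>s. u' s \<phi> - L2_inner \<Omega> (\<lambda>x. \<Sum>k\<in>I. dc k s * e k x) \<phi>)"
    unfolding dI by (intro Bochner_Integration.integrable_diff[OF u'(1)] Bochner_Integration.integrable_sum
      integrable_mult_left c(1))
  have wI: "L2_inner \<Omega> (\<lambda>x. u s x - (\<Sum>k\<in>I. c k s * e k x)) \<phi>
      = L2_inner \<Omega> (u s) \<phi> - (\<Sum>k\<in>I. c k s * L2_inner \<Omega> (e k) \<phi>)" if "s \<in> {0..T}" for s
  proof -
    have "L2_inner \<Omega> (\<lambda>x. 1 * u s x + (- 1) * (\<Sum>k\<in>I. c k s * e k x)) \<phi>
        = 1 * L2_inner \<Omega> (u s) \<phi> + (- 1) * L2_inner \<Omega> (\<lambda>x. \<Sum>k\<in>I. c k s * e k x) \<phi>"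
      by (rule L2_inner_lincomb[OF u(2)[OF that] L2_sum[OF I] \<phi>])
    also have "L2_inner \<Omega> (\<lambda>x. \<Sum>k\<in>I. c k s * e k x) \<phi> = (\<Sum>k\<in>I. c k s * L2_inner \<Omega> (e k) \<phi>)"
      by (rule L2_inner_sum[OF I \<phi>])
    finally show ?thesis by simp
  qed
  fix \<tau> assume \<tau>: "\<tau> \<in> {0..T}"
  have sub: "integrable (lebesgue_on {0..\<tau>}) f" if "integrable (lebesgue_on {0..T}) f" for f :: "real \<Rightarrow> real"
    by (rule integrable_subinterval[OF that]) (use \<tau> in auto)
  have "(LINT s|lebesgue_on {0..\<tau>}. u' s \<phi> - L2_inner \<Omega> (\<lambda>x. \<Sum>k\<in>I. dc k s * e k x) \<phi>)
      = (LINT s|lebesgue_on {0..\<tau>}. u' s \<phi>) - (\<Sum>k\<in>I. (LINT s|lebesgue_on {0..\<tau>}. dc k s) * L2_inner \<Omega> (e k) \<phi>)"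
  proof -
    have "integrable (lebesgue_on {0..\<tau>}) (\<lambda>s. dc k s * L2_inner \<Omega> (e k) \<phi>)" if "k \<in> I" for k
      by (intro integrable_mult_left sub c(1) that)
    then show ?thesis
      unfolding dI by (subst Bochner_Integration.integral_diff)
        (auto intro!: Bochner_Integration.integrable_sum sub u'(1) simp: Bochner_Integration.integral_sum)
  qed
  also have "(\<Sum>k\<in>I. (LINT s|lebesgue_on {0..\<tau>}. dc k s) * L2_inner \<Omega> (e k) \<phi>)
      = (\<Sum>k\<in>I. c k \<tau> * L2_inner \<Omega> (e k) \<phi>) - (\<Sum>k\<in>I. c k 0 * L2_inner \<Omega> (e k) \<phi>)"
    unfolding sum_subtractf[symmetric]
  proof (rule sum.cong[OF refl])
    fix k assume "k \<in> I"
    show "(LINT s|lebesgue_on {0..\<tau>}. dc k s) * L2_inner \<Omega> (e k) \<phi>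
        = c k \<tau> * L2_inner \<Omega> (e k) \<phi> - c k 0 * L2_inner \<Omega> (e k) \<phi>"
      unfolding c(2)[OF \<open>k \<in> I\<close> \<tau>] by (simp only: distrib_right add_diff_cancel_left')
  qed
  finally have eq: "(LINT s|lebesgue_on {0..\<tau>}. u' s \<phi> - L2_inner \<Omega> (\<lambda>x. \<Sum>k\<in>I. dc k s * e k x) \<phi>)
      = (LINT s|lebesgue_on {0..\<tau>}. u' s \<phi>)
        - ((\<Sum>k\<in>I. c k \<tau> * L2_inner \<Omega> (e k) \<phi>) - (\<Sum>k\<in>I. c k 0 * L2_inner \<Omega> (e k) \<phi>))" .
  have zero: "0 \<in> {0..T}" using T by simp
  show "L2_inner \<Omega> (\<lambda>x. u \<tau> x - (\<Sum>k\<in>I. c k \<tau> * e k x)) \<phi>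
      = L2_inner \<Omega> (\<lambda>x. u 0 x - (\<Sum>k\<in>I. c k 0 * e k x)) \<phi>
        + (LINT s|lebesgue_on {0..\<tau>}. u' s \<phi> - L2_inner \<Omega> (\<lambda>x. \<Sum>k\<in>I. dc k s * e k x) \<phi>)"
    unfolding wI[OF \<tau>] wI[OF zero] eq u'(2)[OF \<tau>] by linarith
qed

definition ramp :: "(nat \<Rightarrow> real) \<Rightarrow> nat \<Rightarrow> real \<Rightarrow> real" where
  "ramp t i s = max 0 (min 1 ((s - t (i - 1)) / (t i - t (i - 1))))"

text \<open>The usual nodal basis function, as a difference of two ramps: \<open>ramp t i\<close> is zero before the \<open>i\<close>-th
interval, one after it and linear on it. At the ends of the mesh the missing ramp is replaced by a
constant.\<close>

definition hat :: "nat \<Rightarrow> (nat \<Rightarrow> real) \<Rightarrow> nat \<Rightarrow> real \<Rightarrow> real" where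
  "hat M t i s = (if i = 0 then 1 else ramp t i s) - (if i = M then 0 else ramp t (Suc i) s)"

text \<open>The product is negative outside the \<open>i\<close>-th interval, so taking the positive part both localises
the bubble and keeps it continuous.\<close>

definition bubble :: "(nat \<Rightarrow> real) \<Rightarrow> nat set \<Rightarrow> nat \<Rightarrow> real \<Rightarrow> real" where
  "bubble t J i s = (if i \<in> J then max 0 ((t i - s) * (s - t (i - 1))) / 2 else 0)"

text \<open>The polynomial that agrees with the \<open>i\<close>-th hat function on the \<open>j\<close>-th interval.\<close>

definition hat_poly :: "(nat \<Rightarrow> real) \<Rightarrow> nat \<Rightarrow> nat \<Rightarrow> real poly" where
  "hat_poly t i j = (if i = j then [:- t (j - 1) / step t j, 1 / step t j:]
     else if i = j - 1 then [:t j / step t j, - 1 / step t j:] else 0)"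

definition bubble_poly :: "(nat \<Rightarrow> real) \<Rightarrow> nat set \<Rightarrow> nat \<Rightarrow> nat \<Rightarrow> real poly" where
  "bubble_poly t J i j =
     (if i = j \<and> j \<in> J then smult (1 / 2) ([:t j, - 1:] * [:- t (j - 1), 1:]) else 0)"

lemma ramp_on_interval:
  assumes t: "mesh T M t" and ij: "i \<in> {1..M}" "j \<in> {1..M}" and s: "s \<in> {t (j - 1)..t j}"
  shows "ramp t i s = (if i < j then 1 else if i = j then (s - t (j - 1)) / step t j else 0)"
proof -
  have i: "t (i - 1) < t i" by (rule mesh_bounds(2)[OF t ij(1)])
  consider "i < j" | "i = j" | "j < i" by linarith
  then show ?thesis
  proof cases
    case 1
    then have "t i \<le> t (j - 1)" using ij by (intro mesh_le[OF t]) auto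
    then have "1 \<le> (s - t (i - 1)) / (t i - t (i - 1))" using s i by simp
    then show ?thesis using 1 by (simp add: ramp_def)
  next
    case 2
    then have "0 \<le> (s - t (i - 1)) / (t i - t (i - 1))" "(s - t (i - 1)) / (t i - t (i - 1)) \<le> 1"
      using s i by auto
    then show ?thesis using 2 by (simp add: ramp_def step_def)
  next
    case 3
    then have "t j \<le> t (i - 1)" using ij by (intro mesh_le[OF t]) auto
    then have "(s - t (i - 1)) / (t i - t (i - 1)) \<le> 0" using s i by (intro divide_nonpos_pos) auto
    then show ?thesis using 3 by (simp add: ramp_def)
  qed
qed

lemma hat_on_interval:
  assumes t: "mesh T M t" and ij: "i \<in> {0..M}" "j \<in> {1..M}" and s: "s \<in> {t (j - 1)..t j}"
  shows "hat M t i s = poly (hat_poly t i j) s"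
proof -
  have j: "step t j > 0" using mesh_bounds(2)[OF t ij(2)] by (simp add: step_def)
  have 1: "(if i = 0 then 1 else ramp t i s) = (if i < j then 1 else if i = j then (s - t (j - 1)) / step t j else 0)"
    using ij ramp_on_interval[OF t _ ij(2) s, of i] by auto
  have 2: "(if i = M then 0 else ramp t (Suc i) s)
      = (if Suc i < j then 1 else if Suc i = j then (s - t (j - 1)) / step t j else 0)"
    using ij ramp_on_interval[OF t _ ij(2) s, of "Suc i"] by auto
  have "1 - (s - t (j - 1)) / step t j = (t j - s) / step t j"
    using j by (simp add: field_simps) (simp add: step_def)
  then show ?thesis
    unfolding hat_def 1 2 hat_poly_def using ij j by (auto simp: diff_divide_distrib)
qed

lemma bubble_on_interval:
  assumes t: "mesh T M t" and ij: "i \<in> {1..M}" "j \<in> {1..M}" and s: "s \<in> {t (j - 1)..t j}"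
  shows "bubble t J i s = poly (bubble_poly t J i j) s"
proof -
  have "max 0 ((t i - s) * (s - t (i - 1))) = (if i = j then (t j - s) * (s - t (j - 1)) else 0)"
  proof -
    consider "i < j" | "i = j" | "j < i" by linarith
    then show ?thesis
    proof cases
      case 1
      then have "t i \<le> t (j - 1)" "t (i - 1) \<le> t i" using ij by (auto intro!: mesh_le[OF t])
      then have "(t i - s) * (s - t (i - 1)) \<le> 0" using s by (intro mult_nonpos_nonneg) auto
      then show ?thesis using 1 by simp
    next
      case 2
      then have "0 \<le> (t i - s) * (s - t (i - 1))" using s by simp
      then show ?thesis using 2 by simp
    next
      case 3
      then have "t j \<le> t (i - 1)" "t (i - 1) \<le> t i" using ij by (auto intro!: mesh_le[OF t])
      then have "(t i - s) * (s - t (i - 1)) \<le> 0" using s by (intro mult_nonneg_nonpos) auto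
      then show ?thesis using 3 by simp
    qed
  qed
  then show ?thesis by (simp add: bubble_def bubble_poly_def algebra_simps)
qed

lemma continuous_on_hat:
  assumes "mesh T M t" "i \<in> {0..M}"
  shows "continuous_on S (hat M t i)"
proof -
  have r: "continuous_on S (ramp t j)" if "j \<in> {1..M}" for j
    using mesh_bounds(2)[OF assms(1) that] unfolding ramp_def by (intro continuous_intros) auto
  show ?thesis
    unfolding hat_def using assms(2) r[of i] r[of "Suc i"]
    by (cases "i = 0"; cases "i = M") (auto intro!: continuous_intros)
qed

lemma continuous_on_bubble: "continuous_on S (bubble t J i)"
  unfolding bubble_def by (cases "i \<in> J") (auto intro!: continuous_intros)

lemma sum_two_terms:
  fixes A B :: real
  assumes "j \<in> {1..M::nat}"
  shows "(\<Sum>i=0..M. (if i = j then A else if i = j - 1 then B else 0) * y i) = A * y j + B * y (j - 1)"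
proof -
  have "(\<Sum>i=0..M. (if i = j then A else if i = j - 1 then B else 0) * y i)
      = (\<Sum>i=0..M. (if i = j then A * y i else 0) + (if i = j - 1 then B * y i else 0))"
    using assms by (intro sum.cong) auto
  also have "\<dots> = A * y j + B * y (j - 1)"
  proof -
    have "j \<le> M" "j - 1 \<le> M" using assms by auto
    then show ?thesis by (simp add: sum.distrib)
  qed
  finally show ?thesis .
qed

lemma hat_sum_on_interval:
  assumes t: "mesh T M t" and j: "j \<in> {1..M}" and s: "s \<in> {t (j - 1)..t j}"
  shows "(\<Sum>i=0..M. hat M t i s * y i)
    = (s - t (j - 1)) / step t j * y j + (t j - s) / step t j * y (j - 1)"
proof -
  have "(\<Sum>i=0..M. hat M t i s * y i) = (\<Sum>i=0..M. (if i = j then (s - t (j - 1)) / step t j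
      else if i = j - 1 then (t j - s) / step t j else 0) * y i)"
    by (intro sum.cong refl arg_cong2[of _ _ _ _ "(*)"])
      (auto simp: hat_on_interval[OF t _ j s] hat_poly_def diff_divide_distrib)
  then show ?thesis by (simp only: sum_two_terms[OF j])
qed

lemma hat_deriv_sum_on_interval:
  assumes t: "mesh T M t" and j: "j \<in> {1..M}" and s: "s \<in> {t (j - 1)<..<t j}"
  shows "(\<Sum>i=0..M. pw_poly_deriv M t (hat_poly t i) s * y i) = (y j - y (j - 1)) / step t j"
proof -
  have "(\<Sum>i=0..M. pw_poly_deriv M t (hat_poly t i) s * y i) = (\<Sum>i=0..M. (if i = j then 1 / step t j
      else if i = j - 1 then - 1 / step t j else 0) * y i)"
    by (intro sum.cong refl arg_cong2[of _ _ _ _ "(*)"])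
      (auto simp: pw_poly_deriv_eq[OF t j s] hat_poly_def pderiv_pCons)
  then show ?thesis by (simp add: sum_two_terms[OF j] diff_divide_distrib)
qed

lemma bubble_sum_on_interval:
  assumes t: "mesh T M t" and j: "j \<in> {1..M}" and s: "s \<in> {t (j - 1)..t j}"
  shows "(\<Sum>i=1..M. bubble t J i s * y i) = (if j \<in> J then (t j - s) * (s - t (j - 1)) / 2 * y j else 0)"
proof -
  have "(\<Sum>i=1..M. bubble t J i s * y i)
      = (\<Sum>i=1..M. if i = j then (if j \<in> J then (t j - s) * (s - t (j - 1)) / 2 * y j else 0) else 0)"
    by (intro sum.cong refl) (auto simp: bubble_on_interval[OF t _ j s] bubble_poly_def algebra_simps)
  then show ?thesis using j by simp
qed

lemma bubble_deriv_sum_on_interval: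
  assumes t: "mesh T M t" and j: "j \<in> {1..M}" and s: "s \<in> {t (j - 1)<..<t j}"
  shows "(\<Sum>i=1..M. pw_poly_deriv M t (bubble_poly t J i) s * y i)
    = (if j \<in> J then - (s - midpt t j) * y j else 0)"
proof -
  have d: "poly (pderiv (smult (1 / 2) ([:t j, - 1:] * [:- t (j - 1), 1:]))) s = - (s - midpt t j)"
    by (simp add: pderiv_pCons midpt_def step_def field_simps)
  have "(\<Sum>i=1..M. pw_poly_deriv M t (bubble_poly t J i) s * y i)
      = (\<Sum>i=1..M. if i = j then (if j \<in> J then - (s - midpt t j) * y j else 0) else 0)"
    by (intro sum.cong refl, simp only: pw_poly_deriv_eq[OF t j s] bubble_poly_def d if_distrib
      pderiv_0 poly_0 mult_zero_left split: if_split) auto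
  then show ?thesis using j by simp
qed

section \<open>Variation in time of the Green function\<close>

lemma borel_measurable_lebesgue_on_AE:
  fixes f g :: "'a::euclidean_space \<Rightarrow> real"
  assumes S: "S \<in> sets lebesgue" and f: "f \<in> borel_measurable (lebesgue_on S)"
    and eq: "AE x in lebesgue_on S. f x = g x"
  shows "g \<in> borel_measurable (lebesgue_on S)"
proof -
  have "(\<lambda>x. if x \<in> S then f x else 0) \<in> borel_measurable lebesgue"
    using f S by (simp add: borel_measurable_if)
  moreover have "AE x in lebesgue. (if x \<in> S then f x else 0) = (if x \<in> S then g x else 0)"
    using eq S by (auto simp: AE_restrict_space_iff elim: eventually_mono)
  ultimately have "(\<lambda>x. if x \<in> S then g x else 0) \<in> borel_measurable lebesgue"
    by (rule borel_measurable_AE)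
  then show ?thesis using S by (simp add: borel_measurable_if)
qed

text \<open>An integral of \<open>|\<phi>'|\<close> would do on the right-hand side, too. Riemann sums are preferred because
with \<open>\<phi> = G(\<cdot>, y)\<close> they can be integrated over \<open>y\<close> term by term: Fatou's lemma then takes
the place of Tonelli's theorem, which would require joint measurability of \<open>\<partial>\<^sub>tG\<close>.\<close>

lemma ennreal_abs_increment_le_liminf_Riemann_sums:
  fixes \<phi> \<phi>' :: "real \<Rightarrow> real"
  assumes ab: "a < b" and der: "\<And>s. s \<in> {a..b} \<Longrightarrow> (\<phi> has_real_derivative \<phi>' s) (at s)"
    and cont: "continuous_on {a..b} \<phi>'"
  shows "ennreal \<bar>\<phi> b - \<phi> a\<bar> \<le> liminf (\<lambda>n. ennreal (\<Sum>k<Suc n.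
    (b - a) / real (Suc n) * \<bar>\<phi>' (a + real (Suc k) * ((b - a) / real (Suc n)))\<bar>))"
    (is "_ \<le> liminf (\<lambda>n. ennreal (?S n))")
  unfolding le_Liminf_iff
proof (intro allI impI)
  fix y :: ennreal assume y: "y < ennreal \<bar>\<phi> b - \<phi> a\<bar>"
  then obtain r where r: "y = ennreal r" "r \<ge> 0"
    by (cases y) auto
  with y have r2: "r < \<bar>\<phi> b - \<phi> a\<bar>" by (simp add: ennreal_less_iff)
  \<comment> \<open>A slack that costs half of the gap between \<open>r\<close> and the increment over the whole interval.\<close>
  define \<epsilon> where "\<epsilon> = (\<bar>\<phi> b - \<phi> a\<bar> - r) / (2 * (b - a))"
  have "X / (2 * d) * d = X / 2" if "d > 0" for X d :: real using that by (simp add: field_simps)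
  from this[of "b - a"] have \<epsilon>: "\<epsilon> > 0" "\<epsilon> * (b - a) = (\<bar>\<phi> b - \<phi> a\<bar> - r) / 2"
    using r2 ab by (simp_all only: \<epsilon>_def) auto
  have "uniformly_continuous_on {a..b} \<phi>'"
    using cont by (simp add: compact_uniformly_continuous)
  from this[unfolded uniformly_continuous_on_def, rule_format, OF \<epsilon>(1)] obtain d where d: "d > 0"
    "\<And>p q. p \<in> {a..b} \<Longrightarrow> q \<in> {a..b} \<Longrightarrow> dist q p < d \<Longrightarrow> dist (\<phi>' q) (\<phi>' p) < \<epsilon>"
    by blast
  have "(\<lambda>n. (b - a) * inverse (real (Suc n))) \<longlonglongrightarrow> (b - a) * 0"
    by (intro tendsto_intros LIMSEQ_inverse_real_of_nat)
  then have "\<forall>\<^sub>F n in sequentially. (b - a) * inverse (real (Suc n)) < d"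
    using d(1) by (intro order_tendstoD(2)[of _ "(b - a) * 0"]) auto
  then show "\<forall>\<^sub>F n in sequentially. y < ennreal (?S n)"
  proof eventually_elim
    case (elim n)
    define h where "h = (b - a) / real (Suc n)"
    have "h > 0" "h < d" using ab elim by (simp_all add: h_def divide_inverse del: of_nat_Suc)
    moreover have "a + real (Suc n) * h = b" by (simp add: h_def)
    ultimately have h: "h > 0" "h < d" "a + real (Suc n) * h = b" .
    have mem: "a + real k * h \<in> {a..b}" if "k \<le> Suc n" for k
    proof -
      have "real k * h \<le> real (Suc n) * h" using that h(1) by (intro mult_right_mono) auto
      then show ?thesis using h by (auto simp del: of_nat_Suc)
    qed
    have step: "\<bar>\<phi> (a + real (Suc k) * h) - \<phi> (a + real k * h)\<bar>
        \<le> h * \<bar>\<phi>' (a + real (Suc k) * h)\<bar> + h * \<epsilon>" if k: "k < Suc n" for k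
    proof -
      let ?p = "a + real k * h" and ?q = "a + real (Suc k) * h"
      have pq: "?p \<in> {a..b}" "?q \<in> {a..b}" "?p < ?q" "?q - ?p = h"
        using mem[of k] mem[of "Suc k"] k h(1) by (auto simp: algebra_simps)
      obtain z where z: "?p < z" "z < ?q" "\<phi> ?q - \<phi> ?p = (?q - ?p) * \<phi>' z"
        using MVT2[OF pq(3), of \<phi> \<phi>'] der pq(1,2) by auto
      have "dist (\<phi>' ?q) (\<phi>' z) < \<epsilon>"
      proof (rule d(2))
        show "z \<in> {a..b}" using z(1,2) pq(1,2) unfolding atLeastAtMost_iff by linarith
        show "?q \<in> {a..b}" by (rule pq(2))
        show "dist ?q z < d" using z(1,2) pq(4) h(2) unfolding dist_real_def by linarith
      qed
      then have "\<bar>\<phi>' z\<bar> \<le> \<bar>\<phi>' ?q\<bar> + \<epsilon>" by (simp add: dist_real_def)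
      then have "h * \<bar>\<phi>' z\<bar> \<le> h * (\<bar>\<phi>' ?q\<bar> + \<epsilon>)" using h(1) by (intro mult_left_mono) auto
      then show ?thesis using z(3) pq(4) h(1) by (simp add: abs_mult distrib_left)
    qed
    have "\<phi> b - \<phi> a = (\<Sum>k<Suc n. \<phi> (a + real (Suc k) * h) - \<phi> (a + real k * h))"
      using sum_lessThan_telescope[of "\<lambda>k. \<phi> (a + real k * h)" "Suc n"] by (simp only: h(3)) simp
    then have "\<bar>\<phi> b - \<phi> a\<bar> \<le> (\<Sum>k<Suc n. h * \<bar>\<phi>' (a + real (Suc k) * h)\<bar> + h * \<epsilon>)"
      by (simp only:) (intro order_trans[OF sum_abs] sum_mono step, simp)
    also have "\<dots> = ?S n + real (Suc n) * h * \<epsilon>"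
      by (simp only: sum.distrib h_def[symmetric]) simp
    also have "real (Suc n) * h = b - a" using h(3) by simp
    finally have "\<bar>\<phi> b - \<phi> a\<bar> \<le> ?S n + \<epsilon> * (b - a)" by (simp only: mult.commute)
    then have "r < ?S n" using \<epsilon>(2) r2 by argo
    then show ?case using r by (simp add: ennreal_lessI)
  qed
qed

lemma log_increment_lower_bound:
  fixes r h :: real
  assumes "r > 0" "h > 0"
  shows "h / (r + h) \<le> ln (r + h) - ln r"
proof -
  have "ln (r / (r + h)) \<le> r / (r + h) - 1" using assms by (intro ln_le_minus_one) auto
  moreover have "r / (r + h) - 1 = - (h / (r + h))" using assms by (simp add: field_simps)
  ultimately show ?thesis using assms by (simp add: ln_div)
qed

text \<open>With right end points, each summand \<open>h c / (r + h)\<close> is bounded by the increment of \<open>c ln\<close> over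
its subinterval, so the sum telescopes.\<close>

lemma Riemann_sum_le_log_increment:
  fixes c d \<gamma> a b :: real
  assumes ab: "0 < a" "a < b" and cd: "c \<ge> 0" "d \<ge> 0" "\<gamma> \<ge> 0"
  shows "(\<Sum>k<Suc n. (b - a) / real (Suc n) *
      ((c / (a + real (Suc k) * ((b - a) / real (Suc n))) + d) * exp (- \<gamma> * (a + real (Suc k) * ((b - a) / real (Suc n))))))
    \<le> exp (- \<gamma> * a) * ((c * ln b + d * b) - (c * ln a + d * a))"
proof -
  define h where "h = (b - a) / real (Suc n)"
  have h: "h > 0" "a + real (Suc n) * h = b" using ab by (auto simp: h_def)
  define B where "B r = c * ln r + d * r" for r
  have "h * ((c / (a + real (Suc k) * h) + d) * exp (- \<gamma> * (a + real (Suc k) * h)))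
      \<le> exp (- \<gamma> * a) * (B (a + real (Suc k) * h) - B (a + real k * h))" for k
  proof -
    define r where "r = a + real k * h"
    have r: "r > 0" "a + real (Suc k) * h = r + h" "a \<le> r + h"
      using ab h(1) by (auto simp: r_def algebra_simps add_pos_nonneg)
    have "c * (h / (r + h)) \<le> c * (ln (r + h) - ln r)"
      using log_increment_lower_bound[OF r(1) h(1)] cd by (intro mult_left_mono) auto
    then have 1: "h * (c / (r + h) + d) \<le> B (r + h) - B r"
      by (simp add: B_def algebra_simps)
    have 2: "exp (- \<gamma> * (r + h)) \<le> exp (- \<gamma> * a)" using r cd by (simp add: mult_left_mono)
    have "h * (c / (r + h) + d) * exp (- \<gamma> * (r + h)) \<le> (B (r + h) - B r) * exp (- \<gamma> * a)"
    proof (rule mult_mono[OF 1 2])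
      have "0 \<le> h * (c / (r + h) + d)"
        using r h(1) cd by (intro mult_nonneg_nonneg add_nonneg_nonneg divide_nonneg_nonneg) auto
      with 1 show "0 \<le> B (r + h) - B r" by linarith
    qed simp
    then show ?thesis unfolding r(2) r_def[symmetric] by (simp add: mult_ac)
  qed
  then have "(\<Sum>k<Suc n. h * ((c / (a + real (Suc k) * h) + d) * exp (- \<gamma> * (a + real (Suc k) * h))))
      \<le> (\<Sum>k<Suc n. exp (- \<gamma> * a) * (B (a + real (Suc k) * h) - B (a + real k * h)))"
    by (rule sum_mono)
  also have "\<dots> = exp (- \<gamma> * a) * (B b - B a)"
    unfolding sum_distrib_left[symmetric] sum_lessThan_telescope[of "\<lambda>k. B (a + real k * h)"] h(2) by simp
  finally show ?thesis unfolding h_def B_def .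
qed

lemma green_dt_L1:
  assumes "green_bounds \<Omega> T G \<kappa> \<kappa>' \<gamma>" "x \<in> \<Omega>" "s \<in> {0<..T}" "p \<le> 2"
  shows "L1_norm \<Omega> (green_dt p G x s) \<le> ennreal ((\<kappa> p / s ^ p + \<kappa>' p) * exp (- \<gamma> * s))"
  using assms unfolding green_bounds_def by blast

lemma green_in_H10_measurable:
  assumes "green_function \<Omega> P G" "x \<in> \<Omega>" "s > 0"
  shows "G x s \<in> H10 \<Omega>" "G x s \<in> borel_measurable (lebesgue_on \<Omega>)"
proof -
  show "G x s \<in> H10 \<Omega>" using assms by (simp add: green_function_def)
  then show "G x s \<in> borel_measurable (lebesgue_on \<Omega>)" by (intro L2_measurable H10_imp_L2)
qed

lemma green_C1_in_time:
  assumes "green_function \<Omega> P G" "x \<in> \<Omega>"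
  shows "AE y in lebesgue_on \<Omega>. \<forall>s>0.
    ((\<lambda>\<tau>. G x \<tau> y) has_real_derivative green_dt 1 G x s y) (at s) \<and>
    isCont (\<lambda>\<tau>. green_dt 1 G x \<tau> y) s"
proof -
  have "AE y in lebesgue_on \<Omega>. \<forall>p<2. \<forall>t>0. (\<lambda>\<tau>. green_dt p G x \<tau> y) differentiable at t"
    using assms by (simp add: green_function_def)
  then show ?thesis
  proof eventually_elim
    case (elim y)
    show ?case
    proof (intro allI impI conjI)
      fix s :: real assume s: "s > 0"
      have "(\<lambda>\<tau>. green_dt 0 G x \<tau> y) differentiable at s" using elim s by auto
      then have "(\<lambda>\<tau>. G x \<tau> y) differentiable at s" by (simp add: green_dt_def)
      then show "((\<lambda>\<tau>. G x \<tau> y) has_real_derivative green_dt 1 G x s y) (at s)"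
        by (simp add: green_dt_def DERIV_deriv_iff_real_differentiable)
      have "(\<lambda>\<tau>. green_dt 1 G x \<tau> y) differentiable at s" using elim s by auto
      then show "isCont (\<lambda>\<tau>. green_dt 1 G x \<tau> y) s"
        by (rule differentiable_imp_continuous_within)
    qed
  qed
qed

text \<open>The derivative is almost everywhere the limit of a sequence of difference quotients.\<close>

lemma green_dt_measurable:
  assumes S: "\<Omega> \<in> sets lebesgue" and G: "green_function \<Omega> P G" "x \<in> \<Omega>" and s: "s > 0"
  shows "green_dt 1 G x s \<in> borel_measurable (lebesgue_on \<Omega>)"
proof -
  define Q where "Q n y = (G x (s + inverse (real (Suc n))) y - G x s y) / inverse (real (Suc n))" for n y
  have "(\<lambda>y. lim (\<lambda>n. Q n y)) \<in> borel_measurable (lebesgue_on \<Omega>)"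
  proof (rule borel_measurable_lim_metric)
    fix n
    have "s + inverse (real (Suc n)) > 0" using s by (simp add: add_pos_pos del: of_nat_Suc)
    then show "Q n \<in> borel_measurable (lebesgue_on \<Omega>)"
      unfolding Q_def using green_in_H10_measurable(2)[OF G] s
      by (intro borel_measurable_divide borel_measurable_diff borel_measurable_const)
  qed
  moreover have "AE y in lebesgue_on \<Omega>. lim (\<lambda>n. Q n y) = green_dt 1 G x s y"
    using green_C1_in_time[OF G]
  proof eventually_elim
    case (elim y)
    then have "((\<lambda>h. (G x (s + h) y - G x s y) / h) \<longlongrightarrow> green_dt 1 G x s y) (at 0)"
      using s by (simp add: DERIV_def)
    moreover have "filterlim (\<lambda>n. inverse (real (Suc n))) (at 0) sequentially"
      unfolding filterlim_at using LIMSEQ_inverse_real_of_nat by (simp del: of_nat_Suc)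
    ultimately have "(\<lambda>n. Q n y) \<longlonglongrightarrow> green_dt 1 G x s y"
      unfolding Q_def by (rule filterlim_compose)
    then show ?case by (rule limI)
  qed
  ultimately show ?thesis by (rule borel_measurable_lebesgue_on_AE[OF S])
qed

text \<open>Formally, \<open>\<parallel>G(b) - G(a)\<parallel>\<^sub>1 \<le> \<integral>\<^sub>a\<^sup>b \<parallel>\<partial>\<^sub>tG(r)\<parallel>\<^sub>1 dr \<le> e\<^sup>-\<^sup>\<gamma>\<^sup>a \<integral>\<^sub>a\<^sup>b (\<kappa>\<^sub>1 / r + \<kappa>\<^sub>1') dr\<close>. The first integral is
replaced by Riemann sums.\<close>

lemma green_increment_L1:
  assumes S: "\<Omega> \<in> sets lebesgue" and G: "green_function \<Omega> P G" "x \<in> \<Omega>"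
    and bd: "green_bounds \<Omega> T G \<kappa> \<kappa>' \<gamma>" and ab: "0 < a" "a \<le> b" "b \<le> T"
  shows "L1_norm \<Omega> (\<lambda>y. G x b y - G x a y)
    \<le> ennreal (exp (- \<gamma> * a) * ((\<kappa> 1 * ln b + \<kappa>' 1 * b) - (\<kappa> 1 * ln a + \<kappa>' 1 * a)))"
proof (cases "a = b")
  case True
  then show ?thesis by (simp add: L1_norm_def)
next
  case False
  with ab have less: "a < b" by simp
  let ?N = "lebesgue_on \<Omega>" and ?R = "exp (- \<gamma> * a) * ((\<kappa> 1 * ln b + \<kappa>' 1 * b) - (\<kappa> 1 * ln a + \<kappa>' 1 * a))"
  have \<kappa>: "\<kappa> 1 \<ge> 0" "\<kappa>' 1 \<ge> 0" "\<gamma> \<ge> 0" using bd by (auto simp: green_bounds_def)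
  define r where "r n k = a + real (Suc k) * ((b - a) / real (Suc n))" for n k
  define h where "h n = (b - a) / real (Suc n)" for n
  have h: "h n > 0" for n using less by (simp add: h_def)
  have r: "0 < r n k" "r n k \<le> T" if "k < Suc n" for n k
  proof -
    have "real (Suc k) * h n \<le> real (Suc n) * h n" using that h[of n] by (intro mult_right_mono) auto
    also have "real (Suc n) * h n = b - a" by (simp add: h_def)
    finally show "r n k \<le> T" using ab unfolding r_def h_def by simp
    have "0 \<le> real (Suc k) * h n" using h[of n] by (intro mult_nonneg_nonneg) auto
    then show "0 < r n k" using ab unfolding r_def h_def by linarith
  qed
  define X where "X n y = (\<Sum>k<Suc n. ennreal (h n) * ennreal \<bar>green_dt 1 G x (r n k) y\<bar>)" for n y
  have mX: "(\<lambda>y. ennreal (h n) * ennreal \<bar>green_dt 1 G x (r n k) y\<bar>) \<in> borel_measurable ?N" if "k < Suc n" for n k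
    using green_dt_measurable[OF S G r(1)[OF that]] by measurable
  have "L1_norm \<Omega> (\<lambda>y. G x b y - G x a y) \<le> (\<integral>\<^sup>+y. liminf (\<lambda>n. X n y) \<partial>?N)"
    unfolding L1_norm_def
  proof (rule nn_integral_mono_AE)
    show "AE y in ?N. ennreal \<bar>G x b y - G x a y\<bar> \<le> liminf (\<lambda>n. X n y)"
      using green_C1_in_time[OF G]
    proof eventually_elim
      case (elim y)
      have "ennreal \<bar>G x b y - G x a y\<bar> \<le> liminf (\<lambda>n. ennreal (\<Sum>k<Suc n. h n * \<bar>green_dt 1 G x (r n k) y\<bar>))"
        unfolding r_def h_def
        by (rule ennreal_abs_increment_le_liminf_Riemann_sums[OF less])
          (use elim ab in \<open>auto intro: continuous_at_imp_continuous_on\<close>)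
      also have "(\<lambda>n. ennreal (\<Sum>k<Suc n. h n * \<bar>green_dt 1 G x (r n k) y\<bar>)) = (\<lambda>n. X n y)"
      proof
        fix n
        show "ennreal (\<Sum>k<Suc n. h n * \<bar>green_dt 1 G x (r n k) y\<bar>) = X n y"
          unfolding X_def using h[of n] by (subst sum_ennreal[symmetric]) (auto simp: ennreal_mult)
      qed
      finally show ?case .
    qed
  qed
  also have "\<dots> \<le> liminf (\<lambda>n. \<integral>\<^sup>+y. X n y \<partial>?N)"
    unfolding X_def by (intro nn_integral_liminf borel_measurable_sum) (use mX in auto)
  also have "\<dots> \<le> liminf (\<lambda>n::nat. ennreal ?R)"
  proof (intro Liminf_mono always_eventually allI)
    fix n
    have "(\<integral>\<^sup>+y. X n y \<partial>?N) = (\<Sum>k<Suc n. \<integral>\<^sup>+y. ennreal (h n) * ennreal \<bar>green_dt 1 G x (r n k) y\<bar> \<partial>?N)"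
      unfolding X_def by (rule nn_integral_sum) (use mX in auto)
    also have "\<dots> = (\<Sum>k<Suc n. ennreal (h n) * L1_norm \<Omega> (green_dt 1 G x (r n k)))"
      unfolding L1_norm_def
    proof (rule sum.cong[OF refl])
      fix k assume "k \<in> {..<Suc n}"
      then have "green_dt 1 G x (r n k) \<in> borel_measurable ?N"
        using green_dt_measurable[OF S G r(1)] by simp
      then show "(\<integral>\<^sup>+y. ennreal (h n) * ennreal \<bar>green_dt 1 G x (r n k) y\<bar> \<partial>?N)
          = ennreal (h n) * (\<integral>\<^sup>+y. ennreal \<bar>green_dt 1 G x (r n k) y\<bar> \<partial>?N)"
        by (intro nn_integral_cmult) measurable
    qed
    also have "\<dots> \<le> (\<Sum>k<Suc n. ennreal (h n) * ennreal ((\<kappa> 1 / r n k + \<kappa>' 1) * exp (- \<gamma> * r n k)))"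
    proof (intro sum_mono mult_left_mono)
      fix k assume "k \<in> {..<Suc n}"
      then have "r n k \<in> {0<..T}" using r[of k n] by simp
      from green_dt_L1[OF bd G(2) this, of 1]
      show "L1_norm \<Omega> (green_dt 1 G x (r n k)) \<le> ennreal ((\<kappa> 1 / r n k + \<kappa>' 1) * exp (- \<gamma> * r n k))"
        by simp
    qed simp
    also have "\<dots> = (\<Sum>k<Suc n. ennreal (h n * ((\<kappa> 1 / r n k + \<kappa>' 1) * exp (- \<gamma> * r n k))))"
      using h[of n] r \<kappa> by (intro sum.cong refl ennreal_mult[symmetric]) (auto intro!: mult_nonneg_nonneg add_nonneg_nonneg divide_nonneg_pos)
    also have "\<dots> = ennreal (\<Sum>k<Suc n. h n * ((\<kappa> 1 / r n k + \<kappa>' 1) * exp (- \<gamma> * r n k)))"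
    proof (rule sum_ennreal)
      fix k assume "k \<in> {..<Suc n}"
      then have "0 < r n k" using r by simp
      then show "0 \<le> h n * ((\<kappa> 1 / r n k + \<kappa>' 1) * exp (- \<gamma> * r n k))"
        using h[of n] \<kappa> by (intro mult_nonneg_nonneg add_nonneg_nonneg divide_nonneg_pos) simp_all
    qed
    also have "\<dots> \<le> ennreal ?R"
      unfolding h_def r_def by (intro ennreal_leI Riemann_sum_le_log_increment ab less \<kappa>)
    finally show "(\<integral>\<^sup>+y. X n y \<partial>?N) \<le> ennreal ?R" .
  qed
  also have "\<dots> = ennreal ?R" by (simp add: Liminf_const)
  finally show ?thesis .
qed

lemma green_L1:
  assumes "green_bounds \<Omega> T G \<kappa> \<kappa>' \<gamma>" "x \<in> \<Omega>" "s \<in> {0<..T}"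
  shows "L1_norm \<Omega> (G x s) \<le> ennreal (\<kappa> 0 * exp (- \<gamma> * s))"
proof -
  have "\<kappa>' 0 = 0" using assms(1) by (simp add: green_bounds_def)
  moreover have "green_dt 0 G x s = G x s" by (rule ext) (simp add: green_dt_def)
  ultimately show ?thesis using green_dt_L1[OF assms, of 0] by simp
qed

section \<open>Pairing with bounded functions\<close>

lemma nn_integral_abs_mult_le_Linf_L1:
  assumes "g \<in> borel_measurable (lebesgue_on \<Omega>)"
  shows "(\<integral>\<^sup>+y. ennreal \<bar>F y * g y\<bar> \<partial>lebesgue_on \<Omega>) \<le> Linf_norm \<Omega> F * L1_norm \<Omega> g"
proof -
  have "(\<integral>\<^sup>+y. ennreal \<bar>F y * g y\<bar> \<partial>lebesgue_on \<Omega>)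
      \<le> (\<integral>\<^sup>+y. Linf_norm \<Omega> F * ennreal \<bar>g y\<bar> \<partial>lebesgue_on \<Omega>)"
  proof (rule nn_integral_mono_AE)
    show "AE y in lebesgue_on \<Omega>. ennreal \<bar>F y * g y\<bar> \<le> Linf_norm \<Omega> F * ennreal \<bar>g y\<bar>"
      using esssup_AE[of "\<lambda>y. ennreal \<bar>F y\<bar>" "lebesgue_on \<Omega>"]
      by eventually_elim (simp add: Linf_norm_def abs_mult ennreal_mult mult_right_mono)
  qed
  also have "\<dots> = Linf_norm \<Omega> F * L1_norm \<Omega> g"
    unfolding L1_norm_def using assms by (intro nn_integral_cmult) measurable
  finally show ?thesis .
qed

lemma abs_L2_inner_le_Linf_L1:
  assumes "g \<in> borel_measurable (lebesgue_on \<Omega>)"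
  shows "ennreal \<bar>L2_inner \<Omega> F g\<bar> \<le> Linf_norm \<Omega> F * L1_norm \<Omega> g"
proof (cases "integrable (lebesgue_on \<Omega>) (\<lambda>y. F y * g y)")
  case True
  have "ennreal \<bar>L2_inner \<Omega> F g\<bar> \<le> (\<integral>\<^sup>+y. ennreal \<bar>F y * g y\<bar> \<partial>lebesgue_on \<Omega>)"
    unfolding L2_inner_def using integral_norm_bound_ennreal[OF True] by simp
  also have "\<dots> \<le> Linf_norm \<Omega> F * L1_norm \<Omega> g" by (rule nn_integral_abs_mult_le_Linf_L1[OF assms])
  finally show ?thesis .
next
  case False
  then show ?thesis by (simp add: L2_inner_def not_integrable_integral_eq)
qed

lemma integrable_Linf_times_L1:
  assumes "F \<in> borel_measurable (lebesgue_on \<Omega>)" "g \<in> borel_measurable (lebesgue_on \<Omega>)"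
    and "Linf_norm \<Omega> F < \<infinity>" "L1_norm \<Omega> g < \<infinity>"
  shows "integrable (lebesgue_on \<Omega>) (\<lambda>y. F y * g y)"
proof (rule integrableI_bounded)
  show "(\<lambda>y. F y * g y) \<in> borel_measurable (lebesgue_on \<Omega>)"
    using assms(1,2) by (rule borel_measurable_times)
  have "(\<integral>\<^sup>+y. ennreal \<bar>F y * g y\<bar> \<partial>lebesgue_on \<Omega>) \<le> Linf_norm \<Omega> F * L1_norm \<Omega> g"
    by (rule nn_integral_abs_mult_le_Linf_L1[OF assms(2)])
  also have "\<dots> < \<infinity>" using assms(3,4) by (simp add: ennreal_mult_less_top)
  finally show "(\<integral>\<^sup>+y. ennreal (norm (F y * g y)) \<partial>lebesgue_on \<Omega>) < \<infinity>" by simp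
qed

lemma L1_norm_zero_imp_AE:
  assumes g: "g \<in> borel_measurable (lebesgue_on \<Omega>)" and "L1_norm \<Omega> g = 0"
  shows "AE y in lebesgue_on \<Omega>. g y = 0"
proof -
  have "(\<lambda>y. ennreal \<bar>g y\<bar>) \<in> borel_measurable (lebesgue_on \<Omega>)" using g by measurable
  then have "AE y in lebesgue_on \<Omega>. ennreal \<bar>g y\<bar> = 0"
    using assms(2) by (simp add: L1_norm_def nn_integral_0_iff_AE)
  then show ?thesis by eventually_elim simp
qed

text \<open>Hoelder's inequality; the two parts control the values and the oscillation of
\<open>s \<mapsto> D(G(T - s))\<close>.\<close>

lemma represented_functional_bounds:
  assumes h: "represents \<Omega> h D" "Linf_norm \<Omega> h = ennreal N" "N \<ge> 0"
  shows "\<phi> \<in> H10 \<Omega> \<Longrightarrow> L1_norm \<Omega> \<phi> \<le> ennreal K \<Longrightarrow> K \<ge> 0 \<Longrightarrow> \<bar>D \<phi>\<bar> \<le> N * K"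
    and "\<phi> \<in> H10 \<Omega> \<Longrightarrow> \<omega> \<in> H10 \<Omega> \<Longrightarrow> L1_norm \<Omega> \<phi> < \<infinity> \<Longrightarrow> L1_norm \<Omega> \<omega> < \<infinity>
      \<Longrightarrow> L1_norm \<Omega> (\<lambda>y. \<phi> y - \<omega> y) \<le> ennreal K \<Longrightarrow> K \<ge> 0 \<Longrightarrow> \<bar>D \<phi> - D \<omega>\<bar> \<le> N * K"
proof -
  have mh: "h \<in> borel_measurable (lebesgue_on \<Omega>)" and
    rep: "\<And>\<phi>. \<phi> \<in> H10 \<Omega> \<Longrightarrow> integrable (lebesgue_on \<Omega>) (\<lambda>x. h x * \<phi> x) \<Longrightarrow> D \<phi> = L2_inner \<Omega> h \<phi>"
    using h(1) by (simp_all add: represents_def)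
  have m: "\<phi> \<in> borel_measurable (lebesgue_on \<Omega>)" if "\<phi> \<in> H10 \<Omega>" for \<phi>
    by (intro L2_measurable H10_imp_L2 that)
  have int: "integrable (lebesgue_on \<Omega>) (\<lambda>x. h x * \<phi> x)" if "\<phi> \<in> H10 \<Omega>" "L1_norm \<Omega> \<phi> < \<infinity>" for \<phi>
    using h(2) by (intro integrable_Linf_times_L1 mh m that) simp
  have bound: "\<bar>L2_inner \<Omega> h g\<bar> \<le> N * K" if "g \<in> borel_measurable (lebesgue_on \<Omega>)" "L1_norm \<Omega> g \<le> ennreal K" "K \<ge> 0" for g K
  proof -
    have "ennreal \<bar>L2_inner \<Omega> h g\<bar> \<le> ennreal N * ennreal K"
      using abs_L2_inner_le_Linf_L1[OF that(1), of h] that(2) h(2)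
      by (metis mult_left_mono order_trans zero_le)
    then show ?thesis using h(3) that(3) by (simp add: ennreal_mult[symmetric])
  qed
  show "\<bar>D \<phi>\<bar> \<le> N * K" if "\<phi> \<in> H10 \<Omega>" "L1_norm \<Omega> \<phi> \<le> ennreal K" "K \<ge> 0" for \<phi> K
  proof -
    have "L1_norm \<Omega> \<phi> < \<infinity>" using that(2) by (rule order_le_less_trans) simp
    then show ?thesis using rep[OF that(1) int] bound[OF m] that by simp
  qed
  show "\<bar>D \<phi> - D \<omega>\<bar> \<le> N * K"
    if "\<phi> \<in> H10 \<Omega>" "\<omega> \<in> H10 \<Omega>" "L1_norm \<Omega> \<phi> < \<infinity>" "L1_norm \<Omega> \<omega> < \<infinity>"
      "L1_norm \<Omega> (\<lambda>y. \<phi> y - \<omega> y) \<le> ennreal K" "K \<ge> 0" for \<phi> \<omega> K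
  proof -
    have "D \<phi> - D \<omega> = L2_inner \<Omega> h (\<lambda>y. \<phi> y - \<omega> y)"
      using rep[OF that(1) int] rep[OF that(2) int] int that
      by (simp add: L2_inner_def right_diff_distrib)
    then show ?thesis
      using bound[OF borel_measurable_diff[OF m m, OF that(1,2)] that(5,6)] by simp
  qed
qed

section \<open>The contribution of one mesh interval\<close>

text \<open>The oscillation bound makes \<open>g\<close> continuous, hence measurable; the two estimates correspond to
\<open>\<Phi>\<^sub>1\<^sup>*\<close> and \<open>\<Phi>\<^sub>1\<close>.\<close>

lemma midpoint_weight_bounds:
  fixes g \<beta> :: "real \<Rightarrow> real"
  assumes ab: "a < b" "b \<le> T" and E: "E \<ge> 0"
    and \<beta>: "\<And>s. \<beta> s = - (c * ln (T - s) + d * (T - s))"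
    and K: "\<And>s. s \<in> {a<..<b} \<Longrightarrow> \<bar>g s\<bar> \<le> K"
    and inc: "\<And>s r. a < s \<Longrightarrow> s \<le> r \<Longrightarrow> r < b \<Longrightarrow> \<bar>g r - g s\<bar> \<le> E * (\<beta> r - \<beta> s)"
  shows "integrable (lebesgue_on {a<..<b}) (\<lambda>s. (s - (a + b) / 2) * g s)"
    and "\<bar>LINT s|lebesgue_on {a<..<b}. (s - (a + b) / 2) * g s\<bar> \<le> K * integral {a..b} (\<lambda>s. \<bar>s - (a + b) / 2\<bar>)"
    and "\<bar>LINT s|lebesgue_on {a<..<b}. (s - (a + b) / 2) * g s\<bar>
      \<le> E * ((c * integral {a..b} (\<lambda>s. (b - s) * (s - a) / (T - s)) + d * ((b - a) ^ 3 / 6)) / 2)"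
proof -
  let ?m = "(a + b) / 2" and ?I = "{a<..<b}"
  have S: "?I \<in> sets lebesgue" by simp
  have "continuous_on ?I \<beta>"
    unfolding \<beta> using ab by (intro continuous_intros) auto
  have "continuous_on ?I g"
    unfolding continuous_on_def
  proof
    fix s assume s: "s \<in> ?I"
    have "((\<lambda>r. E * \<bar>\<beta> r - \<beta> s\<bar>) \<longlongrightarrow> E * \<bar>\<beta> s - \<beta> s\<bar>) (at s within ?I)"
      using \<open>continuous_on ?I \<beta>\<close> s by (intro tendsto_intros) (auto simp: continuous_on_def)
    then have lim: "((\<lambda>r. E * \<bar>\<beta> r - \<beta> s\<bar>) \<longlongrightarrow> 0) (at s within ?I)" by simp
    have "\<bar>g r - g s\<bar> \<le> E * \<bar>\<beta> r - \<beta> s\<bar>" if "r \<in> ?I" for r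
    proof (cases "s \<le> r")
      case True
      then have "\<bar>g r - g s\<bar> \<le> E * (\<beta> r - \<beta> s)" using inc[of s r] s that by simp
      also have "\<dots> \<le> E * \<bar>\<beta> r - \<beta> s\<bar>" using E by (intro mult_left_mono) auto
      finally show ?thesis .
    next
      case False
      then have "\<bar>g r - g s\<bar> \<le> E * (\<beta> s - \<beta> r)" using inc[of r s] s that by (simp add: abs_minus_commute)
      also have "\<dots> \<le> E * \<bar>\<beta> r - \<beta> s\<bar>" using E by (intro mult_left_mono) auto
      finally show ?thesis .
    qed
    then have "\<forall>\<^sub>F r in at s within ?I. norm (g r - g s) \<le> E * \<bar>\<beta> r - \<beta> s\<bar>"
      by (simp add: eventually_at_filter)
    from Lim_null_comparison[OF this lim] show "(g \<longlongrightarrow> g s) (at s within ?I)"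
      by (simp add: Lim_null[symmetric])
  qed
  then have "continuous_on ?I (\<lambda>s. (s - ?m) * g s)" by (intro continuous_intros)
  then have meas: "(\<lambda>s. (s - ?m) * g s) \<in> borel_measurable (lebesgue_on ?I)"
    using S by (rule continuous_imp_measurable_on_sets_lebesgue)
  have K0: "K \<ge> 0" using K[of ?m] ab by (auto intro: order_trans[OF abs_ge_zero])
  have wK: "\<bar>(s - ?m) * g s\<bar> \<le> K * \<bar>s - ?m\<bar>" if "s \<in> ?I" for s
    using mult_right_mono[OF K[OF that], of "\<bar>s - ?m\<bar>"] by (simp add: abs_mult mult.commute)
  have "integrable (lebesgue_on ?I) (\<lambda>s. K * \<bar>s - ?m\<bar>)"
  proof -
    have "integrable (lebesgue_on {a..b}) (\<lambda>s. K * \<bar>s - ?m\<bar>)"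
      by (rule continuous_imp_integrable_real) (intro continuous_intros)
    then show ?thesis by (rule integrable_subset_lebesgue_on) auto
  qed
  then show int: "integrable (lebesgue_on ?I) (\<lambda>s. (s - ?m) * g s)"
    by (rule Bochner_Integration.integrable_bound[OF _ meas]) (use wK K0 in \<open>auto simp: abs_mult intro!: AE_I2\<close>)
  have eq: "(LINT s|lebesgue_on ?I. (s - ?m) * g s) = integral {a..b} (\<lambda>s. (s - ?m) * g s)"
    by (rule lebesgue_integral_Ioo_eq_integral_Icc[OF int])
  have HK: "(\<lambda>s. (s - ?m) * g s) integrable_on ?I"
    using int S by (rule integrable_on_lebesgue_on)
  have "norm (integral ?I (\<lambda>s. (s - ?m) * g s)) \<le> integral ?I (\<lambda>s. K * \<bar>s - ?m\<bar>)"
  proof (rule integral_norm_bound_integral[OF HK])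
    show "(\<lambda>s. K * \<bar>s - ?m\<bar>) integrable_on ?I"
      unfolding integrable_on_open_interval_real
      by (intro integrable_continuous_interval continuous_intros)
  qed (use wK in simp)
  then show "\<bar>LINT s|lebesgue_on ?I. (s - ?m) * g s\<bar> \<le> K * integral {a..b} (\<lambda>s. \<bar>s - ?m\<bar>)"
    unfolding eq integral_open_interval_real[symmetric] by simp
  note L = integral_midpoint_weight_log[OF ab, of c d]
  have L': "((\<lambda>s. (s - ?m) * (E * \<beta> s)) has_integral
      E * ((c * integral {a..b} (\<lambda>s. (b - s) * (s - a) / (T - s)) + d * ((b - a) ^ 3 / 6)) / 2)) {a..b}"
    using has_integral_mult_right[OF L, of E] unfolding \<beta> by (simp only: mult.left_commute)
  have "\<bar>integral {a..b} (\<lambda>s. (s - ?m) * g s)\<bar> \<le> integral {a..b} (\<lambda>s. (s - ?m) * (E * \<beta> s))"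
  proof (rule integral_midpoint_weight_le[OF ab(1)])
    show "(\<lambda>s. (s - ?m) * g s) integrable_on {a..b}" using HK unfolding integrable_on_open_interval_real .
    show "(\<lambda>s. (s - ?m) * (E * \<beta> s)) integrable_on {a..b}" using L' by (rule has_integral_integrable)
    show "\<bar>g r - g s\<bar> \<le> E * \<beta> r - E * \<beta> s" if "a < s" "s \<le> r" "r < b" for s r
      using inc[OF that] by (simp add: right_diff_distrib)
  qed
  then show "\<bar>LINT s|lebesgue_on ?I. (s - ?m) * g s\<bar>
      \<le> E * ((c * integral {a..b} (\<lambda>s. (b - s) * (s - a) / (T - s)) + d * ((b - a) ^ 3 / 6)) / 2)"
    unfolding eq integral_unique[OF L'] .
qed

text \<open>If the prefactor is positive, finiteness provides bounded functions representing \<open>D\<close>, and the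
estimate holds with the norm of each of them. If it vanishes, then either \<open>G\<close> itself or its time
derivative is zero, so that \<open>D(G(T - s))\<close> is constant in \<open>s\<close> and the weight integrates it to zero.\<close>

lemma residual_estimate:
  assumes S: "\<Omega> \<in> sets lebesgue" and G: "green_function \<Omega> P G" "x \<in> \<Omega>"
    and bd: "green_bounds \<Omega> T G \<kappa> \<kappa>' \<gamma>"
    and j: "0 \<le> t (j - 1)" "t (j - 1) < t j" "t j \<le> T"
    and cong: "\<And>\<phi> \<omega>. \<phi> \<in> H10 \<Omega> \<Longrightarrow> \<omega> \<in> H10 \<Omega> \<Longrightarrow> AE y in lebesgue_on \<Omega>. \<phi> y = \<omega> y \<Longrightarrow> D \<phi> = D \<omega>"
    and fin: "ennreal (Psi1 \<kappa> \<kappa>' T t j / 2) * Linf_norm_dual \<Omega> D < \<infinity>"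
  shows "integrable (lebesgue_on {t (j - 1)<..<t j}) (\<lambda>s. (s - midpt t j) * D (G x (T - s)))"
    and "ennreal \<bar>LINT s|lebesgue_on {t (j - 1)<..<t j}. (s - midpt t j) * D (G x (T - s))\<bar>
      \<le> ennreal (exp (- \<gamma> * (T - t j))) * (ennreal (Psi1 \<kappa> \<kappa>' T t j / 2) * Linf_norm_dual \<Omega> D)"
proof -
  let ?a = "t (j - 1)" and ?b = "t j"
  let ?I = "{?a<..<?b}" and ?Psi = "Psi1 \<kappa> \<kappa>' T t j / 2"
  define e where "e = exp (- \<gamma> * (T - ?b))"
  define g where "g s = D (G x (T - s))" for s
  define \<beta> where "\<beta> s = - (\<kappa> 1 * ln (T - s) + \<kappa>' 1 * (T - s))" for s
  have e: "e > 0" by (simp add: e_def)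
  have \<kappa>: "\<kappa> 0 \<ge> 0" "\<kappa> 1 \<ge> 0" "\<kappa>' 1 \<ge> 0" "\<gamma> \<ge> 0" using bd by (auto simp: green_bounds_def)
  have mid: "midpt t j = (?a + ?b) / 2" by (simp add: midpt_def step_def field_simps)
  have H10: "G x (T - s) \<in> H10 \<Omega>" if "s \<in> ?I" for s
    using that j by (intro green_in_H10_measurable(1)[OF G]) auto
  have exp_le: "exp (- \<gamma> * (T - s)) \<le> e" if "s \<in> ?I" for s
    using that \<kappa>(4) by (simp add: e_def mult_left_mono)
  have L1: "L1_norm \<Omega> (G x (T - s)) \<le> ennreal (\<kappa> 0 * e)" if "s \<in> ?I" for s
  proof -
    have "L1_norm \<Omega> (G x (T - s)) \<le> ennreal (\<kappa> 0 * exp (- \<gamma> * (T - s)))"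
      using that j by (intro green_L1[OF bd G(2)]) auto
    also have "\<dots> \<le> ennreal (\<kappa> 0 * e)"
      using exp_le[OF that] \<kappa>(1) by (intro ennreal_leI mult_left_mono)
    finally show ?thesis .
  qed
  have \<beta>_mono: "\<beta> s \<le> \<beta> r" if "s \<le> r" "r < ?b" for s r
  proof -
    have "ln (T - r) \<le> ln (T - s)" using that j by simp
    then have "\<kappa> 1 * ln (T - r) \<le> \<kappa> 1 * ln (T - s)" "\<kappa>' 1 * (T - r) \<le> \<kappa>' 1 * (T - s)"
      using \<kappa> that by (simp_all add: mult_left_mono)
    then show ?thesis by (simp add: \<beta>_def)
  qed
  have L1_inc: "L1_norm \<Omega> (\<lambda>y. G x (T - r) y - G x (T - s) y) \<le> ennreal (e * (\<beta> r - \<beta> s))"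
    if "?a < s" "s \<le> r" "r < ?b" for s r
  proof -
    have "L1_norm \<Omega> (\<lambda>y. G x (T - r) y - G x (T - s) y) = L1_norm \<Omega> (\<lambda>y. G x (T - s) y - G x (T - r) y)"
      by (simp add: L1_norm_def abs_minus_commute)
    also have "\<dots> \<le> ennreal (exp (- \<gamma> * (T - r)) * ((\<kappa> 1 * ln (T - s) + \<kappa>' 1 * (T - s)) - (\<kappa> 1 * ln (T - r) + \<kappa>' 1 * (T - r))))"
      using that j by (intro green_increment_L1[OF S G bd]) auto
    also have "(\<kappa> 1 * ln (T - s) + \<kappa>' 1 * (T - s)) - (\<kappa> 1 * ln (T - r) + \<kappa>' 1 * (T - r)) = \<beta> r - \<beta> s"
      by (simp add: \<beta>_def)
    also have "ennreal (exp (- \<gamma> * (T - r)) * (\<beta> r - \<beta> s)) \<le> ennreal (e * (\<beta> r - \<beta> s))"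
      using exp_le[of r] \<beta>_mono[OF that(2,3)] that by (intro ennreal_leI mult_right_mono) auto
    finally show ?thesis .
  qed
  have main: "integrable (lebesgue_on ?I) (\<lambda>s. (s - (?a + ?b) / 2) * g s) \<and>
      \<bar>LINT s|lebesgue_on ?I. (s - (?a + ?b) / 2) * g s\<bar> \<le> e * ?Psi * N"
    if h: "represents \<Omega> h D" "Linf_norm \<Omega> h = ennreal N" "N \<ge> 0" for h N
  proof -
    have K: "\<bar>g s\<bar> \<le> N * (\<kappa> 0 * e)" if "s \<in> ?I" for s
      unfolding g_def using \<kappa> e by (intro represented_functional_bounds(1)[OF h H10 L1] that) simp
    have inc: "\<bar>g r - g s\<bar> \<le> (N * e) * (\<beta> r - \<beta> s)" if "?a < s" "s \<le> r" "r < ?b" for s r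
    proof -
      have sr: "s \<in> ?I" "r \<in> ?I" using that by auto
      have fin: "L1_norm \<Omega> (G x (T - s)) < \<infinity>" if "s \<in> ?I" for s
        using L1[OF that] by (rule order_le_less_trans) simp
      have "\<bar>D (G x (T - r)) - D (G x (T - s))\<bar> \<le> N * (e * (\<beta> r - \<beta> s))"
        using e \<beta>_mono[OF that(2,3)]
        by (intro represented_functional_bounds(2)[OF h] H10 fin sr L1_inc that) simp
      then show ?thesis unfolding g_def by (simp only: mult.assoc)
    qed
    have Ne: "N * e \<ge> 0" using h(3) e by simp
    note B = midpoint_weight_bounds[OF j(2,3) Ne \<beta>_def K inc]
    let ?L = "\<bar>LINT s|lebesgue_on ?I. (s - (?a + ?b) / 2) * g s\<bar>"
    have "?L \<le> (N * e) * (Phi1_star \<kappa> t j / 2)"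
      using B(2) unfolding Phi1_star_eq by (simp add: mult_ac)
    moreover have "?L \<le> (N * e) * (Phi1 \<kappa> \<kappa>' T t j / 2)"
      using B(3) unfolding Phi1_def step_def .
    ultimately have "?L \<le> e * ?Psi * N" unfolding Psi1_def by (simp add: min_def mult_ac)
    with B(1) show ?thesis by blast
  qed
  have "integrable (lebesgue_on ?I) (\<lambda>s. (s - midpt t j) * g s) \<and>
    ennreal \<bar>LINT s|lebesgue_on ?I. (s - midpt t j) * g s\<bar> \<le> ennreal e * (ennreal ?Psi * Linf_norm_dual \<Omega> D)"
  proof (cases "?Psi > 0")
    case True
    then have "Linf_norm_dual \<Omega> D < \<infinity>" using fin by (auto simp: ennreal_mult_less_top)
    then obtain h0 where h0: "represents \<Omega> h0 D" "Linf_norm \<Omega> h0 < \<infinity>"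
      by (auto simp: Linf_norm_dual_def INF_less_iff)
    then have "Linf_norm \<Omega> h0 = ennreal (enn2real (Linf_norm \<Omega> h0))" by simp
    from main[OF h0(1) this] have int: "integrable (lebesgue_on ?I) (\<lambda>s. (s - midpt t j) * g s)"
      unfolding mid by simp
    define X where "X = ennreal \<bar>LINT s|lebesgue_on ?I. (s - midpt t j) * g s\<bar>"
    define C where "C = ennreal (e * ?Psi)"
    have C: "C \<noteq> 0" "C \<noteq> top" "C > 0" using True e by (auto simp: C_def)
    \<comment> \<open>Dividing by the prefactor turns the bounds for all representing functions into one for their infimum.\<close>
    have "X / C \<le> Linf_norm_dual \<Omega> D"
      unfolding Linf_norm_dual_def
    proof (rule INF_greatest)
      fix h assume "h \<in> {h. represents \<Omega> h D}"
      then have h: "represents \<Omega> h D" by simp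
      show "X / C \<le> Linf_norm \<Omega> h"
      proof (cases "Linf_norm \<Omega> h = top")
        case False
        then obtain N where N: "Linf_norm \<Omega> h = ennreal N" "N \<ge> 0"
          by (cases "Linf_norm \<Omega> h") auto
        have "X \<le> ennreal (e * ?Psi * N)"
          unfolding X_def mid using main[OF h N] by (intro ennreal_leI) simp
        also have "\<dots> = C * Linf_norm \<Omega> h"
          unfolding C_def N(1) using N(2) True e by (intro ennreal_mult) simp_all
        finally show ?thesis using C by (intro divide_le_posI_ennreal)
      qed simp
    qed
    then have "C * (X / C) \<le> C * Linf_norm_dual \<Omega> D" by (rule mult_left_mono) simp
    moreover have "C * (X / C) = X"
      using C by (metis ennreal_times_divide mult.commute mult_divide_eq_ennreal)
    ultimately have "X \<le> C * Linf_norm_dual \<Omega> D" by simp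
    moreover have "ennreal (e * ?Psi) = ennreal e * ennreal ?Psi"
      by (rule ennreal_mult) (use True e in linarith)+
    ultimately have "X \<le> ennreal e * (ennreal ?Psi * Linf_norm_dual \<Omega> D)"
      unfolding C_def by (simp only: mult.assoc)
    with int show ?thesis unfolding X_def by (rule conjI)
  next
    case False
    then have "Phi1 \<kappa> \<kappa>' T t j \<le> 0 \<or> Phi1_star \<kappa> t j \<le> 0" by (auto simp: Psi1_def min_def split: if_splits)
    then have "(\<kappa> 1 = 0 \<and> \<kappa>' 1 = 0) \<or> \<kappa> 0 = 0"
      using Phi1_nonpos_imp_constants_zero[of t j T \<kappa> \<kappa>'] Phi1_star_nonpos_imp_constant_zero[of t j \<kappa>] j \<kappa> by blast
    then have zero: "L1_norm \<Omega> (\<lambda>y. G x (T - r) y - G x (T - s) y) = 0" if "?a < s" "s \<le> r" "r < ?b" for s r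
    proof
      assume "\<kappa> 1 = 0 \<and> \<kappa>' 1 = 0"
      then show ?thesis using L1_inc[OF that] by (simp add: \<beta>_def)
    next
      assume 0: "\<kappa> 0 = 0"
      have "L1_norm \<Omega> (\<lambda>y. G x (T - r) y - G x (T - s) y) \<le> L1_norm \<Omega> (G x (T - r)) + L1_norm \<Omega> (G x (T - s))"
      proof -
        have m: "G x (T - z) \<in> borel_measurable (lebesgue_on \<Omega>)" if "z \<in> ?I" for z
          by (intro L2_measurable H10_imp_L2 H10 that)
        have m2: "G x (T - r) \<in> borel_measurable (lebesgue_on \<Omega>)" "G x (T - s) \<in> borel_measurable (lebesgue_on \<Omega>)"
          using that by (auto intro!: m)
        show ?thesis
          unfolding L1_norm_def
        proof (subst nn_integral_add[symmetric])
          show "(\<integral>\<^sup>+y. ennreal \<bar>G x (T - r) y - G x (T - s) y\<bar> \<partial>lebesgue_on \<Omega>)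
              \<le> (\<integral>\<^sup>+y. ennreal \<bar>G x (T - r) y\<bar> + ennreal \<bar>G x (T - s) y\<bar> \<partial>lebesgue_on \<Omega>)"
            by (intro nn_integral_mono)
              (simp add: ennreal_plus[symmetric] abs_triangle_ineq4 del: ennreal_plus)
        qed (use m2 in measurable)
      qed
      then show ?thesis using L1[of r] L1[of s] that 0 by simp
    qed
    have const: "g s = g r" if "?a < s" "s \<le> r" "r < ?b" for s r
    proof -
      have sr: "s \<in> ?I" "r \<in> ?I" using that by auto
      have "(\<lambda>y. G x (T - r) y - G x (T - s) y) \<in> borel_measurable (lebesgue_on \<Omega>)"
        by (intro borel_measurable_diff L2_measurable H10_imp_L2 H10 sr)
      from L1_norm_zero_imp_AE[OF this zero[OF that]] have "AE y in lebesgue_on \<Omega>. G x (T - s) y = G x (T - r) y" by eventually_elim simp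
      then show ?thesis unfolding g_def by (rule cong[OF H10[OF sr(1)] H10[OF sr(2)]])
    qed
    define c where "c = g ((?a + ?b) / 2)"
    have "g s = c" if "s \<in> ?I" for s
    proof (cases "s \<le> (?a + ?b) / 2")
      case True
      then show ?thesis unfolding c_def using that by (intro const) auto
    next
      case False
      then show ?thesis unfolding c_def using that by (intro const[symmetric]) auto
    qed
    then have gc: "(s - midpt t j) * g s = (s - (?a + ?b) / 2) * c" if "s \<in> ?I" for s using that mid by simp
    have cont: "integrable (lebesgue_on ?I) (\<lambda>s. (s - (?a + ?b) / 2) * c)"
    proof -
      have "integrable (lebesgue_on {?a..?b}) (\<lambda>s. (s - (?a + ?b) / 2) * c)"
        by (rule continuous_imp_integrable_real) (intro continuous_intros)
      then show ?thesis by (rule integrable_subset_lebesgue_on) auto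
    qed
    have "integrable (lebesgue_on ?I) (\<lambda>s. (s - midpt t j) * g s)"
    proof -
      have "integrable (lebesgue_on ?I) (\<lambda>s. (s - midpt t j) * g s)
          \<longleftrightarrow> integrable (lebesgue_on ?I) (\<lambda>s. (s - (?a + ?b) / 2) * c)"
        by (rule Bochner_Integration.integrable_cong[OF refl]) (simp only: gc space_lebesgue_on)
      with cont show ?thesis by blast
    qed
    moreover have "(LINT s|lebesgue_on ?I. (s - midpt t j) * g s) = (LINT s|lebesgue_on ?I. (s - (?a + ?b) / 2) * c)"
      by (rule Bochner_Integration.integral_cong[OF refl]) (simp only: gc space_lebesgue_on)
    moreover have "(LINT s|lebesgue_on ?I. (s - (?a + ?b) / 2) * c) = 0"
    proof -
      have "((\<lambda>s. (s - (?a + ?b) / 2) * c) has_integral 0 * c) {?a..?b}"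
        using integral_id_minus_midpoint[of ?a ?b] j(2) by (intro has_integral_mult_left) auto
      then have "integral {?a..?b} (\<lambda>s. (s - (?a + ?b) / 2) * c) = 0"
        by (simp only: integral_unique mult_zero_left)
      then show ?thesis by (simp only: lebesgue_integral_Ioo_eq_integral_Icc[OF cont])
    qed
    ultimately show ?thesis by (simp only: abs_zero ennreal_0 zero_le simp_thms)
  qed
  note both = this[unfolded g_def e_def]
  show "integrable (lebesgue_on ?I) (\<lambda>s. (s - midpt t j) * D (G x (T - s)))"
    "ennreal \<bar>LINT s|lebesgue_on ?I. (s - midpt t j) * D (G x (T - s))\<bar>
      \<le> ennreal (exp (- \<gamma> * (T - ?b))) * (ennreal ?Psi * Linf_norm_dual \<Omega> D)"
    by (rule conjunct1[OF both], rule conjunct2[OF both])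
qed

text \<open>Meant for \<open>N(s) = \<parallel>f(s) - F(s)\<parallel>\<^sub>\<infinity>\<close>, a function of \<open>s\<close> whose measurability is unknown. The constant is
therefore pulled out of the integral of \<open>p\<close> instead.\<close>

lemma nn_integral_abs_le_cmult:
  fixes N :: "real \<Rightarrow> ennreal"
  assumes p: "p \<in> borel_measurable M" and c: "c \<ge> 0"
    and le: "AE s in M. ennreal \<bar>p s\<bar> \<le> ennreal c * N s"
  shows "(\<integral>\<^sup>+s. ennreal \<bar>p s\<bar> \<partial>M) \<le> ennreal c * (\<integral>\<^sup>+s. N s \<partial>M)"
proof (cases "c = 0")
  case True
  then have "AE s in M. ennreal \<bar>p s\<bar> = 0" using le by auto
  then have "(\<integral>\<^sup>+s. ennreal \<bar>p s\<bar> \<partial>M) = (\<integral>\<^sup>+s. 0 \<partial>M)" by (rule nn_integral_cong_AE)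
  then show ?thesis by simp
next
  case False
  with c have c: "c > 0" by simp
  have eq: "ennreal \<bar>p s\<bar> = ennreal c * ennreal (\<bar>p s\<bar> / c)" for s
    using c by (simp add: ennreal_mult[symmetric])
  have "(\<integral>\<^sup>+s. ennreal \<bar>p s\<bar> \<partial>M) = ennreal c * (\<integral>\<^sup>+s. ennreal (\<bar>p s\<bar> / c) \<partial>M)"
    unfolding eq by (intro nn_integral_cmult measurable_compose[OF _ measurable_ennreal]
      borel_measurable_divide borel_measurable_abs borel_measurable_const p)
  also have "(\<integral>\<^sup>+s. ennreal (\<bar>p s\<bar> / c) \<partial>M) \<le> (\<integral>\<^sup>+s. N s \<partial>M)"
  proof (rule nn_integral_mono_AE)
    show "AE s in M. ennreal (\<bar>p s\<bar> / c) \<le> N s"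
      using le
    proof eventually_elim
      case (elim s)
      then have "ennreal c * ennreal (\<bar>p s\<bar> / c) \<le> ennreal c * N s" by (simp only: eq)
      then show ?case using c by (simp add: ennreal_mult_le_mult_iff)
    qed
  qed
  finally show ?thesis by (simp add: mult_left_mono)
qed

text \<open>The pairing of \<open>F(s)\<close> with the Green function inherits integrability in \<open>s\<close> from \<open>p\<close> and from the
residual term, of which it is the sum almost everywhere.\<close>

lemma interval_contribution:
  assumes S: "\<Omega> \<in> sets lebesgue" and G: "green_function \<Omega> P G" "x \<in> \<Omega>"
    and bd: "green_bounds \<Omega> T G \<kappa> \<kappa>' \<gamma>"
    and j: "0 \<le> t (j - 1)" "t (j - 1) < t j" "t j \<le> T"
    and cong: "\<And>\<phi> \<omega>. \<phi> \<in> H10 \<Omega> \<Longrightarrow> \<omega> \<in> H10 \<Omega> \<Longrightarrow> AE y in lebesgue_on \<Omega>. \<phi> y = \<omega> y \<Longrightarrow> D \<phi> = D \<omega>"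
    and fin: "ennreal (Psi1 \<kappa> \<kappa>' T t j / 2) * Linf_norm_dual \<Omega> D < \<infinity>"
    and p: "integrable (lebesgue_on {t (j - 1)<..<t j}) p"
    and eq: "AE s in lebesgue_on {t (j - 1)<..<t j}.
      p s = L2_inner \<Omega> (F s) (G x (T - s)) - (s - midpt t j) * D (G x (T - s))"
  shows "ennreal \<bar>LINT s|lebesgue_on {t (j - 1)<..<t j}. p s\<bar>
    \<le> ennreal (exp (- \<gamma> * (T - t j))) *
        (ennreal (\<kappa> 0) * (\<integral>\<^sup>+s. Linf_norm \<Omega> (F s) \<partial>lebesgue_on {t (j - 1)<..<t j})
         + ennreal (Psi1 \<kappa> \<kappa>' T t j / 2) * Linf_norm_dual \<Omega> D)"
proof -
  let ?I = "lebesgue_on {t (j - 1)<..<t j}"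
  define r where "r s = (s - midpt t j) * D (G x (T - s))" for s
  define e where "e = exp (- \<gamma> * (T - t j))"
  have \<kappa>: "\<kappa> 0 \<ge> 0" "\<gamma> \<ge> 0" using bd by (auto simp: green_bounds_def)
  have e: "e > 0" by (simp add: e_def)
  have r: "integrable ?I r"
    and r_bd: "ennreal \<bar>LINT s|?I. r s\<bar> \<le> ennreal e * (ennreal (Psi1 \<kappa> \<kappa>' T t j / 2) * Linf_norm_dual \<Omega> D)"
    unfolding r_def e_def
    by (rule residual_estimate(1)[OF S G bd j _ fin], rule cong, assumption+)
      (rule residual_estimate(2)[OF S G bd j _ fin], rule cong, assumption+)
  have pr: "integrable ?I (\<lambda>s. p s + r s)" by (rule Bochner_Integration.integrable_add[OF p r])
  have "AE s in ?I. s \<in> {t (j - 1)<..<t j}" by (rule AE_I2) simp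
  with eq have le: "AE s in ?I. ennreal \<bar>p s + r s\<bar> \<le> ennreal (\<kappa> 0 * e) * Linf_norm \<Omega> (F s)"
  proof eventually_elim
    case (elim s)
    then have s: "T - s \<in> {0<..T}" using j by auto
    have "ennreal \<bar>p s + r s\<bar> = ennreal \<bar>L2_inner \<Omega> (F s) (G x (T - s))\<bar>"
      using elim by (simp add: r_def)
    also have "\<dots> \<le> Linf_norm \<Omega> (F s) * L1_norm \<Omega> (G x (T - s))"
      using s by (intro abs_L2_inner_le_Linf_L1 green_in_H10_measurable(2)[OF G]) simp
    also have "\<dots> \<le> Linf_norm \<Omega> (F s) * ennreal (\<kappa> 0 * e)"
    proof (rule mult_left_mono)
      have "L1_norm \<Omega> (G x (T - s)) \<le> ennreal (\<kappa> 0 * exp (- \<gamma> * (T - s)))"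
        by (rule green_L1[OF bd G(2) s])
      also have "\<dots> \<le> ennreal (\<kappa> 0 * e)"
        using elim(2) \<kappa> by (intro ennreal_leI mult_left_mono) (auto simp: e_def intro!: mult_left_mono)
      finally show "L1_norm \<Omega> (G x (T - s)) \<le> ennreal (\<kappa> 0 * e)" .
    qed simp
    finally show ?case by (simp only: mult.commute)
  qed
  have "ennreal \<bar>LINT s|?I. p s + r s\<bar> \<le> (\<integral>\<^sup>+s. ennreal \<bar>p s + r s\<bar> \<partial>?I)"
    using integral_norm_bound_ennreal[OF pr] by simp
  also have "\<dots> \<le> ennreal (\<kappa> 0 * e) * (\<integral>\<^sup>+s. Linf_norm \<Omega> (F s) \<partial>?I)"
    using \<kappa> e by (intro nn_integral_abs_le_cmult borel_measurable_integrable[OF pr] le) simp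
  also have "ennreal (\<kappa> 0 * e) = ennreal e * ennreal (\<kappa> 0)"
    using \<kappa> e by (subst mult.commute) (intro ennreal_mult, auto)
  finally have pr_bd: "ennreal \<bar>LINT s|?I. p s + r s\<bar>
      \<le> ennreal e * (ennreal (\<kappa> 0) * (\<integral>\<^sup>+s. Linf_norm \<Omega> (F s) \<partial>?I))"
    by (simp only: mult.assoc)
  have "(LINT s|?I. p s) = (LINT s|?I. p s + r s) - (LINT s|?I. r s)"
    using p r by simp
  then have "\<bar>LINT s|?I. p s\<bar> \<le> \<bar>LINT s|?I. p s + r s\<bar> + \<bar>LINT s|?I. r s\<bar>" by linarith
  then have "ennreal \<bar>LINT s|?I. p s\<bar> \<le> ennreal (\<bar>LINT s|?I. p s + r s\<bar> + \<bar>LINT s|?I. r s\<bar>)"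
    by (rule ennreal_leI)
  also have "\<dots> = ennreal \<bar>LINT s|?I. p s + r s\<bar> + ennreal \<bar>LINT s|?I. r s\<bar>"
    by (rule ennreal_plus) simp_all
  also have "\<dots> \<le> ennreal e * (ennreal (\<kappa> 0) * (\<integral>\<^sup>+s. Linf_norm \<Omega> (F s) \<partial>?I))
      + ennreal e * (ennreal (Psi1 \<kappa> \<kappa>' T t j / 2) * Linf_norm_dual \<Omega> D)"
    by (rule add_mono[OF pr_bd r_bd])
  finally show ?thesis unfolding e_def distrib_left .
qed

section \<open>The residual of the reconstruction\<close>

lemma f_hat_in_L2_and_inner:
  assumes "f (t j) \<in> L2 \<Omega>" "f (t (j - 1)) \<in> L2 \<Omega>"
  shows "f_hat t f j s \<in> L2 \<Omega>"
    and "\<phi> \<in> L2 \<Omega> \<Longrightarrow> L2_inner \<Omega> (f_hat t f j s) \<phi> = L2_inner \<Omega> (f (t j)) \<phi>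
      - (t j - s) / step t j * (L2_inner \<Omega> (f (t j)) \<phi> - L2_inner \<Omega> (f (t (j - 1))) \<phi>)"
proof -
  let ?r = "(t j - s) / step t j"
  have eq: "f_hat t f j s = (\<lambda>x. (1 - ?r) * f (t j) x + ?r * f (t (j - 1)) x)"
    by (rule ext) (simp add: f_hat_def left_diff_distrib right_diff_distrib diff_divide_distrib)
  show "f_hat t f j s \<in> L2 \<Omega>" unfolding eq by (rule L2_lincomb[OF assms])
  show "L2_inner \<Omega> (f_hat t f j s) \<phi> = L2_inner \<Omega> (f (t j)) \<phi>
      - ?r * (L2_inner \<Omega> (f (t j)) \<phi> - L2_inner \<Omega> (f (t (j - 1))) \<phi>)" if "\<phi> \<in> L2 \<Omega>"
    unfolding eq L2_inner_lincomb[OF assms that] by (simp only: left_diff_distrib right_diff_distrib)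
qed

lemma beta_in_L2:
  assumes "f (t j) \<in> L2 \<Omega>" "f (t (j - 1)) \<in> L2 \<Omega>" "f (midpt t j) \<in> L2 \<Omega>"
  shows "beta t f j \<in> L2 \<Omega>"
proof -
  have "beta t f j = (\<lambda>x. (- 4 / (step t j)\<^sup>2) * (1 * f (t j) x + 1 * f (t (j - 1)) x) + (8 / (step t j)\<^sup>2) * f (midpt t j) x)"
    by (rule ext) (simp add: beta_def diff_divide_distrib add_divide_distrib algebra_simps)
  also have "\<dots> \<in> L2 \<Omega>" by (intro L2_lincomb assms)
  finally show ?thesis .
qed

text \<open>\<open>J\<close> is the set of intervals on which the bubble correction is switched on, here and below.\<close>

definition interpolated_load :: "(nat \<Rightarrow> real) \<Rightarrow> (real \<Rightarrow> real ^ 'n \<Rightarrow> real) \<Rightarrow> nat set \<Rightarrow> nat \<Rightarrow> real \<Rightarrow> real ^ 'n \<Rightarrow> real" where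
  "interpolated_load t f J j s = (if j \<in> J then f_tilde t f j s else f_hat t f j s)"

text \<open>The slope in \<open>s\<close> of the functional \<open>K v - F\<close>, which vanishes at the midpoint of the interval; \<open>v\<close> is
the reconstruction and \<open>F\<close> the interpolated load.\<close>

definition residual ::
    "(real ^ 'n) set \<Rightarrow> 'n coefficients \<Rightarrow> (real \<Rightarrow> real ^ 'n \<Rightarrow> real) \<Rightarrow> (nat \<Rightarrow> real) \<Rightarrow>
     (nat \<Rightarrow> real ^ 'n \<Rightarrow> real) \<Rightarrow> (nat \<Rightarrow> real ^ 'n \<Rightarrow> real) \<Rightarrow> nat set \<Rightarrow> nat \<Rightarrow> (real ^ 'n \<Rightarrow> real) \<Rightarrow> real" where
  "residual \<Omega> P f t U q J j \<phi> = delta_psi \<Omega> P f t U j \<phi> - (if j \<in> J then L2_inner \<Omega> (q j) \<phi> else 0)"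

text \<open>On an interval \<open>[a,b]\<close> the scheme expresses the difference quotient of the \<open>y\<close> by the mean of the
\<open>F - L\<close>. What remains of the residual is the difference between a linear interpolant and the mean of
its end values, a multiple of \<open>s - (a + b) / 2\<close>.\<close>

lemma crank_nicolson_algebra:
  fixes a b s :: real
  assumes "a < b" and CN: "(y1 - y0) / (b - a) + (L1 + L0) / 2 = (F1 + F0) / 2"
  shows "(y1 - y0) / (b - a) + ((s - a) / (b - a) * L1 + (b - s) / (b - a) * L0)
    = F1 - (b - s) / (b - a) * (F1 - F0) + (s - (a + b) / 2) * (((L1 - F1) - (L0 - F0)) / (b - a))"
proof -
  define h where "h = b - a"
  define m where "m = (s - (a + b) / 2) / h"
  have h: "h > 0" using assms(1) by (simp add: h_def)
  have 1: "(s - a) / h = 1 / 2 + m" and 2: "(b - s) / h = 1 / 2 - m"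
    using h unfolding m_def h_def by (simp_all add: field_simps)
  have 3: "(s - (a + b) / 2) * (((L1 - F1) - (L0 - F0)) / h) = m * ((L1 - F1) - (L0 - F0))"
    by (simp add: m_def)
  have "X + ((1 / 2 + m) * L1 + (1 / 2 - m) * L0)
      = F1 - (1 / 2 - m) * (F1 - F0) + m * ((L1 - F1) - (L0 - F0))"
    if "X + (L1 + L0) / 2 = (F1 + F0) / 2" for X
  proof -
    have X: "X = (F1 + F0) / 2 - (L1 + L0) / 2" using that by linarith
    show ?thesis unfolding X by (simp add: field_simps)
  qed
  from this[OF CN] show ?thesis unfolding h_def[symmetric] 1 2 3 .
qed

text \<open>Nodal values and bubble corrections are put into one family, indexed by a disjoint sum.\<close>

definition recon_index :: "nat \<Rightarrow> (nat + nat) set" where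
  "recon_index M = {0..M} <+> {1..M}"

definition recon_coeff :: "nat \<Rightarrow> (nat \<Rightarrow> real) \<Rightarrow> nat set \<Rightarrow> nat + nat \<Rightarrow> real \<Rightarrow> real" where
  "recon_coeff M t J = case_sum (hat M t) (bubble t J)"

definition recon_coeff_deriv :: "nat \<Rightarrow> (nat \<Rightarrow> real) \<Rightarrow> nat set \<Rightarrow> nat + nat \<Rightarrow> real \<Rightarrow> real" where
  "recon_coeff_deriv M t J =
     case_sum (\<lambda>i. pw_poly_deriv M t (hat_poly t i)) (\<lambda>i. pw_poly_deriv M t (bubble_poly t J i))"

lemma recon_sum:
  fixes e :: "nat + nat \<Rightarrow> real"
  shows "(\<Sum>k\<in>recon_index M. c k * e k) = (\<Sum>i=0..M. c (Inl i) * e (Inl i)) + (\<Sum>i=1..M. c (Inr i) * e (Inr i))"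
  unfolding recon_index_def by (subst sum.Plus) auto

lemma recon_coeff_fundamental_theorem:
  assumes t: "mesh T M t" "T > 0" and k: "k \<in> recon_index M"
  shows "integrable (lebesgue_on {0..T}) (recon_coeff_deriv M t J k)"
    and "\<tau> \<in> {0..T} \<Longrightarrow> recon_coeff M t J k \<tau>
      = recon_coeff M t J k 0 + (LINT s|lebesgue_on {0..\<tau>}. recon_coeff_deriv M t J k s)"
proof -
  show "integrable (lebesgue_on {0..T}) (recon_coeff_deriv M t J k)"
    by (cases k) (simp_all add: recon_coeff_deriv_def integrable_pw_poly_deriv)
  assume \<tau>: "\<tau> \<in> {0..T}"
  show "recon_coeff M t J k \<tau> = recon_coeff M t J k 0 + (LINT s|lebesgue_on {0..\<tau>}. recon_coeff_deriv M t J k s)"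
  proof (cases k)
    case (Inl i)
    then have i: "i \<in> {0..M}" using k by (auto simp: recon_index_def)
    show ?thesis
      unfolding recon_coeff_def recon_coeff_deriv_def Inl sum.case
      by (rule pw_poly_fundamental_theorem[OF t continuous_on_hat[OF t(1) i] hat_on_interval[OF t(1) i] \<tau>])
  next
    case (Inr i)
    then have i: "i \<in> {1..M}" using k by (auto simp: recon_index_def)
    show ?thesis
      unfolding recon_coeff_def recon_coeff_deriv_def Inr sum.case
      by (rule pw_poly_fundamental_theorem[OF t continuous_on_bubble bubble_on_interval[OF t(1) i] \<tau>])
  qed
qed

text \<open>For \<open>w = u - v\<close> this says \<open>K w = (f - F) - (s - m) D\<close>. In the corrected case the bubble contributes
\<open>- (s - m) q\<^sup>j\<close> through its time derivative and \<open>\<beta>\<^sup>j\<close> times the bubble through \<open>\<L> q\<^sup>j = \<beta>\<^sup>j\<close>, exactly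
the difference between the two interpolants of \<open>f\<close>.\<close>

lemma residual_identity:
  fixes \<Omega> :: "(real ^ 'n) set" and U q :: "nat \<Rightarrow> real ^ 'n \<Rightarrow> real"
  assumes \<Omega>: "open \<Omega>" and P: "elliptic \<Omega> P" and t: "mesh T M t" and j: "j \<in> {1..M}"
    and f: "\<And>s. s \<in> {0..T} \<Longrightarrow> f s \<in> L2 \<Omega>"
    and CN: "crank_nicolson \<Omega> P f u0 M t U"
    and q: "\<And>j. j \<in> {1..M} \<Longrightarrow> elliptic_solution \<Omega> P (beta t f j) (q j)"
    and s: "s \<in> {t (j - 1)<..<t j}" and u: "u s \<in> H10 \<Omega>" and \<phi>: "\<phi> \<in> H10 \<Omega>"
    and eq: "par_op \<Omega> P u u' s \<phi> = L2_inner \<Omega> (f s) \<phi>"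
  shows "par_op \<Omega> P (\<lambda>s x. u s x - (\<Sum>k\<in>recon_index M. recon_coeff M t J k s * case_sum U q k x))
      (\<lambda>s \<phi>. u' s \<phi> - L2_inner \<Omega> (\<lambda>x. \<Sum>k\<in>recon_index M. recon_coeff_deriv M t J k s * case_sum U q k x) \<phi>) s \<phi>
    = L2_inner \<Omega> (\<lambda>x. f s x - interpolated_load t f J j s x) \<phi> - (s - midpt t j) * residual \<Omega> P f t U q J j \<phi>"
proof -
  let ?K = "recon_index M" and ?c = "recon_coeff M t J" and ?dc = "recon_coeff_deriv M t J"
  let ?e = "case_sum U q" and ?a = "t (j - 1)" and ?b = "t j"
  note ab = mesh_bounds[OF t j]
  have \<phi>': "\<phi> \<in> H1 \<Omega>" "\<phi> \<in> L2 \<Omega>" using \<phi> by (auto intro: H10_imp_H1 H10_imp_L2)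
  have U: "U i \<in> H10 \<Omega>" if "i \<in> {0..M}" for i using CN that by (simp add: crank_nicolson_def)
  have qH: "q i \<in> H10 \<Omega>" if "i \<in> {1..M}" for i using q[OF that] by (simp add: elliptic_solution_def)
  have e: "?e k \<in> H10 \<Omega>" if "k \<in> ?K" for k
    using that U qH by (auto simp: recon_index_def)
  have fin: "finite ?K" by (simp add: recon_index_def)
  define y where "y i = L2_inner \<Omega> (U i) \<phi>" for i
  define L where "L i = ell_op \<Omega> P (U i) \<phi>" for i
  define F where "F i = L2_inner \<Omega> (f (t i)) \<phi>" for i
  define p where "p = (?b - s) * (s - ?a) / 2"
  define B where "B = L2_inner \<Omega> (beta t f j) \<phi>"
  define Q where "Q = L2_inner \<Omega> (q j) \<phi>"
  have s': "s \<in> {?a..?b}" "s \<in> {0..T}" using s ab by auto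
  have dsum: "L2_inner \<Omega> (\<lambda>x. \<Sum>k\<in>?K. ?dc k s * ?e k x) \<phi>
      = (y j - y (j - 1)) / step t j + (if j \<in> J then - (s - midpt t j) * Q else 0)"
  proof -
    have "L2_inner \<Omega> (\<lambda>x. \<Sum>k\<in>?K. ?dc k s * ?e k x) \<phi> = (\<Sum>k\<in>?K. ?dc k s * L2_inner \<Omega> (?e k) \<phi>)"
      by (intro L2_inner_sum fin \<phi>' H10_imp_L2 e)
    then show ?thesis
      unfolding recon_sum by (simp only: recon_coeff_deriv_def sum.case
        hat_deriv_sum_on_interval[OF t j s] bubble_deriv_sum_on_interval[OF t j s] y_def Q_def)
  qed
  have Lq: "ell_op \<Omega> P (q j) \<phi> = B"
    using q[OF j] \<phi> by (simp add: elliptic_solution_def B_def)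
  have csum: "ell_op \<Omega> P (\<lambda>x. \<Sum>k\<in>?K. ?c k s * ?e k x) \<phi>
      = ((s - ?a) / step t j * L j + (?b - s) / step t j * L (j - 1)) + (if j \<in> J then p * B else 0)"
  proof -
    have "ell_op \<Omega> P (\<lambda>x. \<Sum>k\<in>?K. ?c k s * ?e k x) \<phi> = (\<Sum>k\<in>?K. ?c k s * ell_op \<Omega> P (?e k) \<phi>)"
      by (intro ell_op_sum \<Omega> P fin \<phi>' H10_imp_H1 e)
    then show ?thesis
      unfolding recon_sum by (simp only: recon_coeff_def sum.case
        hat_sum_on_interval[OF t j s'(1)] bubble_sum_on_interval[OF t j s'(1)] L_def Lq p_def)
  qed
  have diff: "ell_op \<Omega> P (\<lambda>x. u s x - (\<Sum>k\<in>?K. ?c k s * ?e k x)) \<phi>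
      = ell_op \<Omega> P (u s) \<phi> - ell_op \<Omega> P (\<lambda>x. \<Sum>k\<in>?K. ?c k s * ?e k x) \<phi>"
  proof -
    have "ell_op \<Omega> P (\<lambda>x. 1 * u s x + (- 1) * (\<Sum>k\<in>?K. ?c k s * ?e k x)) \<phi>
        = 1 * ell_op \<Omega> P (u s) \<phi> + (- 1) * ell_op \<Omega> P (\<lambda>x. \<Sum>k\<in>?K. ?c k s * ?e k x) \<phi>"
      by (intro ell_op_lincomb \<Omega> P \<phi>' H10_imp_H1 u H1_sum fin e)
    then show ?thesis by simp
  qed
  have fL: "f (t j) \<in> L2 \<Omega>" "f (t (j - 1)) \<in> L2 \<Omega>" "f (midpt t j) \<in> L2 \<Omega>"
    using ab by (auto intro!: f simp: midpt_def step_def field_simps)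
  have loadL: "interpolated_load t f J j s \<in> L2 \<Omega>" and loadI: "L2_inner \<Omega> (interpolated_load t f J j s) \<phi>
      = F j - (?b - s) / step t j * (F j - F (j - 1)) + (if j \<in> J then p * B else 0)"
  proof -
    have tilde: "f_tilde t f j s = (\<lambda>x. 1 * f_hat t f j s x + p * beta t f j x)"
      by (rule ext) (simp add: f_tilde_def p_def)
    show "interpolated_load t f J j s \<in> L2 \<Omega>"
      unfolding interpolated_load_def tilde using f_hat_in_L2_and_inner(1)[OF fL(1,2)] L2_lincomb[OF f_hat_in_L2_and_inner(1)[OF fL(1,2)] beta_in_L2[OF fL]]
      by (cases "j \<in> J") (simp_all only: if_True if_False)
    show "L2_inner \<Omega> (interpolated_load t f J j s) \<phi>
      = F j - (?b - s) / step t j * (F j - F (j - 1)) + (if j \<in> J then p * B else 0)"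
      unfolding interpolated_load_def tilde
      by (cases "j \<in> J"; simp only: if_True if_False
        L2_inner_lincomb[OF f_hat_in_L2_and_inner(1)[OF fL(1,2)] beta_in_L2[OF fL] \<phi>'(2)]
        f_hat_in_L2_and_inner(2)[OF fL(1,2) \<phi>'(2)] F_def B_def; simp only: mult_1 add_0_right)
  qed
  have fload: "L2_inner \<Omega> (\<lambda>x. f s x - interpolated_load t f J j s x) \<phi> = L2_inner \<Omega> (f s) \<phi> - L2_inner \<Omega> (interpolated_load t f J j s) \<phi>"
    using L2_inner_lincomb[OF f[OF s'(2)] loadL \<phi>'(2), of 1 "- 1"] by simp
  have CNj: "(y j - y (j - 1)) / (?b - ?a) + (L j + L (j - 1)) / 2 = (F j + F (j - 1)) / 2"
  proof -
    have UL: "U j \<in> L2 \<Omega>" "U (j - 1) \<in> L2 \<Omega>" using j by (auto intro!: H10_imp_L2 U)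
    have "L2_inner \<Omega> (\<lambda>x. (U j x - U (j - 1) x) / step t j) \<phi> + (L j + L (j - 1)) / 2
        = L2_inner \<Omega> (\<lambda>x. (f (t j) x + f (t (j - 1)) x) / 2) \<phi>"
      using CN j \<phi> unfolding crank_nicolson_def L_def by blast
    moreover have "L2_inner \<Omega> (\<lambda>x. (U j x - U (j - 1) x) / step t j) \<phi> = (y j - y (j - 1)) / step t j"
      using L2_inner_lincomb[OF UL \<phi>'(2), of "1 / step t j" "- 1 / step t j"]
      by (simp add: diff_divide_distrib y_def)
    moreover have "L2_inner \<Omega> (\<lambda>x. (f (t j) x + f (t (j - 1)) x) / 2) \<phi> = (F j + F (j - 1)) / 2"
      using L2_inner_lincomb[OF fL(1,2) \<phi>'(2), of "1 / 2" "1 / 2"]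
      by (simp add: add_divide_distrib F_def)
    ultimately show ?thesis by (simp add: step_def)
  qed
  have res: "residual \<Omega> P f t U q J j \<phi>
      = ((L j - F j) - (L (j - 1) - F (j - 1))) / step t j - (if j \<in> J then Q else 0)"
    by (simp add: residual_def delta_psi_def psi_def L_def F_def Q_def)
  have mid: "midpt t j = (?a + ?b) / 2" by (simp add: midpt_def step_def field_simps)
  have step: "step t j = ?b - ?a" by (simp only: step_def)
  have alg: "(y j - y (j - 1)) / step t j + ((s - ?a) / step t j * L j + (?b - s) / step t j * L (j - 1))
    = F j - (?b - s) / step t j * (F j - F (j - 1))
      + (s - midpt t j) * (((L j - F j) - (L (j - 1) - F (j - 1))) / step t j)"
    unfolding step mid by (rule crank_nicolson_algebra[OF ab(2) CNj])
  have "par_op \<Omega> P (\<lambda>s x. u s x - (\<Sum>k\<in>?K. ?c k s * ?e k x))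
      (\<lambda>s \<phi>. u' s \<phi> - L2_inner \<Omega> (\<lambda>x. \<Sum>k\<in>?K. ?dc k s * ?e k x) \<phi>) s \<phi>
    = L2_inner \<Omega> (f s) \<phi> - L2_inner \<Omega> (\<lambda>x. \<Sum>k\<in>?K. ?dc k s * ?e k x) \<phi>
      - ell_op \<Omega> P (\<lambda>x. \<Sum>k\<in>?K. ?c k s * ?e k x) \<phi>"
    using eq unfolding par_op_def diff by linarith
  also have "\<dots> = L2_inner \<Omega> (f s) \<phi> - L2_inner \<Omega> (interpolated_load t f J j s) \<phi> - (s - midpt t j) * residual \<Omega> P f t U q J j \<phi>"
    unfolding dsum csum loadI res right_diff_distrib[of "s - midpt t j" _ "if j \<in> J then Q else 0"]
    using alg by (cases "j \<in> J"; simp only: if_True if_False; linarith)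
  finally show ?thesis by (simp only: fload)
qed

lemma residual_cong_AE:
  assumes \<Omega>: "open \<Omega>" and P: "elliptic \<Omega> P"
    and U: "U j \<in> H10 \<Omega>" "U (j - 1) \<in> H10 \<Omega>" and f: "f (t j) \<in> L2 \<Omega>" "f (t (j - 1)) \<in> L2 \<Omega>"
    and q: "q j \<in> H10 \<Omega>"
    and \<phi>: "\<phi> \<in> H10 \<Omega>" "\<omega> \<in> H10 \<Omega>" "AE y in lebesgue_on \<Omega>. \<phi> y = \<omega> y"
  shows "residual \<Omega> P f t U q J j \<phi> = residual \<Omega> P f t U q J j \<omega>"
proof -
  have "ell_op \<Omega> P v \<phi> = ell_op \<Omega> P v \<omega>" if "v \<in> H10 \<Omega>" for v
    by (intro ell_op_cong_AE \<Omega> P H10_imp_H1 \<phi> that)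
  moreover have "L2_inner \<Omega> v \<phi> = L2_inner \<Omega> v \<omega>" if "v \<in> L2 \<Omega>" for v
    unfolding L2_inner_commute[of \<Omega> v] by (intro L2_inner_cong_AE H10_imp_L2 \<phi> that)
  ultimately show ?thesis
    unfolding residual_def delta_psi_def psi_def using U f H10_imp_L2[OF q] by simp
qed

section \<open>The error estimate\<close>

text \<open>Membership constrains the coefficients at every index, also at those beyond the mesh, where zero
is used.\<close>

lemma recon_in_reconstructions:
  assumes t: "mesh T M t"
  shows "(\<lambda>s x. \<Sum>k\<in>recon_index M. recon_coeff M t J k s * case_sum U q k x) \<in> reconstructions M t U q"
proof -
  define a where "a i = (if i \<in> {0..M} then hat M t i else (\<lambda>_. 0))" for i
  define b where "b i = (if i \<in> {1..M} then bubble t J i else (\<lambda>_. 0))" for i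
  have zero: "continuous_pw_poly M t (\<lambda>_. 0)"
    by (auto simp: continuous_pw_poly_def intro: exI[of _ 0])
  have "continuous_pw_poly M t (hat M t i)" if "i \<in> {0..M}" for i
    unfolding continuous_pw_poly_def
    using continuous_on_hat[OF t that] hat_on_interval[OF t that] by blast
  moreover have "continuous_pw_poly M t (bubble t J i)" if "i \<in> {1..M}" for i
    unfolding continuous_pw_poly_def
    using continuous_on_bubble bubble_on_interval[OF t that] by blast
  ultimately have ab: "\<forall>i. continuous_pw_poly M t (a i) \<and> continuous_pw_poly M t (b i)"
    using zero by (simp add: a_def b_def)
  have "(\<lambda>s x. \<Sum>k\<in>recon_index M. recon_coeff M t J k s * case_sum U q k x)
      = (\<lambda>s x. (\<Sum>i=0..M. a i s * U i x) + (\<Sum>i=1..M. b i s * q i x))"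
    by (intro ext) (simp add: recon_sum recon_coeff_def a_def b_def)
  with ab show ?thesis unfolding reconstructions_def by blast
qed

text \<open>The representation formula at time \<open>T\<close>, split over the mesh.\<close>

lemma pointwise_error_bound:
  fixes \<Omega> :: "(real ^ 'n) set" and U q :: "nat \<Rightarrow> real ^ 'n \<Rightarrow> real"
  assumes \<Omega>: "open \<Omega>" and T: "T > 0" and P: "elliptic \<Omega> P"
    and f: "\<And>s. s \<in> {0..T} \<Longrightarrow> f s \<in> L2 \<Omega>"
    and u: "parabolic_solution \<Omega> P T f u0 u"
    and G: "green_function \<Omega> P G" and bd: "green_bounds \<Omega> T G \<kappa> \<kappa>' \<gamma>"
    and t: "mesh T M t" and CN: "crank_nicolson \<Omega> P f u0 M t U"
    and q: "\<And>j. j \<in> {1..M} \<Longrightarrow> elliptic_solution \<Omega> P (beta t f j) (q j)"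
    and rep: "\<And>v. v \<in> reconstructions M t U q \<Longrightarrow> green_representation \<Omega> P T G (\<lambda>s x. u s x - v s x)"
    and fin: "\<And>j. j \<in> {1..M} \<Longrightarrow>
      ennreal (Psi1 \<kappa> \<kappa>' T t j / 2) * Linf_norm_dual \<Omega> (residual \<Omega> P f t U q J j) < \<infinity>"
  shows "AE x in lebesgue_on \<Omega>. ennreal \<bar>u T x - U M x\<bar>
    \<le> (\<Sum>j=1..M. ennreal (exp (- \<gamma> * (T - t j))) *
        (ennreal (\<kappa> 0) * (\<integral>\<^sup>+s. Linf_norm \<Omega> (\<lambda>x. f s x - interpolated_load t f J j s x) \<partial>lebesgue_on {t (j - 1)<..<t j})
         + ennreal (Psi1 \<kappa> \<kappa>' T t j / 2) * Linf_norm_dual \<Omega> (residual \<Omega> P f t U q J j)))"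
proof -
  let ?K = "recon_index M" and ?c = "recon_coeff M t J" and ?dc = "recon_coeff_deriv M t J"
  let ?e = "case_sum U q"
  have S: "\<Omega> \<in> sets lebesgue" using \<Omega> by (simp add: borel_open)
  have uH: "u s \<in> H10 \<Omega>" if "s \<in> {0..T}" for s
    using u that unfolding parabolic_solution_def by blast
  have UH: "U i \<in> H10 \<Omega>" if "i \<in> {0..M}" for i using CN that by (simp add: crank_nicolson_def)
  have qH: "q i \<in> H10 \<Omega>" if "i \<in> {1..M}" for i using q[OF that] by (simp add: elliptic_solution_def)
  have eL2: "?e k \<in> L2 \<Omega>" if "k \<in> ?K" for k
    using that UH qH by (auto simp: recon_index_def intro: H10_imp_L2)
  obtain u' where u': "time_deriv \<Omega> T u u'"
    and pde: "AE s in lebesgue_on {0..T}. \<forall>\<phi>\<in>H10 \<Omega>. par_op \<Omega> P u u' s \<phi> = L2_inner \<Omega> (f s) \<phi>"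
    using u unfolding parabolic_solution_def by blast
  define w where "w = (\<lambda>s x. u s x - (\<Sum>k\<in>?K. ?c k s * ?e k x))"
  define w' where "w' = (\<lambda>s \<phi>. u' s \<phi> - L2_inner \<Omega> (\<lambda>x. \<Sum>k\<in>?K. ?dc k s * ?e k x) \<phi>)"
  have "time_deriv \<Omega> T w w'"
    unfolding w_def w'_def
  proof (rule time_deriv_diff_sum[OF u' _ T])
    show "finite ?K" by (simp add: recon_index_def)
    show "u s \<in> L2 \<Omega>" if "s \<in> {0..T}" for s by (rule H10_imp_L2[OF uH[OF that]])
    show "?e k \<in> L2 \<Omega>" if "k \<in> ?K" for k by (rule eL2[OF that])
  qed (fact recon_coeff_fundamental_theorem[OF t T])+
  have "green_representation \<Omega> P T G w"
    unfolding w_def by (rule rep[OF recon_in_reconstructions[OF t]])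
  have repr: "AE x in lebesgue_on \<Omega>.
      integrable (lebesgue_on {0<..<T}) (\<lambda>s. par_op \<Omega> P w w' s (G x (T - s))) \<and>
      w T x = L2_inner \<Omega> (G x T) (w 0) + (LINT s|lebesgue_on {0<..<T}. par_op \<Omega> P w w' s (G x (T - s)))"
  proof -
    have "T \<in> {0<..T}" using T by simp
    with \<open>green_representation \<Omega> P T G w\<close> \<open>time_deriv \<Omega> T w w'\<close> show ?thesis
      unfolding green_representation_def by blast
  qed
  have M: "M \<in> {1..M}" "1 \<in> {1..M}"
    using t T by (cases M; simp add: mesh_def)+
  have wT: "w T x = u T x - U M x" for x
  proof -
    have tM: "t M = T" using t by (simp add: mesh_def)
    have T': "T \<in> {t (M - 1)..t M}" using mesh_bounds[OF t M(1)] tM by simp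
    have "(\<Sum>k\<in>?K. ?c k T * ?e k x) = U M x"
      unfolding recon_sum recon_coeff_def sum.case hat_sum_on_interval[OF t M(1) T']
        bubble_sum_on_interval[OF t M(1) T']
      using mesh_bounds[OF t M(1)] by (simp add: tM step_def)
    then show ?thesis by (simp add: w_def)
  qed
  have w0: "w 0 x = u 0 x - U 0 x" for x
  proof -
    have t0: "t 0 = 0" using t by (simp add: mesh_def)
    have T': "0 \<in> {t (1 - 1)..t 1}" using mesh_bounds[OF t M(2)] t0 by simp
    have "(\<Sum>k\<in>?K. ?c k 0 * ?e k x) = U 0 x"
      unfolding recon_sum recon_coeff_def sum.case hat_sum_on_interval[OF t M(2) T']
        bubble_sum_on_interval[OF t M(2) T']
      using mesh_bounds[OF t M(2)] by (simp add: t0 step_def)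
    then show ?thesis by (simp add: w_def)
  qed
  have w0_zero: "AE x in lebesgue_on \<Omega>. w 0 x = 0"
  proof -
    have "AE x in lebesgue_on \<Omega>. u 0 x = u0 x" "AE x in lebesgue_on \<Omega>. U 0 x = u0 x"
      using u CN unfolding parabolic_solution_def crank_nicolson_def by blast+
    then show ?thesis by eventually_elim (simp add: w0)
  qed
  \<comment> \<open>The reconstruction starts from the exact initial value, so only the time integral contributes.\<close>
  have init: "L2_inner \<Omega> (G x T) (w 0) = 0" for x
    unfolding L2_inner_def
    by (rule integral_eq_zero_AE) (use w0_zero in \<open>eventually_elim, simp\<close>)
  have "AE x in lebesgue_on \<Omega>. x \<in> \<Omega>" by (rule AE_I2) simp
  with repr show ?thesis
  proof eventually_elim
    case (elim x)
    define p where "p s = par_op \<Omega> P w w' s (G x (T - s))" for s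
    have p: "integrable (lebesgue_on {0<..<T}) p" "u T x - U M x = (LINT s|lebesgue_on {0<..<T}. p s)"
      using elim(1) init wT by (simp_all add: p_def[abs_def])
    have x: "x \<in> \<Omega>" by (rule elim(2))
    have "\<bar>u T x - U M x\<bar> \<le> (\<Sum>j=1..M. \<bar>LINT s|lebesgue_on {t (j - 1)<..<t j}. p s\<bar>)"
      unfolding p(2) mesh_integral_split(2)[OF t p(1)] by (rule sum_abs)
    then have "ennreal \<bar>u T x - U M x\<bar> \<le> ennreal (\<Sum>j=1..M. \<bar>LINT s|lebesgue_on {t (j - 1)<..<t j}. p s\<bar>)"
      by (rule ennreal_leI)
    also have "\<dots> = (\<Sum>j=1..M. ennreal \<bar>LINT s|lebesgue_on {t (j - 1)<..<t j}. p s\<bar>)"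
      by (rule sum_ennreal[symmetric]) simp
    also have "\<dots> \<le> (\<Sum>j=1..M. ennreal (exp (- \<gamma> * (T - t j))) *
        (ennreal (\<kappa> 0) * (\<integral>\<^sup>+s. Linf_norm \<Omega> (\<lambda>x. f s x - interpolated_load t f J j s x) \<partial>lebesgue_on {t (j - 1)<..<t j})
         + ennreal (Psi1 \<kappa> \<kappa>' T t j / 2) * Linf_norm_dual \<Omega> (residual \<Omega> P f t U q J j)))"
    proof (rule sum_mono)
      fix j assume j: "j \<in> {1..M}"
      let ?I = "{t (j - 1)<..<t j}"
      note ab = mesh_bounds[OF t j]
      have cong: "residual \<Omega> P f t U q J j \<phi> = residual \<Omega> P f t U q J j \<omega>"
        if "\<phi> \<in> H10 \<Omega>" "\<omega> \<in> H10 \<Omega>" "AE y in lebesgue_on \<Omega>. \<phi> y = \<omega> y" for \<phi> \<omega>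
      proof (rule residual_cong_AE[where q = q, OF \<Omega> P _ _ _ _ qH[OF j]])
        show "U j \<in> H10 \<Omega>" "U (j - 1) \<in> H10 \<Omega>" using j by (auto intro: UH)
        show "f (t j) \<in> L2 \<Omega>" "f (t (j - 1)) \<in> L2 \<Omega>" using ab by (auto intro: f)
      qed (use that in simp_all)
      have "AE s in lebesgue. s \<in> {0..T} \<longrightarrow> (\<forall>\<phi>\<in>H10 \<Omega>. par_op \<Omega> P u u' s \<phi> = L2_inner \<Omega> (f s) \<phi>)"
        using pde by (subst (asm) lebesgue_on_AE_iff) auto
      then have "AE s in lebesgue. s \<in> ?I \<longrightarrow>
          p s = L2_inner \<Omega> (\<lambda>x. f s x - interpolated_load t f J j s x) (G x (T - s)) - (s - midpt t j) * residual \<Omega> P f t U q J j (G x (T - s))"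
      proof eventually_elim
        case (elim s)
        show ?case
        proof
          assume s: "s \<in> ?I"
          then have s': "s \<in> {0..T}" "T - s > 0" using ab by auto
          note \<phi> = green_in_H10_measurable(1)[OF G x s'(2)]
          have "par_op \<Omega> P u u' s (G x (T - s)) = L2_inner \<Omega> (f s) (G x (T - s))" using elim s' \<phi> by blast
          from residual_identity[OF \<Omega> P t j f CN q s uH[OF s'(1)] \<phi> this, of J]
          show "p s = L2_inner \<Omega> (\<lambda>x. f s x - interpolated_load t f J j s x) (G x (T - s)) - (s - midpt t j) * residual \<Omega> P f t U q J j (G x (T - s))"
            unfolding p_def w_def w'_def .
        qed
      qed
      then have eq: "AE s in lebesgue_on ?I. p s = L2_inner \<Omega> (\<lambda>x. f s x - interpolated_load t f J j s x) (G x (T - s))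
          - (s - midpt t j) * residual \<Omega> P f t U q J j (G x (T - s))"
        by (subst lebesgue_on_AE_iff) auto
      show "ennreal \<bar>LINT s|lebesgue_on ?I. p s\<bar> \<le> ennreal (exp (- \<gamma> * (T - t j))) *
        (ennreal (\<kappa> 0) * (\<integral>\<^sup>+s. Linf_norm \<Omega> (\<lambda>x. f s x - interpolated_load t f J j s x) \<partial>lebesgue_on ?I)
         + ennreal (Psi1 \<kappa> \<kappa>' T t j / 2) * Linf_norm_dual \<Omega> (residual \<Omega> P f t U q J j))"
        by (rule interval_contribution[OF S G x bd ab _ fin[OF j] mesh_integral_split(1)[OF t p(1) j] eq])
          (rule cong)
    qed
    finally show ?case .
  qed
qed

text \<open>If the smaller estimator is infinite on some interval, so is the right-hand side. Otherwise all
residual terms are integrable in time and the pointwise bound applies with the best choice of \<open>J\<close>.\<close>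

theorem theorem9:
  fixes \<Omega> :: "(real ^ 'n) set"
    and P :: "'n coefficients"
    and T :: real
    and f :: "real \<Rightarrow> real ^ 'n \<Rightarrow> real"
    and u0 :: "real ^ 'n \<Rightarrow> real"
    and u :: "real \<Rightarrow> real ^ 'n \<Rightarrow> real"
    and G :: "real ^ 'n \<Rightarrow> real \<Rightarrow> real ^ 'n \<Rightarrow> real"
    and \<kappa> \<kappa>' :: "nat \<Rightarrow> real"
    and \<gamma> :: real
    and M :: nat
    and t :: "nat \<Rightarrow> real"
    and U q :: "nat \<Rightarrow> real ^ 'n \<Rightarrow> real"
  assumes "lipschitz_domain \<Omega>"
    and "T > 0"
    and "elliptic \<Omega> P"
    and "\<forall>s\<in>{0..T}. f s \<in> L2 \<Omega>"
    and "parabolic_solution \<Omega> P T f u0 u"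
    and "green_function \<Omega> P G"
    and "\<forall>w\<in>W11_H10 \<Omega> T. green_representation \<Omega> P T G w"
    and "green_bounds \<Omega> T G \<kappa> \<kappa>' \<gamma>"
    and "mesh T M t"
    and "crank_nicolson \<Omega> P f u0 M t U"
    and "\<forall>j\<in>{1..M}. unique_elliptic_solution \<Omega> P (beta t f j) (q j)"
    and "\<forall>v\<in>reconstructions M t U q. green_representation \<Omega> P T G (\<lambda>s x. u s x - v s x)"
  shows "Linf_norm \<Omega> (\<lambda>x. u T x - U M x)
    \<le> (\<Sum>j=1..M. ennreal (exp (- \<gamma> * (T - t j))) *
          min (eta_f_hat \<Omega> \<kappa> f t j + eta_delta_psi \<Omega> P \<kappa> \<kappa>' T f t U j)
              (eta_f_tilde \<Omega> \<kappa> f t j + eta_delta_psi_q \<Omega> P \<kappa> \<kappa>' T f t U q j))"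
proof -
  have \<Omega>: "open \<Omega>" using assms(1) by (simp add: lipschitz_domain_def)
  define \<eta> where "\<eta> j = min (eta_f_hat \<Omega> \<kappa> f t j + eta_delta_psi \<Omega> P \<kappa> \<kappa>' T f t U j)
      (eta_f_tilde \<Omega> \<kappa> f t j + eta_delta_psi_q \<Omega> P \<kappa> \<kappa>' T f t U q j)" for j
  \<comment> \<open>On each interval the reconstruction is adapted to the smaller of the two estimators.\<close>
  define J where "J = {j. eta_f_tilde \<Omega> \<kappa> f t j + eta_delta_psi_q \<Omega> P \<kappa> \<kappa>' T f t U q j
      \<le> eta_f_hat \<Omega> \<kappa> f t j + eta_delta_psi \<Omega> P \<kappa> \<kappa>' T f t U j}"
  have \<eta>: "\<eta> j = ennreal (\<kappa> 0) * (\<integral>\<^sup>+s. Linf_norm \<Omega> (\<lambda>x. f s x - interpolated_load t f J j s x) \<partial>lebesgue_on {t (j - 1)<..<t j})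
      + ennreal (Psi1 \<kappa> \<kappa>' T t j / 2) * Linf_norm_dual \<Omega> (residual \<Omega> P f t U q J j)" for j
  proof (cases "j \<in> J")
    case True
    then have "\<eta> j = eta_f_tilde \<Omega> \<kappa> f t j + eta_delta_psi_q \<Omega> P \<kappa> \<kappa>' T f t U q j"
      unfolding \<eta>_def J_def mem_Collect_eq by (rule min_absorb2)
    moreover have "residual \<Omega> P f t U q J j = (\<lambda>\<phi>. delta_psi \<Omega> P f t U j \<phi> - L2_inner \<Omega> (q j) \<phi>)"
      using True by (intro ext) (simp add: residual_def)
    ultimately show ?thesis using True by (simp add: eta_f_tilde_def eta_delta_psi_q_def interpolated_load_def)
  next
    case False
    then have "\<eta> j = eta_f_hat \<Omega> \<kappa> f t j + eta_delta_psi \<Omega> P \<kappa> \<kappa>' T f t U j"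
      unfolding \<eta>_def J_def mem_Collect_eq by (intro min_absorb1) simp
    moreover have "residual \<Omega> P f t U q J j = delta_psi \<Omega> P f t U j"
      using False by (intro ext) (simp add: residual_def)
    ultimately show ?thesis using False by (simp add: eta_f_hat_def eta_delta_psi_def interpolated_load_def)
  qed
  have "Linf_norm \<Omega> (\<lambda>x. u T x - U M x) \<le> (\<Sum>j=1..M. ennreal (exp (- \<gamma> * (T - t j))) * \<eta> j)"
  proof (cases "\<exists>j\<in>{1..M}. \<eta> j = \<infinity>")
    case True
    then obtain j where j: "j \<in> {1..M}" "\<eta> j = \<infinity>" by blast
    have "ennreal (exp (- \<gamma> * (T - t j))) * \<eta> j = \<infinity>"
      using j(2) by (simp add: ennreal_mult_top)
    moreover have "ennreal (exp (- \<gamma> * (T - t j))) * \<eta> j \<le> (\<Sum>j=1..M. ennreal (exp (- \<gamma> * (T - t j))) * \<eta> j)"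
      using j(1) by (intro member_le_sum) auto
    ultimately have "top \<le> (\<Sum>j=1..M. ennreal (exp (- \<gamma> * (T - t j))) * \<eta> j)"
      by (simp only: infinity_ennreal_def)
    then show ?thesis by (rule order_trans[OF top_greatest])
  next
    case False
    have "AE x in lebesgue_on \<Omega>. ennreal \<bar>u T x - U M x\<bar> \<le> (\<Sum>j=1..M. ennreal (exp (- \<gamma> * (T - t j))) * \<eta> j)"
      unfolding \<eta>
    proof (rule pointwise_error_bound[OF \<Omega> assms(2,3) _ assms(5,6,8,9,10)])
      show "f s \<in> L2 \<Omega>" if "s \<in> {0..T}" for s using assms(4) that by blast
      show "elliptic_solution \<Omega> P (beta t f j) (q j)" if "j \<in> {1..M}" for j
        using assms(11) that by (simp add: unique_elliptic_solution_def)
      show "green_representation \<Omega> P T G (\<lambda>s x. u s x - v s x)" if "v \<in> reconstructions M t U q" for v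
        using assms(12) that by blast
      show "ennreal (Psi1 \<kappa> \<kappa>' T t j / 2) * Linf_norm_dual \<Omega> (residual \<Omega> P f t U q J j) < \<infinity>" if "j \<in> {1..M}" for j
      proof -
        have "\<eta> j < \<infinity>" using False that by (auto simp: top.not_eq_extremum)
        then show ?thesis unfolding \<eta> by simp
      qed
    qed
    moreover have "(\<lambda>x. ennreal \<bar>u T x - U M x\<bar>) \<in> borel_measurable (lebesgue_on \<Omega>)"
    proof -
      have "u T \<in> H10 \<Omega>" using assms(2,5) by (simp add: parabolic_solution_def)
      moreover have "U M \<in> H10 \<Omega>" using assms(10) by (simp add: crank_nicolson_def)
      ultimately show ?thesis
        by (intro measurable_compose[OF _ measurable_ennreal] borel_measurable_abs borel_measurable_diff
          L2_measurable H10_imp_L2)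
    qed
    ultimately show ?thesis unfolding Linf_norm_def by (intro esssup_I)
  qed
  then show ?thesis unfolding \<eta>_def .
qed

end
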